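(* Consider the $(n_0,n_1,\ldots,n_N)$ multihop channel used with the amplify-and-forward (AF) scheme. The resulting end-to-end channel has the same DMT as the $(n_N,n_{N-1},\ldots,n_0)$ Rayleigh product channel, i.e. $$d^{\rm AF}(r)=d^{\rm RP}(r)\quad\text{for all } r .$$
   Context: Multihop channel: layers $0,\ldots,N$ with $n_i$ antennas in layer $i$; $\mathbf y_i=\mathbf H_i\mathbf x_{i-1}+\mathbf z_i$, $i=1,\ldots,N$, where $\mathbf H_i\in\mathbb C^{n_i\times n_{i-1}}$ are mutually independent with i.i.d. $\mathcal{CN}(0,1)$ entries, and $\mathbf z_i$ are independent noises with i.i.d. $\mathcal{CN}(0,1)$ entries; $\mathbb E\|\mathbf x_i\|^2\le\mathsf{SNR}$. AF scheme: $\mathbf x_i=\mathbf D_i\mathbf y_i$, $i=1,\ldots,N-1$, where $\mathbf D_i$ is the $n_i\times n_i$ diagonal matrix with $$\mathbf D_i(j,j)=\min\left\{\kappa,\ \sqrt{\frac{1}{\frac{\mathsf{SNR}}{n_{i-1}}\sum_{k=1}^{n_{i-1}}|\mathbf H_i(j,k)|^2+1}}\cdot\sqrt{\frac{\mathsf{SNR}}{n_i}}\right\},$$ with $0<\kappa<\infty$ a constant independent of $\mathsf{SNR}$. With the conventions $\mathbf D_N:=\mathbf I$, $\mathbf H_{N+1}:=\mathbf I$ and $\prod_{i=a}^{b}\mathbf M_i:=\mathbf M_b\cdots\mathbf M_a$, the end-to-end channel is $$\mathbf y_N=\Big(\prod_{i=1}^N\mathbf D_i\mathbf H_i\Big)\mathbf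 x_0+\sum_{j=1}^N\Big(\prod_{i=j}^N\mathbf H_{i+1}\mathbf D_i\Big)\mathbf z_j .$$ In whitened form it is the MIMO channel with matrix $\sqrt{\mathbf R}\,\prod_{i=1}^N\mathbf D_i\mathbf H_i$ and unit white noise, where $\mathbf R^{-1}$ is the conditional covariance of the accumulated noise given the $\mathbf H_i$'s. Rayleigh product (RP) channel of dimension $(m_0,\ldots,m_N)$: the MIMO channel with matrix $\mathbf G_1\mathbf G_2\cdots\mathbf G_N$, where $\mathbf G_i\in\mathbb C^{m_{i-1}\times m_i}$ are independent with i.i.d. $\mathcal{CN}(0,1)$ entries. DMT: for a MIMO fading channel with matrix $\mathbf H$ (unit white noise, input power proportional to $\mathsf{SNR}$), $P_{\rm out}(\mathsf{SNR},R)=\mathsf P\{\log\det(\mathbf I+\mathsf{SNR}\,\mathbf H\mathbf H^\dagger)<R\}$ (constant scalings of $\mathsf{SNR}$ are immaterial) and $d(r)=-\lim_{\mathsf{SNR}\to\infty}\log P_{\rm out}(\mathsf{SNR},R)/\log\mathsf{SNR}$, where $R=r\log\mathsf{SNR}$ for $r>0$ and $R>0$ is any fixed rate for $r=0$. *)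

theory Defs
  imports
    "HOL-Probability.Probability"
    "Jordan_Normal_Form.Schur_Decomposition"
begin

unbundle no vec_syntax
hide_const (open) Finite_Cartesian_Product.mat Finite_Cartesian_Product.vec
  Determinants.det Finite_Cartesian_Product.row Finite_Cartesian_Product.column

text \<open>
  Conventions: the rows and columns of matrices are numbered from 0, the layers of the
  multihop channel run from 0 to N, and the hops from 1 to N. The SNR is the real
  variable \<open>\<rho>\<close>. Random matrices and vectors are functions on the sample space.
\<close>

section \<open>Matrices\<close>

text \<open>
  Product of the matrices of a list from left to right; \<open>d\<close> is the number of columns of the
  result, so that the empty product is the identity matrix of size \<open>d\<close>.
\<close>
definition mat_prod_list :: "nat \<Rightarrow> complex mat list \<Rightarrow> complex mat" where
  "mat_prod_list d Ms = foldr (*) Ms (1\<^sub>m d)"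

definition psd :: "complex mat \<Rightarrow> bool" where
  "psd A \<longleftrightarrow> A \<in> carrier_mat (dim_row A) (dim_row A) \<and> mat_adjoint A = A \<and>
     (\<forall>v \<in> carrier_vec (dim_row A). 0 \<le> Re ((A *\<^sub>v v) \<bullet>c v))"

text \<open>A positive semidefinite matrix has exactly one positive semidefinite square root.\<close>
definition psd_sqrt :: "complex mat \<Rightarrow> complex mat" where
  "psd_sqrt A = (SOME S. psd S \<and> dim_row S = dim_row A \<and> S * S = A)"

section \<open>Gaussian variables\<close>

text \<open>
  The density of the circularly symmetric complex normal law of mean 0 and variance 1 with
  respect to Lebesgue measure on the complex plane.
\<close>
definition complex_std_normal :: "'w measure \<Rightarrow> ('w \<Rightarrow> complex) \<Rightarrow> bool" where
  "complex_std_normal M X \<longleftrightarrow> distributed M lborel X (\<lambda>w. ennreal (exp (- (cmod w)\<^sup>2) / pi))"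

definition covariance_mat :: "'w measure \<Rightarrow> nat \<Rightarrow> ('w \<Rightarrow> complex vec) \<Rightarrow> complex mat" where
  "covariance_mat M d v = mat d d (\<lambda>(a, b).
     LINT \<omega>|M. (v \<omega> $ a - (LINT \<omega>'|M. v \<omega>' $ a)) * cnj (v \<omega> $ b - (LINT \<omega>'|M. v \<omega>' $ b)))"

section \<open>Outage probability and diversity-multiplexing tradeoff\<close>

definition outage_prob :: "'w measure \<Rightarrow> ('w \<Rightarrow> complex mat) \<Rightarrow> real \<Rightarrow> real \<Rightarrow> real" where
  "outage_prob M C \<rho> R = measure M {\<omega> \<in> space M.
     ln (Re (det (1\<^sub>m (dim_row (C \<omega>)) + of_real \<rho> \<cdot>\<^sub>m (C \<omega> * mat_adjoint (C \<omega>))))) < R}"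

text \<open>The target rates, as functions of the SNR, that have multiplexing gain \<open>r\<close>.\<close>
definition rate_of_gain :: "real \<Rightarrow> (real \<Rightarrow> real) \<Rightarrow> bool" where
  "rate_of_gain r R \<longleftrightarrow>
     (if r = 0 then \<exists>R0 > 0. R = (\<lambda>\<rho>. R0) else R = (\<lambda>\<rho>. r * ln \<rho>))"

text \<open>
  \<open>has_dmt M C r d\<close> says that the limit defining the diversity gain at multiplexing gain \<open>r\<close>
  exists and equals \<open>d\<close>. The channel matrix \<open>C \<rho>\<close> may itself depend on the SNR \<open>\<rho>\<close>, as it does
  under amplify-and-forward.
\<close>
definition has_dmt :: "'w measure \<Rightarrow> (real \<Rightarrow> 'w \<Rightarrow> complex mat) \<Rightarrow> real \<Rightarrow> real \<Rightarrow> bool" where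
  "has_dmt M C r d \<longleftrightarrow> (\<forall>R. rate_of_gain r R \<longrightarrow>
     ((\<lambda>\<rho>. - (ln (outage_prob M (C \<rho>) \<rho> (R \<rho>)) / ln \<rho>)) \<longlongrightarrow> d) at_top)"

section \<open>The Rayleigh product channel\<close>

definition rayleigh_product :: "'w measure \<Rightarrow> nat \<Rightarrow> (nat \<Rightarrow> nat) \<Rightarrow> (nat \<Rightarrow> 'w \<Rightarrow> complex mat) \<Rightarrow> bool"
  where
  "rayleigh_product M N m G \<longleftrightarrow>
     (\<forall>i \<in> {1..N}. \<forall>\<omega> \<in> space M. G i \<omega> \<in> carrier_mat (m (i - 1)) (m i)) \<and>
     (\<forall>i \<in> {1..N}. \<forall>j < m (i - 1). \<forall>k < m i. complex_std_normal M (\<lambda>\<omega>. G i \<omega> $$ (j, k))) \<and>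
     prob_space.indep_vars M (\<lambda>_. borel) (\<lambda>(i, j, k) \<omega>. G i \<omega> $$ (j, k))
       (SIGMA i:{1..N}. {..<m (i - 1)} \<times> {..<m i})"

definition rp_matrix :: "nat \<Rightarrow> (nat \<Rightarrow> nat) \<Rightarrow> (nat \<Rightarrow> 'w \<Rightarrow> complex mat) \<Rightarrow> 'w \<Rightarrow> complex mat" where
  "rp_matrix N m G \<omega> = mat_prod_list (m N) (map (\<lambda>i. G i \<omega>) [1..<N + 1])"

section \<open>The multihop channel with amplify-and-forward\<close>

text \<open>
  All fading coefficients and all noise samples together form one independent family; it is
  indexed by the disjoint sum of the two index sets.
\<close>
definition multihop :: "'w measure \<Rightarrow> nat \<Rightarrow> (nat \<Rightarrow> nat) \<Rightarrow>
    (nat \<Rightarrow> 'w \<Rightarrow> complex mat) \<Rightarrow> (nat \<Rightarrow> 'w \<Rightarrow> complex vec) \<Rightarrow> bool" where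
  "multihop M N n H z \<longleftrightarrow>
     (\<forall>i \<in> {1..N}. \<forall>\<omega> \<in> space M.
        H i \<omega> \<in> carrier_mat (n i) (n (i - 1)) \<and> z i \<omega> \<in> carrier_vec (n i)) \<and>
     (\<forall>i \<in> {1..N}. \<forall>j < n i. \<forall>k < n (i - 1). complex_std_normal M (\<lambda>\<omega>. H i \<omega> $$ (j, k))) \<and>
     (\<forall>i \<in> {1..N}. \<forall>j < n i. complex_std_normal M (\<lambda>\<omega>. z i \<omega> $ j)) \<and>
     prob_space.indep_vars M (\<lambda>_. borel)
       (case_sum (\<lambda>(i, j, k) \<omega>. H i \<omega> $$ (j, k)) (\<lambda>(i, j) \<omega>. z i \<omega> $ j))
       ((SIGMA i:{1..N}. {..<n i} \<times> {..<n (i - 1)}) <+> (SIGMA i:{1..N}. {..<n i}))"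

text \<open>In the next four definitions, \<open>h i\<close> is a realization of the \<open>i\<close>-th channel matrix.\<close>

definition af_relay :: "nat \<Rightarrow> (nat \<Rightarrow> nat) \<Rightarrow> real \<Rightarrow> real \<Rightarrow> (nat \<Rightarrow> complex mat) \<Rightarrow> nat \<Rightarrow> complex mat"
  where
  "af_relay N n \<kappa> \<rho> h i = (if i = N then 1\<^sub>m (n N) else
     mat_diag (n i) (\<lambda>j. of_real (min \<kappa>
       (sqrt (1 / (\<rho> / real (n (i - 1)) * (\<Sum>k < n (i - 1). (cmod (h i $$ (j, k)))\<^sup>2) + 1))
        * sqrt (\<rho> / real (n i))))))"

definition af_signal_mat :: "nat \<Rightarrow> (nat \<Rightarrow> nat) \<Rightarrow> real \<Rightarrow> real \<Rightarrow> (nat \<Rightarrow> complex mat) \<Rightarrow> complex mat"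
  where
  "af_signal_mat N n \<kappa> \<rho> h =
     mat_prod_list (n 0) (map (\<lambda>i. af_relay N n \<kappa> \<rho> h i * h i) (rev [1..<N + 1]))"

definition af_noise_mat :: "nat \<Rightarrow> (nat \<Rightarrow> nat) \<Rightarrow> real \<Rightarrow> real \<Rightarrow> (nat \<Rightarrow> complex mat) \<Rightarrow> nat \<Rightarrow> complex mat"
  where
  "af_noise_mat N n \<kappa> \<rho> h j =
     mat_prod_list (n j)
       (map (\<lambda>i. (if i = N then 1\<^sub>m (n N) else h (i + 1)) * af_relay N n \<kappa> \<rho> h i) (rev [j..<N + 1]))"

definition af_noise :: "nat \<Rightarrow> (nat \<Rightarrow> nat) \<Rightarrow> real \<Rightarrow> real \<Rightarrow> (nat \<Rightarrow> complex mat) \<Rightarrow>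
    (nat \<Rightarrow> complex vec) \<Rightarrow> complex vec" where
  "af_noise N n \<kappa> \<rho> h zs = vec (n N) (\<lambda>a. \<Sum>j = 1..N. (af_noise_mat N n \<kappa> \<rho> h j *\<^sub>v zs j) $ a)"

text \<open>
  Since the noise is independent of the fading, the conditional covariance of the accumulated
  noise given the channel matrices is, at the outcome \<open>\<omega>\<close>, its covariance with the channel
  matrices frozen at their values at \<open>\<omega>\<close>.
\<close>
definition af_noise_cov :: "'w measure \<Rightarrow> nat \<Rightarrow> (nat \<Rightarrow> nat) \<Rightarrow> real \<Rightarrow> (nat \<Rightarrow> 'w \<Rightarrow> complex mat) \<Rightarrow>
    (nat \<Rightarrow> 'w \<Rightarrow> complex vec) \<Rightarrow> real \<Rightarrow> 'w \<Rightarrow> complex mat" where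
  "af_noise_cov M N n \<kappa> H z \<rho> \<omega> =
     covariance_mat M (n N) (\<lambda>\<omega>'. af_noise N n \<kappa> \<rho> (\<lambda>i. H i \<omega>) (\<lambda>j. z j \<omega>'))"

definition af_matrix :: "'w measure \<Rightarrow> nat \<Rightarrow> (nat \<Rightarrow> nat) \<Rightarrow> real \<Rightarrow> (nat \<Rightarrow> 'w \<Rightarrow> complex mat) \<Rightarrow>
    (nat \<Rightarrow> 'w \<Rightarrow> complex vec) \<Rightarrow> real \<Rightarrow> 'w \<Rightarrow> complex mat" where
  "af_matrix M N n \<kappa> H z \<rho> \<omega> =
     psd_sqrt (the (mat_inverse (af_noise_cov M N n \<kappa> H z \<rho> \<omega>)))
       * af_signal_mat N n \<kappa> \<rho> (\<lambda>i. H i \<omega>)"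

end

theory Submission
  imports Defs "Jordan_Normal_Form.Spectral_Radius" "HOL-Real_Asymp.Real_Asymp"
begin

text \<open>
  Attach each relay matrix to the next hop, so that the signal matrix becomes
  \<open>(H\<^sub>N D\<^sub>N\<^sub>-\<^sub>1) \<dots> (H\<^sub>2 D\<^sub>1) H\<^sub>1\<close>. Given the earlier hops, the entries of each
  factor are Gaussian variables multiplied by constants. The Gaussian density decreases along rays, so
  multiplying a coordinate by a factor in \<open>[a, 1]\<close> changes the probability of no event by more than
  a factor \<open>a\<^sup>-\<^sup>2\<close>. Except on an event of superpolynomially small probability all fading coefficients
  are at most \<open>ln \<rho>\<close> in modulus, and then the relay gains and the noise covariance are bounded from
  above and below by powers of \<open>ln \<rho>\<close>. Since the outage probability increases when the noise does,
  the two outage probabilities differ by polylogarithmic factors and a superpolynomially small error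
  only. The Rayleigh product outage probability is at least polynomial in \<open>1 / \<rho>\<close>, again by scaling,
  so the two exponents agree, and neither has to be computed.
\<close>

section \<open>Scaling of complex Gaussian coordinates\<close>

text \<open>The determinants cannot be compared realization by realization: unequal gains may
  enlarge a product, as in \<open>(1, -1) diag(1, 1/2) (1, 1)^T = 1/2\<close>, where equal gains
  give 0. A factor common to all coefficients does act monotonically, being a change of SNR. Unequal
  gains are therefore compared through probabilities, and this requires a gain to be constant once
  the earlier hops are fixed. The matrix \<open>D_i\<close> is a function of \<open>H_i\<close>, so
  \<open>D_i H_i\<close> lacks this property, while \<open>H_{i+1} D_i\<close> has it.

  Gains have a useful lower bound only where the fading is bounded, but conditioning on that event
  would couple the coordinates. Instead the gains are clamped from below everywhere: the clamped
  gain still depends on the previous hop only, and it agrees with the true gain outside the rare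
  event.

  The bound \<open>ln \<rho>\<close> on the fading is a compromise. A power of it costs nothing in
  an exponent, because \<open>ln (ln \<rho>) / ln \<rho>\<close> tends to 0, while the Gaussian tail
  \<open>exp (- (ln \<rho>)^2 / 2)\<close> is still negligible against a polynomially small outage
  probability.\<close>

definition cgauss_density :: "complex \<Rightarrow> ennreal" where
  "cgauss_density w = ennreal (exp (- (cmod w)\<^sup>2) / pi)"

definition cgauss :: "complex measure" where
  "cgauss = density lborel cgauss_density"

lemma measurable_cgauss_density [measurable]: "cgauss_density \<in> borel_measurable borel"
  unfolding cgauss_density_def by measurable

lemma sets_cgauss [simp, measurable_cong]: "sets cgauss = sets borel"
  and space_cgauss [simp]: "space cgauss = UNIV"
  by (simp_all add: cgauss_def)

lemma complex_std_normalD: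
  assumes "complex_std_normal M X"
  shows "X \<in> borel_measurable M" "distr M borel X = cgauss"
proof -
  have D: "distributed M lborel X (\<lambda>w. ennreal (exp (- (cmod w)\<^sup>2) / pi))"
    using assms by (simp add: complex_std_normal_def)
  show "X \<in> borel_measurable M"
    using distributed_measurable[OF D] by (simp add: measurable_lborel1)
  have "distr M borel X = distr M lborel X" by (rule distr_cong) auto
  also have "\<dots> = cgauss"
    using distributed_distr_eq_density[OF D] by (simp add: cgauss_def cgauss_density_def[abs_def])
  finally show "distr M borel X = cgauss" .
qed

text \<open>The exponent 2 is the real dimension of the complex plane.\<close>

lemma nn_integral_lborel_scaleR:
  fixes f :: "complex \<Rightarrow> ennreal"
  assumes [measurable]: "f \<in> borel_measurable borel" and c: "c > 0"
  shows "(\<integral>\<^sup>+ w. f (of_real c * w) \<partial>lborel) = ennreal (1 / c\<^sup>2) * (\<integral>\<^sup>+ w. f w \<partial>lborel)"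
proof -
  have "(\<integral>\<^sup>+ w. f w \<partial>lborel)
      = (\<integral>\<^sup>+ w. f w \<partial>(density (distr lborel borel (\<lambda>x. 0 + c *\<^sub>R x)) (\<lambda>x. ennreal (\<bar>c\<bar> ^ DIM(complex)))))"
    using c by (subst lborel_affine[of c 0]) auto
  also have "\<dots> = (\<integral>\<^sup>+ w. ennreal (c\<^sup>2) * f (of_real c * w) \<partial>lborel)"
    using c by (subst nn_integral_density, simp, simp, subst nn_integral_distr)
      (simp_all add: scaleR_conv_of_real)
  also have "\<dots> = ennreal (c\<^sup>2) * (\<integral>\<^sup>+ w. f (of_real c * w) \<partial>lborel)"
    by (rule nn_integral_cmult) simp
  finally have "ennreal (1 / c\<^sup>2) * (\<integral>\<^sup>+ w. f w \<partial>lborel)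
      = (ennreal (1 / c\<^sup>2) * ennreal (c\<^sup>2)) * (\<integral>\<^sup>+ w. f (of_real c * w) \<partial>lborel)"
    by (simp add: mult.assoc)
  also have "ennreal (1 / c\<^sup>2) * ennreal (c\<^sup>2) = 1"
    using c by (subst ennreal_mult[symmetric]) auto
  finally show ?thesis by simp
qed

text \<open>Substituting \<open>v = u w\<close> yields the Jacobian \<open>1 / u^2\<close> and the
  density at \<open>v / u\<close>. Since \<open>u \<le> 1\<close>, that point is farther from the
  origin than \<open>v\<close>, so the density there is at most the density at \<open>v\<close>. For
  \<open>u > 1\<close> the ratio of the densities would be unbounded.\<close>

lemma nn_integral_cgauss_scale_le:
  fixes f :: "complex \<Rightarrow> ennreal"
  assumes [measurable]: "f \<in> borel_measurable borel" and u: "0 < u" "u \<le> 1"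
  shows "(\<integral>\<^sup>+ w. f (of_real u * w) \<partial>cgauss) \<le> ennreal (1 / u\<^sup>2) * (\<integral>\<^sup>+ w. f w \<partial>cgauss)"
proof -
  let ?g = cgauss_density
  have g_mono: "?g (of_real (1 / u) * w) \<le> ?g w" for w
  proof -
    have "(cmod w)\<^sup>2 \<le> (cmod (of_real (1 / u) * w))\<^sup>2"
      using u by (intro power_mono) (auto simp: norm_mult norm_divide field_simps intro: mult_right_le_one_le mult_left_le_one_le)
    thus ?thesis unfolding cgauss_density_def by (intro ennreal_leI divide_right_mono) auto
  qed
  have "(\<integral>\<^sup>+ w. f (of_real u * w) \<partial>cgauss) = (\<integral>\<^sup>+ w. ?g w * f (of_real u * w) \<partial>lborel)"
    unfolding cgauss_def by (subst nn_integral_density) auto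
  also have "\<dots> = (\<integral>\<^sup>+ w. (\<lambda>v. ?g (of_real (1 / u) * v) * f v) (of_real u * w) \<partial>lborel)"
    using u by (intro nn_integral_cong) (simp add: field_simps)
  also have "\<dots> = ennreal (1 / u\<^sup>2) * (\<integral>\<^sup>+ v. ?g (of_real (1 / u) * v) * f v \<partial>lborel)"
    using u by (subst nn_integral_lborel_scaleR) auto
  also have "\<dots> \<le> ennreal (1 / u\<^sup>2) * (\<integral>\<^sup>+ v. ?g v * f v \<partial>lborel)"
    by (intro mult_left_mono nn_integral_mono mult_right_mono g_mono) auto
  also have "(\<integral>\<^sup>+ v. ?g v * f v \<partial>lborel) = (\<integral>\<^sup>+ w. f w \<partial>cgauss)"
    unfolding cgauss_def by (subst nn_integral_density) auto
  finally show ?thesis .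
qed

text \<open>Half of the exponent is kept as an integrable majorant; the other half pays for a tail
  factor or for a second moment.\<close>

lemma cgauss_density_scale: "cgauss_density (of_real (1 / sqrt 2) * w) = ennreal (exp (- ((cmod w)\<^sup>2 / 2)) / pi)"
  by (simp add: cgauss_density_def norm_mult power_mult_distrib norm_divide power_divide)

text \<open>The total mass of \<open>cgauss\<close> is taken from the hypothesis, so no Gaussian
  integral has to be evaluated; the dilation by \<open>1 / sqrt 2\<close> then doubles it.\<close>

lemma nn_integral_cgauss_density_scale:
  assumes "prob_space cgauss"
  shows "(\<integral>\<^sup>+ w. ennreal c * cgauss_density (of_real (1 / sqrt 2) * w) \<partial>lborel) = ennreal c * 2"
proof -
  interpret prob_space cgauss by fact
  have "(\<integral>\<^sup>+ w. cgauss_density w \<partial>lborel) = 1"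
    using emeasure_space_1 by (simp add: cgauss_def emeasure_density)
  thus ?thesis
    by (subst nn_integral_cmult, simp, subst nn_integral_lborel_scaleR) (simp_all add: power_divide)
qed

abbreviation "cgauss_prod S \<equiv> PiM S (\<lambda>_. cgauss)"

lemma emeasure_cgauss_tail:
  assumes P: "prob_space cgauss" and B: "B \<ge> 0"
  shows "emeasure cgauss {w. cmod w > B} \<le> ennreal (2 * exp (- B\<^sup>2 / 2))"
proof -
  have "emeasure cgauss {w. cmod w > B} = (\<integral>\<^sup>+ w. cgauss_density w * indicator {w. cmod w > B} w \<partial>lborel)"
    unfolding cgauss_def by (subst emeasure_density) auto
  also have "\<dots> \<le> (\<integral>\<^sup>+ w. ennreal (exp (- B\<^sup>2 / 2)) * cgauss_density (of_real (1 / sqrt 2) * w) \<partial>lborel)"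
  proof (intro nn_integral_mono)
    fix w :: complex
    show "cgauss_density w * indicator {w. cmod w > B} w
        \<le> ennreal (exp (- B\<^sup>2 / 2)) * cgauss_density (of_real (1 / sqrt 2) * w)"
    proof (cases "cmod w > B")
      case True
      have "B\<^sup>2 \<le> (cmod w)\<^sup>2" using True B by (intro power_mono) auto
      hence "exp (- (cmod w)\<^sup>2) \<le> exp (- B\<^sup>2 / 2) * exp (- ((cmod w)\<^sup>2 / 2))"
        by (subst mult_exp_exp) simp
      thus ?thesis using True unfolding cgauss_density_scale
        by (simp add: cgauss_density_def ennreal_mult[symmetric] divide_right_mono)
    qed simp
  qed
  also have "\<dots> = ennreal (exp (- B\<^sup>2 / 2)) * 2" by (rule nn_integral_cgauss_density_scale[OF P])
  also have "\<dots> = ennreal (2 * exp (- B\<^sup>2 / 2))"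
    by (simp add: ennreal_mult mult.commute)
  finally show ?thesis .
qed

text \<open>Outside \<open>S\<close> the points of the product space take the value
  \<open>undefined\<close>, so the coordinate is constant there.\<close>

lemma measurable_PiM_coord:
  "(\<lambda>x. x p) \<in> borel_measurable (cgauss_prod S)"
proof (cases "p \<in> S")
  case True
  from measurable_component_singleton[OF this, of "\<lambda>_. cgauss"] show ?thesis
    by (simp add: measurable_cong_sets[OF refl sets_cgauss])
next
  case False
  have "(\<lambda>x. undefined :: complex) \<in> borel_measurable (cgauss_prod S)" by simp
  also have "?this \<longleftrightarrow> ?thesis"
    using False by (intro measurable_cong) (auto simp: space_PiM PiE_def extensional_def)
  finally show ?thesis .
qed

section \<open>Rescaling the coordinates of a Gaussian product\<close>

lemma measurable_PiM_scale:
  assumes "\<And>i. i \<in> S \<Longrightarrow> v i \<in> borel_measurable (cgauss_prod S)"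
  shows "(\<lambda>x. \<lambda>i\<in>S. of_real (v i x) * x i) \<in> measurable (cgauss_prod S) (cgauss_prod S)"
proof (rule measurable_restrict)
  fix i assume i: "i \<in> S"
  have [measurable]: "v i \<in> borel_measurable (cgauss_prod S)" by (rule assms[OF i])
  note [measurable] = measurable_PiM_coord
  show "(\<lambda>x. of_real (v i x) * x i) \<in> measurable (cgauss_prod S) cgauss"
    by (simp add: measurable_cong_sets[OF refl sets_cgauss])
qed

lemma measurable_PiM_slice:
  assumes [measurable]: "f \<in> borel_measurable (cgauss_prod (insert m S))"
    and [simp]: "x \<in> space (cgauss_prod S)"
  shows "(\<lambda>y. f (x(m := y))) \<in> borel_measurable borel"
proof -
  have "(\<lambda>y. f (x(m := y))) \<in> borel_measurable cgauss" by measurable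
  thus ?thesis by (simp add: measurable_cong_sets[OF sets_cgauss refl])
qed

text \<open>Adds one coordinate above those of \<open>S\<close>. For fixed \<open>x\<close> the
  factor \<open>v x\<close> is a number, and the one-dimensional estimate applies to the inner
  integral. The order of integration is then exchanged, so that the integral over \<open>S\<close>
  stands inside, where an induction hypothesis about \<open>T\<close> can be used for each frozen
  \<open>y\<close>.\<close>

lemma PiM_insert_scale_le:
  assumes P: "prob_space cgauss" and fin: "finite S" and m: "m \<notin> S"
    and a: "0 < a" and v: "\<And>x. a \<le> v x" "\<And>x. v x \<le> 1"
    and v_meas [measurable]: "v \<in> borel_measurable (cgauss_prod S)"
    and [measurable]: "T \<in> measurable (cgauss_prod S) (cgauss_prod S)"
    and f [measurable]: "f \<in> borel_measurable (cgauss_prod (insert m S))"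
  shows "(\<integral>\<^sup>+ x. \<integral>\<^sup>+ y. f ((T x)(m := of_real (v x) * y)) \<partial>cgauss \<partial>cgauss_prod S)
    \<le> ennreal (1 / a\<^sup>2) * (\<integral>\<^sup>+ y. \<integral>\<^sup>+ x. f ((T x)(m := y)) \<partial>cgauss_prod S \<partial>cgauss)"
proof -
  interpret prob_space cgauss by fact
  interpret product_sigma_finite "\<lambda>_. cgauss" by standard
  let ?P = "cgauss_prod S"
  interpret PS: sigma_finite_measure ?P using fin by (rule sigma_finite)
  interpret pair_sigma_finite ?P cgauss ..
  have fm [measurable]: "(\<lambda>p. f ((T (fst p))(m := snd p))) \<in> borel_measurable (?P \<Otimes>\<^sub>M cgauss)"
    by measurable
  have "(\<integral>\<^sup>+ x. \<integral>\<^sup>+ y. f ((T x)(m := of_real (v x) * y)) \<partial>cgauss \<partial>?P)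
      \<le> (\<integral>\<^sup>+ x. ennreal (1 / a\<^sup>2) * \<integral>\<^sup>+ y. f ((T x)(m := y)) \<partial>cgauss \<partial>?P)"
  proof (intro nn_integral_mono)
    fix x assume x: "x \<in> space ?P"
    have Tx: "T x \<in> space ?P" using x by (rule measurable_space[rotated]) measurable
    have "(\<integral>\<^sup>+ y. f ((T x)(m := of_real (v x) * y)) \<partial>cgauss)
        \<le> ennreal (1 / (v x)\<^sup>2) * (\<integral>\<^sup>+ y. f ((T x)(m := y)) \<partial>cgauss)"
      using a v[of x] measurable_PiM_slice[OF f Tx]
      by (intro nn_integral_cgauss_scale_le[where f="\<lambda>y. f ((T x)(m := y))"]) auto
    also have "\<dots> \<le> ennreal (1 / a\<^sup>2) * (\<integral>\<^sup>+ y. f ((T x)(m := y)) \<partial>cgauss)"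
      using a v[of x] by (intro mult_right_mono ennreal_leI divide_left_mono power_mono) auto
    finally show "(\<integral>\<^sup>+ y. f ((T x)(m := of_real (v x) * y)) \<partial>cgauss)
        \<le> ennreal (1 / a\<^sup>2) * (\<integral>\<^sup>+ y. f ((T x)(m := y)) \<partial>cgauss)" .
  qed
  also have "\<dots> = ennreal (1 / a\<^sup>2) * (\<integral>\<^sup>+ x. \<integral>\<^sup>+ y. f ((T x)(m := y)) \<partial>cgauss \<partial>?P)"
    by (rule nn_integral_cmult) measurable
  also have "(\<integral>\<^sup>+ x. \<integral>\<^sup>+ y. f ((T x)(m := y)) \<partial>cgauss \<partial>?P)
     = (\<integral>\<^sup>+ y. \<integral>\<^sup>+ x. f ((T x)(m := y)) \<partial>?P \<partial>cgauss)"
    using Fubini'[of "\<lambda>x y. f ((T x)(m := y))"] fm by (simp add: case_prod_beta')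
  finally show ?thesis .
qed

text \<open>
  A predictable factor, one that depends on coordinates of lower level only, is a constant once these
  coordinates are fixed. Hence the coordinates can be rescaled one at a time, from the highest level
  downwards, at the price of a factor \<open>1 / a\<^sup>2\<close> each.
\<close>
lemma
  fixes lev :: "'i \<Rightarrow> nat" and u :: "'i \<Rightarrow> ('i \<Rightarrow> complex) \<Rightarrow> real"
  assumes P: "prob_space cgauss" and fin: "finite I" and a: "0 < a"
    and u_bounds: "\<And>i x. i \<in> I \<Longrightarrow> a \<le> u i x" "\<And>i x. i \<in> I \<Longrightarrow> u i x \<le> 1"
    and u_meas: "\<And>i S. i \<in> I \<Longrightarrow> S \<subseteq> I \<Longrightarrow> u i \<in> borel_measurable (cgauss_prod S)"
    and u_pred: "\<And>i x y. i \<in> I \<Longrightarrow> (\<And>j. lev j < lev i \<Longrightarrow> x j = y j) \<Longrightarrow> u i x = u i y"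
    and f: "f \<in> borel_measurable (cgauss_prod I)"
  shows nn_integral_PiM_predictable_scale_le:
      "(\<integral>\<^sup>+ x. f (\<lambda>i\<in>I. of_real (u i x) * x i) \<partial>cgauss_prod I)
        \<le> ennreal (1 / a\<^sup>2) ^ card I * (\<integral>\<^sup>+ x. f x \<partial>cgauss_prod I)" (is ?A)
    and nn_integral_PiM_le_predictable_scale:
      "(\<integral>\<^sup>+ x. f (\<lambda>i\<in>I. of_real a * x i) \<partial>cgauss_prod I)
        \<le> ennreal (1 / a\<^sup>2) ^ card I * (\<integral>\<^sup>+ x. f (\<lambda>i\<in>I. of_real (u i x) * x i) \<partial>cgauss_prod I)"
      (is ?B)
proof -
  interpret prob_space cgauss by fact
  interpret product_sigma_finite "\<lambda>_. cgauss" by standard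
  let ?P = "\<lambda>S. cgauss_prod S"
  let ?c = "ennreal (1 / a\<^sup>2)"
  define T where "T S x = (\<lambda>i\<in>S. of_real (u i x) * x i)" for S x
  define R where "R S x = (\<lambda>i\<in>S. of_real a * x i)" for S :: "'i set" and x :: "'i \<Rightarrow> complex"
  have T_meas: "T S \<in> measurable (?P S) (?P S)" if "S \<subseteq> I" for S
    unfolding T_def using u_meas that by (intro measurable_PiM_scale) blast
  have R_meas: "R S \<in> measurable (?P S) (?P S)" for S
    unfolding R_def by (rule measurable_PiM_scale) simp
  \<comment> \<open>The claim ranges over all \<open>f\<close> because the induction hypothesis is
    applied to the slices of \<open>f\<close> at a fixed value of the new coordinate.\<close>
  have "S \<subseteq> I \<longrightarrow> (\<forall>f \<in> borel_measurable (?P S).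
      (\<integral>\<^sup>+ x. f (T S x) \<partial>?P S) \<le> ?c ^ card S * (\<integral>\<^sup>+ x. f x \<partial>?P S) \<and>
      (\<integral>\<^sup>+ x. f (R S x) \<partial>?P S) \<le> ?c ^ card S * (\<integral>\<^sup>+ x. f (T S x) \<partial>?P S))"
    if "finite S" for S
    using that
  \<comment> \<open>Coordinates are inserted in order of increasing level. The new \<open>m\<close>
    has maximal level, so no factor, not even its own, depends on coordinate \<open>m\<close>; this
    is what \<open>T_upd\<close> below expresses.\<close>
  proof (induction S rule: finite_ranking_induct[where f=lev], goal_cases)
    case 1
    show ?case
    proof (intro impI ballI conjI)
      fix f :: "('i \<Rightarrow> complex) \<Rightarrow> ennreal"
      show "(\<integral>\<^sup>+ x. f (T {} x) \<partial>?P {}) \<le> ?c ^ card {} * (\<integral>\<^sup>+ x. f x \<partial>?P {})"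
           "(\<integral>\<^sup>+ x. f (R {} x) \<partial>?P {}) \<le> ?c ^ card {} * (\<integral>\<^sup>+ x. f (T {} x) \<partial>?P {})"
        by (auto intro!: nn_integral_mono simp: T_def R_def restrict_def space_PiM
            simp del: nn_integral_const)
    qed
  next
    case (2 m S)
    show ?case
    proof (cases "m \<in> S")
      case True
      thus ?thesis using 2 by (simp add: insert_absorb)
    next
      case False
      show ?thesis
      proof (intro impI ballI)
        fix f :: "('i \<Rightarrow> complex) \<Rightarrow> ennreal"
        assume sub: "insert m S \<subseteq> I" and f [measurable]: "f \<in> borel_measurable (?P (insert m S))"
        have SI: "S \<subseteq> I" and mI: "m \<in> I" using sub by auto
        note [measurable] = T_meas[OF SI] T_meas[OF sub] R_meas[of S] R_meas[of "insert m S"]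
          u_meas[OF mI SI]
        interpret PS: sigma_finite_measure "?P S" using 2(1) by (rule sigma_finite)
        interpret PQ: pair_sigma_finite "?P S" cgauss ..
        have T_upd: "T (insert m S) (x(m := y)) = (T S x)(m := of_real (u m x) * y)" for x y
        proof -
          have "u i (x(m := y)) = u i x" if "i \<in> insert m S" for i
          proof (rule u_pred)
            show "i \<in> I" using that sub by auto
            fix j assume "lev j < lev i"
            moreover have "lev i \<le> lev m" using that 2(2) by auto
            ultimately show "(x(m := y)) j = x j" by auto
          qed
          thus ?thesis using False by (auto simp: T_def fun_eq_iff restrict_def)
        qed
        have R_upd: "R (insert m S) (x(m := y)) = (R S x)(m := of_real a * y)" for x y
          using False by (auto simp: R_def fun_eq_iff restrict_def)
        have card: "card (insert m S) = Suc (card S)" using False 2(1) by simp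
        have slice: "(\<lambda>x. f (x(m := y))) \<in> borel_measurable (?P S)" for y
          by measurable
        have ins: "(\<integral>\<^sup>+ x. g x \<partial>?P (insert m S)) = (\<integral>\<^sup>+ x. \<integral>\<^sup>+ y. g (x(m := y)) \<partial>cgauss \<partial>?P S)"
           and ins_rev: "(\<integral>\<^sup>+ x. g x \<partial>?P (insert m S)) = (\<integral>\<^sup>+ y. \<integral>\<^sup>+ x. g (x(m := y)) \<partial>?P S \<partial>cgauss)"
           if "g \<in> borel_measurable (?P (insert m S))" for g
          using product_nn_integral_insert[OF 2(1) False that]
                product_nn_integral_insert_rev[OF 2(1) False that] by simp_all
        have IH1: "(\<integral>\<^sup>+ x. f ((T S x)(m := y)) \<partial>?P S) \<le> ?c ^ card S * (\<integral>\<^sup>+ x. f (x(m := y)) \<partial>?P S)" for y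
          using bspec[OF mp[OF 2(3) SI] slice[of y]] by blast
        \<comment> \<open>In the second inequality the lower coordinates are treated before
          \<open>m\<close>: they pass from the factor \<open>a\<close> to their true factors while
          coordinate \<open>m\<close> still carries \<open>a\<close>. Only afterwards, for fixed
          \<open>x\<close>, is \<open>a\<close> compared with \<open>u m x\<close>.\<close>
        have IH2: "(\<integral>\<^sup>+ x. f ((R S x)(m := y)) \<partial>?P S) \<le> ?c ^ card S * (\<integral>\<^sup>+ x. f ((T S x)(m := y)) \<partial>?P S)" for y
          using bspec[OF mp[OF 2(3) SI] slice[of y]] by blast
        have "(\<integral>\<^sup>+ x. f (T (insert m S) x) \<partial>?P (insert m S))
          = (\<integral>\<^sup>+ x. \<integral>\<^sup>+ y. f ((T S x)(m := of_real (u m x) * y)) \<partial>cgauss \<partial>?P S)"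
          by (subst ins) (simp_all add: T_upd)
        also have "\<dots> \<le> ?c * (\<integral>\<^sup>+ y. \<integral>\<^sup>+ x. f ((T S x)(m := y)) \<partial>?P S \<partial>cgauss)"
          by (intro PiM_insert_scale_le P 2(1) False a u_bounds mI) auto
        also have "\<dots> \<le> ?c * (\<integral>\<^sup>+ y. ?c ^ card S * (\<integral>\<^sup>+ x. f (x(m := y)) \<partial>?P S) \<partial>cgauss)"
          by (intro mult_left_mono nn_integral_mono IH1) auto
        also have "\<dots> = ?c ^ Suc (card S) * (\<integral>\<^sup>+ x. f x \<partial>?P (insert m S))"
          by (subst nn_integral_cmult) (auto simp: ins_rev[OF f] mult_ac)
        finally have A: "(\<integral>\<^sup>+ x. f (T (insert m S) x) \<partial>?P (insert m S))
          \<le> ?c ^ card (insert m S) * (\<integral>\<^sup>+ x. f x \<partial>?P (insert m S))" by (simp only: card)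
        have "(\<integral>\<^sup>+ x. f (R (insert m S) x) \<partial>?P (insert m S))
          = (\<integral>\<^sup>+ y. \<integral>\<^sup>+ x. f ((R S x)(m := of_real a * y)) \<partial>?P S \<partial>cgauss)"
          by (subst ins_rev) (simp_all add: R_upd)
        also have "\<dots> \<le> (\<integral>\<^sup>+ y. ?c ^ card S * (\<integral>\<^sup>+ x. f ((T S x)(m := of_real a * y)) \<partial>?P S) \<partial>cgauss)"
          by (intro nn_integral_mono IH2)
        also have "\<dots> = ?c ^ card S * (\<integral>\<^sup>+ x. \<integral>\<^sup>+ y. f ((T S x)(m := of_real a * y)) \<partial>cgauss \<partial>?P S)"
        proof (subst nn_integral_cmult)
          have "(\<integral>\<^sup>+ y. \<integral>\<^sup>+ x. f ((T S x)(m := of_real a * y)) \<partial>?P S \<partial>cgauss)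
              = (\<integral>\<^sup>+ x. \<integral>\<^sup>+ y. f ((T S x)(m := of_real a * y)) \<partial>cgauss \<partial>?P S)"
            using PQ.Fubini'[of "\<lambda>x y. f ((T S x)(m := of_real a * y))"] by simp
          thus "?c ^ card S * (\<integral>\<^sup>+ y. \<integral>\<^sup>+ x. f ((T S x)(m := of_real a * y)) \<partial>?P S \<partial>cgauss)
              = ?c ^ card S * (\<integral>\<^sup>+ x. \<integral>\<^sup>+ y. f ((T S x)(m := of_real a * y)) \<partial>cgauss \<partial>?P S)"
            by simp
        qed measurable
        also have "\<dots> \<le> ?c ^ card S * (?c * (\<integral>\<^sup>+ x. \<integral>\<^sup>+ y. f ((T S x)(m := of_real (u m x) * y)) \<partial>cgauss \<partial>?P S))"
        proof (subst nn_integral_cmult[symmetric], measurable, intro mult_left_mono nn_integral_mono)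
          fix x assume x: "x \<in> space (?P S)"
          have Tx: "T S x \<in> space (?P S)" using x T_meas[OF SI] by (rule measurable_space[rotated])
          have [measurable]: "(\<lambda>y. f ((T S x)(m := y))) \<in> borel_measurable borel"
            using measurable_PiM_slice[OF f Tx] .
          \<comment> \<open>The passage from \<open>u m x\<close> to \<open>a\<close> is itself a
            contraction, by \<open>a / u m x \<le> 1\<close>. Its cost \<open>(u m x / a)^2\<close>
            is at most \<open>1 / a^2\<close>.\<close>
          have u: "0 < u m x" "u m x \<le> 1" "a \<le> u m x" using u_bounds[OF mI] a less_le_trans by blast+
          have "(\<integral>\<^sup>+ y. f ((T S x)(m := of_real a * y)) \<partial>cgauss)
              = (\<integral>\<^sup>+ y. (\<lambda>y. f ((T S x)(m := of_real (u m x) * y))) (of_real (a / u m x) * y) \<partial>cgauss)"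
            using u by (intro nn_integral_cong) simp
          also have "\<dots> \<le> ennreal (1 / (a / u m x)\<^sup>2) * (\<integral>\<^sup>+ y. f ((T S x)(m := of_real (u m x) * y)) \<partial>cgauss)"
            using u a by (intro nn_integral_cgauss_scale_le) (auto, measurable)
          also have "\<dots> \<le> ?c * (\<integral>\<^sup>+ y. f ((T S x)(m := of_real (u m x) * y)) \<partial>cgauss)"
            using u a by (intro mult_right_mono ennreal_leI divide_left_mono power_mono) (auto simp: field_simps)
          finally show "(\<integral>\<^sup>+ y. f ((T S x)(m := of_real a * y)) \<partial>cgauss)
              \<le> ?c * (\<integral>\<^sup>+ y. f ((T S x)(m := of_real (u m x) * y)) \<partial>cgauss)" .
        qed auto
        also have "\<dots> = ?c ^ Suc (card S) * (\<integral>\<^sup>+ x. f (T (insert m S) x) \<partial>?P (insert m S))"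
          by (subst ins) (simp_all add: T_upd mult_ac)
        finally have B: "(\<integral>\<^sup>+ x. f (R (insert m S) x) \<partial>?P (insert m S))
          \<le> ?c ^ card (insert m S) * (\<integral>\<^sup>+ x. f (T (insert m S) x) \<partial>?P (insert m S))" by (simp only: card)
        show "(\<integral>\<^sup>+ x. f (T (insert m S) x) \<partial>?P (insert m S))
            \<le> ?c ^ card (insert m S) * (\<integral>\<^sup>+ x. f x \<partial>?P (insert m S)) \<and>
          (\<integral>\<^sup>+ x. f (R (insert m S) x) \<partial>?P (insert m S))
            \<le> ?c ^ card (insert m S) * (\<integral>\<^sup>+ x. f (T (insert m S) x) \<partial>?P (insert m S))"
          using A B by blast
      qed
    qed
  qed
  thus ?A ?B using fin f unfolding T_def R_def by auto
qed

section \<open>Hermitian matrices and their determinants\<close>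

lemma mat_adjoint_dim [simp]: "dim_row (mat_adjoint A) = dim_col A" "dim_col (mat_adjoint A) = dim_row A"
  by (simp_all add: mat_adjoint_def)

lemma mat_adjoint_carrier [simp]: "A \<in> carrier_mat n m \<Longrightarrow> mat_adjoint A \<in> carrier_mat m n"
  by (rule carrier_matI) auto

lemma index_mat_adjoint [simp]:
  "i < dim_col A \<Longrightarrow> j < dim_row A \<Longrightarrow> mat_adjoint A $$ (i, j) = cnj (A $$ (j, i))" for A :: "complex mat"
  by (simp add: mat_adjoint_def mat_of_rows_def)

lemma mat_adjoint_adjoint [simp]: "mat_adjoint (mat_adjoint A) = A" for A :: "complex mat"
  by (rule eq_matI) auto

lemma mat_adjoint_one [simp]: "mat_adjoint (1\<^sub>m n) = (1\<^sub>m n :: complex mat)"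
  by (rule eq_matI) auto

lemma mat_adjoint_mult:
  fixes A B :: "complex mat"
  assumes "A \<in> carrier_mat n m" "B \<in> carrier_mat m k"
  shows "mat_adjoint (A * B) = mat_adjoint B * mat_adjoint A"
  using assms by (intro eq_matI) (auto simp: scalar_prod_def mult.commute)

lemma cscalar_prod_conv_sum:
  "v \<in> carrier_vec n \<Longrightarrow> w \<in> carrier_vec n \<Longrightarrow> v \<bullet>c w = (\<Sum>i<n. v $ i * cnj (w $ i))"
  by (simp add: scalar_prod_def lessThan_atLeast0)

lemma cscalar_prod_self:
  "v \<in> carrier_vec n \<Longrightarrow> v \<bullet>c v = of_real (\<Sum>i<n. (cmod (v $ i))\<^sup>2)"
  by (simp add: cscalar_prod_conv_sum complex_norm_square[symmetric])

lemma cscalar_prod_adjoint: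
  fixes A :: "complex mat"
  assumes "A \<in> carrier_mat n m" "v \<in> carrier_vec m" "w \<in> carrier_vec n"
  shows "(A *\<^sub>v v) \<bullet>c w = v \<bullet>c (mat_adjoint A *\<^sub>v w)"
proof -
  have "(A *\<^sub>v v) \<bullet>c w = (\<Sum>i<n. \<Sum>j<m. A $$ (i, j) * v $ j * cnj (w $ i))"
    using assms by (subst cscalar_prod_conv_sum[of _ n])
      (auto simp: scalar_prod_def lessThan_atLeast0 sum_distrib_right)
  also have "\<dots> = (\<Sum>j<m. \<Sum>i<n. A $$ (i, j) * v $ j * cnj (w $ i))"
    by (rule sum.swap)
  also have "\<dots> = v \<bullet>c (mat_adjoint A *\<^sub>v w)"
    using assms mult_mat_vec_carrier[of "mat_adjoint A" m n w] by (subst cscalar_prod_conv_sum[of _ m])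
      (auto simp: scalar_prod_def lessThan_atLeast0 sum_distrib_left mult_ac)
  finally show ?thesis .
qed

lemma col_carrier: "A \<in> carrier_mat n m \<Longrightarrow> col A i \<in> carrier_vec n"
  using col_dim[of A i] by simp

text \<open>Gram-Schmidt, applied to a basis beginning with \<open>v\<close>, leaves
  \<open>v\<close> in first place. Its output is only orthogonal, so the columns are divided by
  their norms; the scalar \<open>c\<close> is this normalization.\<close>

lemma ex_unitary_with_first_col:
  fixes v :: "complex vec"
  assumes v: "v \<in> carrier_vec n" "v \<noteq> 0\<^sub>v n"
  shows "\<exists>W c. W \<in> carrier_mat n n \<and> mat_adjoint W * W = 1\<^sub>m n \<and> col W 0 = c \<cdot>\<^sub>v v"
proof -
  interpret cof_vec_space n "TYPE(complex)" .
  note b = basis_completion[OF v]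
  define ws where "ws = gram_schmidt n (basis_completion v)"
  note g = gram_schmidt_result[OF b(2,4,5) ws_def]
  have n: "n \<noteq> 0" using v by auto
  have len: "length ws = n" using g b by simp
  obtain vs where bv: "basis_completion v = v # vs" using b(6,7) n by (cases "basis_completion v") auto
  have "hd ws = v" unfolding ws_def bv using gram_schmidt_hd[OF v(1), of vs] by simp
  hence w0: "ws ! 0 = v" using len n by (cases ws) auto
  have wc: "ws ! i \<in> carrier_vec n" if "i < n" for i using g(3) len that by auto
  have orth: "ws ! i \<bullet>c ws ! j = 0 \<longleftrightarrow> i \<noteq> j" if "i < n" "j < n" for i j
    using corthogonalD[OF g(2)] that len by auto
  define q where "q i = (\<Sum>k<n. (cmod (ws ! i $ k))\<^sup>2)" for i
  have qi: "ws ! i \<bullet>c ws ! i = of_real (q i)" if "i < n" for i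
    using cscalar_prod_self[OF wc[OF that]] by (simp add: q_def)
  have q_pos: "q i > 0" if "i < n" for i
  proof -
    have "q i \<noteq> 0" using orth[OF that that] qi[OF that] by auto
    moreover have "q i \<ge> 0" unfolding q_def by (intro sum_nonneg) auto
    ultimately show ?thesis by simp
  qed
  define W where "W = mat n n (\<lambda>(i, j). ws ! j $ i / of_real (sqrt (q j)))"
  have W: "W \<in> carrier_mat n n" by (simp add: W_def)
  have "mat_adjoint W * W = 1\<^sub>m n"
  proof (rule eq_matI)
    fix i j assume ij: "i < dim_row (1\<^sub>m n :: complex mat)" "j < dim_col (1\<^sub>m n :: complex mat)"
    hence ij: "i < n" "j < n" by auto
    have "(mat_adjoint W * W) $$ (i, j)
        = (\<Sum>k<n. cnj (ws ! i $ k) / of_real (sqrt (q i)) * (ws ! j $ k / of_real (sqrt (q j))))"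
      using ij W by (simp add: scalar_prod_def lessThan_atLeast0) (simp add: W_def)
    also have "\<dots> = (ws ! j \<bullet>c ws ! i) / (of_real (sqrt (q i)) * of_real (sqrt (q j)))"
      using ij wc by (simp add: cscalar_prod_conv_sum[of _ n] sum_divide_distrib mult_ac)
    also have "\<dots> = (if i = j then 1 else 0)"
    proof (cases "i = j")
      case True
      have "of_real (sqrt (q i)) * of_real (sqrt (q i)) = (of_real (q i) :: complex)"
        using q_pos[OF ij(1)] by (simp flip: of_real_mult)
      thus ?thesis using True ij qi q_pos[OF ij(1)] by simp
    qed (use orth ij in auto)
    finally show "(mat_adjoint W * W) $$ (i, j) = 1\<^sub>m n $$ (i, j)" using ij by simp
  qed (use W in auto)
  moreover have "col W 0 = (1 / of_real (sqrt (q 0))) \<cdot>\<^sub>v v"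
    using n v w0 by (intro eq_vecI) (auto simp: W_def)
  ultimately show ?thesis using W by blast
qed

declare mat_diag_dim [simp, intro]

text \<open>Deflation. In an orthonormal basis that starts with an eigenvector, the first column of
  \<open>A'\<close> is \<open>e\<close> times a unit vector. Self-adjointness gives the first row
  the same form, makes \<open>e\<close> real, and passes to the remaining block, which is one size
  smaller.\<close>

lemma hermitian_diagonalization:
  fixes A :: "complex mat"
  assumes "A \<in> carrier_mat n n" "mat_adjoint A = A"
  shows "\<exists>U d. U \<in> carrier_mat n n \<and> mat_adjoint U * U = 1\<^sub>m n \<and>
     A = U * mat_diag n (\<lambda>i. of_real (d i)) * mat_adjoint U"
  using assms
proof (induction n arbitrary: A)
  case 0
  thus ?case by (intro exI[of _ "1\<^sub>m 0"] exI[of _ "\<lambda>_. 0"]) auto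
next
  case (Suc n)
  let ?n = "Suc n"
  have A: "A \<in> carrier_mat ?n ?n" by fact
  obtain e v where "eigenvector A v e"
    using spectrum_non_empty[OF A] by (auto simp: spectrum_def eigenvalue_def)
  hence v: "v \<in> carrier_vec ?n" "v \<noteq> 0\<^sub>v ?n" "A *\<^sub>v v = e \<cdot>\<^sub>v v"
    using A by (auto simp: eigenvector_def)
  obtain W c where W: "W \<in> carrier_mat ?n ?n" "mat_adjoint W * W = 1\<^sub>m ?n" "col W 0 = c \<cdot>\<^sub>v v"
    using ex_unitary_with_first_col[OF v(1,2)] by blast
  note [simp] = W(1) A mat_adjoint_carrier[OF W(1)] mult_carrier_mat[of _ ?n ?n _ ?n]
  have [simp]: "col W i \<in> carrier_vec ?n" for i by (rule col_carrier[OF W(1)])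
  have WW: "W * mat_adjoint W = 1\<^sub>m ?n"
    using mat_mult_left_right_inverse[OF _ W(1) W(2)] by auto
  define A' where "A' = mat_adjoint W * (A * W)"
  have A': "A' \<in> carrier_mat ?n ?n" by (simp add: A'_def)
  have adjA': "mat_adjoint A' = A'"
  proof -
    have "mat_adjoint A' = mat_adjoint (A * W) * W"
      unfolding A'_def by (subst mat_adjoint_mult[of _ ?n ?n _ ?n]) auto
    also have "\<dots> = mat_adjoint W * A * W"
      by (subst mat_adjoint_mult[of _ ?n ?n _ ?n]) (auto simp: Suc.prems)
    also have "\<dots> = A'" unfolding A'_def by (rule assoc_mult_mat[of _ ?n ?n _ ?n _ ?n]) auto
    finally show ?thesis .
  qed
  have col0: "A' $$ (i, 0) = (if i = 0 then e else 0)" if "i < ?n" for i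
  proof -
    have "A' $$ (i, 0) = col A' 0 $ i" using A' that by simp
    also have "col A' 0 = mat_adjoint W *\<^sub>v (A *\<^sub>v col W 0)"
      unfolding A'_def by (subst col_mult2[of _ ?n ?n _ ?n]) (auto simp: col_mult2[of _ ?n ?n _ ?n])
    also have "A *\<^sub>v col W 0 = e \<cdot>\<^sub>v col W 0"
      using v unfolding W(3) by (simp add: mult_mat_vec[of _ ?n ?n] smult_smult_assoc mult.commute)
    also have "mat_adjoint W *\<^sub>v (e \<cdot>\<^sub>v col W 0) = e \<cdot>\<^sub>v (mat_adjoint W *\<^sub>v col W 0)"
      by (rule mult_mat_vec[of _ ?n ?n]) auto
    also have "mat_adjoint W *\<^sub>v col W 0 = col (mat_adjoint W * W) 0"
      by (subst col_mult2[of _ ?n ?n _ ?n]) auto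
    finally show ?thesis using that by (simp add: W(2))
  qed
  have row0: "A' $$ (0, i) = (if i = 0 then e else 0)" if "i < ?n" for i
  proof -
    have "A' $$ (0, i) = cnj (A' $$ (i, 0))"
      using A' that by (subst adjA'[symmetric]) auto
    moreover have "A' $$ (0, 0) = cnj (A' $$ (0, 0))"
      using A' that by (subst adjA'[symmetric]) auto
    ultimately show ?thesis using col0[OF that] col0[of 0] by auto
  qed
  have e_real: "e = of_real (Re e)"
  proof -
    have "A' $$ (0, 0) = cnj (A' $$ (0, 0))"
      using A' by (subst adjA'[symmetric]) auto
    thus ?thesis using col0[of 0] by (auto simp: complex_eq_iff)
  qed
  define A3 where "A3 = mat n n (\<lambda>(i, j). A' $$ (Suc i, Suc j))"
  have A3: "A3 \<in> carrier_mat n n" by (simp add: A3_def)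
  have "mat_adjoint A3 = A3"
  proof (rule eq_matI)
    fix i j assume "i < dim_row A3" "j < dim_col A3"
    hence ij: "i < n" "j < n" by (auto simp: A3_def)
    have "cnj (A' $$ (Suc j, Suc i)) = A' $$ (Suc i, Suc j)"
      using A' ij by (subst (2) adjA'[symmetric]) auto
    thus "mat_adjoint A3 $$ (i, j) = A3 $$ (i, j)" using ij by (simp add: A3_def)
  qed (auto simp: A3_def)
  from Suc.IH[OF A3 this] obtain U3 d where U3: "U3 \<in> carrier_mat n n" "mat_adjoint U3 * U3 = 1\<^sub>m n"
     "A3 = U3 * mat_diag n (\<lambda>i. of_real (d i)) * mat_adjoint U3" by blast
  define d' where "d' i = (case i of 0 \<Rightarrow> Re e | Suc j \<Rightarrow> d j)" for i
  define B where "B = four_block_mat (1\<^sub>m 1) (0\<^sub>m 1 n) (0\<^sub>m n 1) U3"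
  let ?D = "mat_diag ?n (\<lambda>i. of_real (d' i)) :: complex mat"
  let ?D3 = "mat_diag n (\<lambda>i. of_real (d i)) :: complex mat"
  have B: "B \<in> carrier_mat ?n ?n" using U3(1) by (auto simp: B_def)
  have adjB: "mat_adjoint B = four_block_mat (1\<^sub>m 1) (0\<^sub>m 1 n) (0\<^sub>m n 1) (mat_adjoint U3)"
    using U3(1) by (intro eq_matI) (auto simp: B_def)
  have BB: "mat_adjoint B * B = 1\<^sub>m ?n"
  proof -
    have "mat_adjoint B * B = four_block_mat (1\<^sub>m 1) (0\<^sub>m 1 n) (0\<^sub>m n 1) (1\<^sub>m n)"
      unfolding adjB unfolding B_def using U3
      by (subst mult_four_block_mat[of _ 1 1 _ n _ n _ _ 1 _ n]) auto
    also have "\<dots> = 1\<^sub>m ?n" by (intro eq_matI) auto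
    finally show ?thesis .
  qed
  have A'_eq: "A' = B * ?D * mat_adjoint B"
  proof -
    have D: "?D = four_block_mat (of_real (Re e) \<cdot>\<^sub>m 1\<^sub>m 1) (0\<^sub>m 1 n) (0\<^sub>m n 1) ?D3"
      by (intro eq_matI) (auto simp: mat_diag_def d'_def split: nat.splits)
    let ?e = "of_real (Re e) \<cdot>\<^sub>m 1\<^sub>m 1 :: complex mat"
    have e: "?e \<in> carrier_mat 1 1" by simp
    have D3: "?D3 \<in> carrier_mat n n" by (rule mat_diag_dim)
    have UD: "U3 * ?D3 \<in> carrier_mat n n" by (rule mult_carrier_mat[OF U3(1) D3])
    have UDU: "U3 * ?D3 * mat_adjoint U3 \<in> carrier_mat n n"
      by (rule mult_carrier_mat[OF UD mat_adjoint_carrier[OF U3(1)]])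
    have z: "(0\<^sub>m 1 n :: complex mat) \<in> carrier_mat 1 n" "(0\<^sub>m n 1 :: complex mat) \<in> carrier_mat n 1" by auto
    have "B * ?D = four_block_mat (1\<^sub>m 1 * ?e + 0\<^sub>m 1 n * 0\<^sub>m n 1) (1\<^sub>m 1 * 0\<^sub>m 1 n + 0\<^sub>m 1 n * ?D3)
       (0\<^sub>m n 1 * ?e + U3 * 0\<^sub>m n 1) (0\<^sub>m n 1 * 0\<^sub>m 1 n + U3 * ?D3)"
      unfolding D B_def by (rule mult_four_block_mat[OF one_carrier_mat z U3(1) e z D3])
    also have "\<dots> = four_block_mat ?e (0\<^sub>m 1 n) (0\<^sub>m n 1) (U3 * ?D3)"
      using left_mult_zero_mat[OF D3] left_mult_zero_mat[OF e] right_mult_zero_mat[OF U3(1)]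
        left_mult_one_mat[OF e] left_add_zero_mat[OF UD] right_add_zero_mat[OF e] by simp
    finally have "B * ?D * mat_adjoint B = four_block_mat (?e * 1\<^sub>m 1 + 0\<^sub>m 1 n * 0\<^sub>m n 1)
       (?e * 0\<^sub>m 1 n + 0\<^sub>m 1 n * mat_adjoint U3) (0\<^sub>m n 1 * 1\<^sub>m 1 + U3 * ?D3 * 0\<^sub>m n 1)
       (0\<^sub>m n 1 * 0\<^sub>m 1 n + U3 * ?D3 * mat_adjoint U3)"
      unfolding adjB
      by (simp only: mult_four_block_mat[OF e z UD one_carrier_mat z mat_adjoint_carrier[OF U3(1)]])
    also have "\<dots> = four_block_mat ?e (0\<^sub>m 1 n) (0\<^sub>m n 1) A3"
      unfolding U3(3)
      using left_mult_zero_mat[OF mat_adjoint_carrier[OF U3(1)]] right_mult_zero_mat[OF UD]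
        right_mult_one_mat[OF e] left_add_zero_mat[OF UDU] right_add_zero_mat[OF e] by simp
    also have "\<dots> = A'"
      using A' col0 row0 e_real by (intro eq_matI) (auto simp: A3_def)
    finally show ?thesis by simp
  qed
  note [simp] = B mat_adjoint_carrier[OF B]
  note as = assoc_mult_mat[of _ ?n ?n _ ?n _ ?n]
  have WB: "W * B \<in> carrier_mat ?n ?n" by (rule mult_carrier_mat[OF W(1) B])
  have adjWB: "mat_adjoint (W * B) = mat_adjoint B * mat_adjoint W"
    by (rule mat_adjoint_mult[OF W(1) B])
  note W' = mat_adjoint_carrier[OF W(1)] and B' = mat_adjoint_carrier[OF B]
  have D: "?D \<in> carrier_mat ?n ?n" by (rule mat_diag_dim)
  have "mat_adjoint (W * B) * (W * B) = 1\<^sub>m ?n"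
  proof -
    have "mat_adjoint (W * B) * (W * B) = mat_adjoint B * (mat_adjoint W * (W * B))"
      unfolding adjWB by (rule assoc_mult_mat[OF B' W' WB])
    also have "mat_adjoint W * (W * B) = mat_adjoint W * W * B"
      by (rule assoc_mult_mat[OF W' W(1) B, symmetric])
    also have "\<dots> = B" unfolding W(2) by (rule left_mult_one_mat[OF B])
    finally show ?thesis unfolding BB .
  qed
  moreover have "A = W * B * ?D * mat_adjoint (W * B)"
  proof -
    have "W * B * ?D * mat_adjoint (W * B) = W * (B * ?D * mat_adjoint B) * mat_adjoint W"
      unfolding adjWB using W(1) W' B B' D
      by (simp only: as mult_carrier_mat[of _ ?n ?n _ ?n])
    also have "\<dots> = W * A' * mat_adjoint W" unfolding A'_eq ..
    also have "\<dots> = W * mat_adjoint W * (A * (W * mat_adjoint W))"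
      unfolding A'_def using W(1) W' A
      by (simp only: as mult_carrier_mat[of _ ?n ?n _ ?n])
    also have "\<dots> = A" unfolding WW right_mult_one_mat[OF A] by (rule left_mult_one_mat[OF A])
    finally show ?thesis by (rule sym)
  qed
  ultimately show ?case using WB by (intro exI[of _ "W * B"] exI[of _ d'] conjI)
qed


lemma det_mat_diag: "det (mat_diag n f :: 'a :: comm_ring_1 mat) = (\<Prod>i<n. f i)"
proof -
  have "det (mat_diag n f) = prod_list (diag_mat (mat_diag n f))"
    by (rule det_upper_triangular[of _ n]) (auto simp: mat_diag_def upper_triangular_def)
  also have "diag_mat (mat_diag n f) = map f [0..<n]"
    unfolding diag_mat_def by (auto simp: mat_diag_def)
  also have "prod_list (map f [0..<n]) = (\<Prod>i<n. f i)"
    using prod.distinct_set_conv_list[of "[0..<n]" f] by (simp only: distinct_upt set_upt lessThan_atLeast0)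
  finally show ?thesis .
qed

lemma psd_adjoint_mult:
  assumes X: "X \<in> carrier_mat m n"
  shows "psd (mat_adjoint X * X)"
proof -
  have c: "mat_adjoint X * X \<in> carrier_mat n n"
    using X by (intro mult_carrier_mat[of _ n m _ n] mat_adjoint_carrier)
  have "mat_adjoint (mat_adjoint X * X) = mat_adjoint X * X"
    using mat_adjoint_mult[OF mat_adjoint_carrier[OF X] X] by simp
  moreover have "0 \<le> Re ((mat_adjoint X * X *\<^sub>v v) \<bullet>c v)" if v: "v \<in> carrier_vec n" for v
  proof -
    have Xv: "X *\<^sub>v v \<in> carrier_vec m" using X v by auto
    have "(mat_adjoint X * X *\<^sub>v v) \<bullet>c v = (mat_adjoint X *\<^sub>v (X *\<^sub>v v)) \<bullet>c v"
      using assoc_mult_mat_vec[OF mat_adjoint_carrier[OF X] X v] by simp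
    also have "\<dots> = (X *\<^sub>v v) \<bullet>c (X *\<^sub>v v)"
      using cscalar_prod_adjoint[OF mat_adjoint_carrier[OF X] Xv v] by simp
    finally show ?thesis
      unfolding cscalar_prod_self[OF Xv] Re_complex_of_real by (simp add: sum_nonneg)
  qed
  ultimately show ?thesis using c by (simp only: psd_def carrier_matD[OF c]) blast
qed

text \<open>Transfers sign conditions on the quadratic form to the diagonal entries, by testing the
  form on the columns of \<open>U\<close>.\<close>

lemma diagonalization_eigenvalue:
  fixes U :: "complex mat"
  assumes U: "U \<in> carrier_mat n n" "mat_adjoint U * U = 1\<^sub>m n" and i: "i < n"
    and A: "A = U * mat_diag n f * mat_adjoint U"
  shows "(A *\<^sub>v col U i) \<bullet>c col U i = f i" "col U i \<noteq> 0\<^sub>v n"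
proof -
  note c = col_carrier[OF U(1), of i]
  note U' = mat_adjoint_carrier[OF U(1)]
  have e: "mat_adjoint U *\<^sub>v col U i = unit_vec n i"
    using col_mult2[OF U' U(1) i] U(2) i by simp
  let ?d = "mat_diag n f *\<^sub>v unit_vec n i"
  have d: "?d \<in> carrier_vec n" by (rule mult_mat_vec_carrier[of _ n n]) auto
  have "A *\<^sub>v col U i = U * mat_diag n f *\<^sub>v (mat_adjoint U *\<^sub>v col U i)"
    unfolding A using U(1) by (intro assoc_mult_mat_vec[OF mult_carrier_mat[OF U(1) mat_diag_dim] U' c])
  also have "\<dots> = U *\<^sub>v ?d"
    unfolding e by (rule assoc_mult_mat_vec[OF U(1) mat_diag_dim unit_vec_carrier])
  finally have "(A *\<^sub>v col U i) \<bullet>c col U i = (U *\<^sub>v ?d) \<bullet>c col U i" by (rule arg_cong)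
  also have "\<dots> = ?d \<bullet>c unit_vec n i"
    using cscalar_prod_adjoint[OF U(1) d c] unfolding e .
  also have "?d = f i \<cdot>\<^sub>v unit_vec n i"
    using i by (intro eq_vecI) (auto simp: mat_diag_def)
  also have "(f i \<cdot>\<^sub>v unit_vec n i) \<bullet>c unit_vec n i
      = (\<Sum>k<n. (f i \<cdot>\<^sub>v unit_vec n i) $ k * cnj (unit_vec n i $ k))"
    by (rule cscalar_prod_conv_sum) auto
  also have "\<dots> = (\<Sum>k<n. if k = i then f i else 0)"
    using i by (intro sum.cong) auto
  also have "\<dots> = f i" using i by simp
  finally show "(A *\<^sub>v col U i) \<bullet>c col U i = f i" .
  show "col U i \<noteq> 0\<^sub>v n"
  proof
    assume "col U i = 0\<^sub>v n"
    moreover have "mat_adjoint U *\<^sub>v 0\<^sub>v n = 0\<^sub>v n" using U' by (intro eq_vecI) (auto simp: scalar_prod_def)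
    ultimately have "unit_vec n i = (0\<^sub>v n :: complex vec)" using e by metis
    thus False using i by (metis index_unit_vec(1) index_zero_vec(1) zero_neq_one)
  qed
qed

lemma psd_sqrt_props:
  assumes "psd A"
  shows "psd (psd_sqrt A)" "dim_row (psd_sqrt A) = dim_row A" "psd_sqrt A * psd_sqrt A = A"
proof -
  define n where "n = dim_row A"
  have A: "A \<in> carrier_mat n n" "mat_adjoint A = A"
    and q: "\<And>v. v \<in> carrier_vec n \<Longrightarrow> 0 \<le> Re ((A *\<^sub>v v) \<bullet>c v)"
    using assms unfolding psd_def n_def by blast+
  obtain U d where U: "U \<in> carrier_mat n n" "mat_adjoint U * U = 1\<^sub>m n"
     and Ad: "A = U * mat_diag n (\<lambda>i. of_real (d i)) * mat_adjoint U"
    using hermitian_diagonalization[OF A] by blast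
  have d: "0 \<le> d i" if "i < n" for i
  proof -
    from q[OF col_carrier[OF U(1), of i]] show ?thesis
      unfolding diagonalization_eigenvalue(1)[OF U that Ad] Re_complex_of_real .
  qed
  \<comment> \<open>Fourth roots of the eigenvalues: the square root of \<open>A\<close> appears as
    the Gram matrix of \<open>X\<close>, so that its semidefiniteness is immediate. This is the
    witness for the choice in \<open>psd_sqrt\<close>.\<close>
  define D where "D = (mat_diag n (\<lambda>i. of_real (sqrt (sqrt (d i)))) :: complex mat)"
  define X where "X = D * mat_adjoint U"
  have D: "D \<in> carrier_mat n n" by (simp add: D_def)
  note cc = U(1) D mat_adjoint_carrier[OF U(1)] mult_carrier_mat[of _ n n _ n]
  have X: "X \<in> carrier_mat n n" unfolding X_def using cc by simp
  have "mat_adjoint D = D" by (intro eq_matI) (auto simp: D_def mat_diag_def)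
  hence "mat_adjoint X = U * D"
    unfolding X_def using cc by (subst mat_adjoint_mult[of _ n n _ n]) auto
  hence "(mat_adjoint X * X) * (mat_adjoint X * X)
     = U * (D * D * (mat_adjoint U * U) * D * D) * mat_adjoint U"
    unfolding X_def using cc(1-3)
    by (simp only: assoc_mult_mat[of _ n n _ n _ n] mult_carrier_mat[of _ n n _ n])
  also have "D * D * (mat_adjoint U * U) * D * D = D * D * D * D"
    unfolding U(2) right_mult_one_mat[OF mult_carrier_mat[OF D D]] ..
  also have "\<dots> = mat_diag n (\<lambda>i. of_real (sqrt (sqrt (d i)) * sqrt (sqrt (d i)) * sqrt (sqrt (d i)) * sqrt (sqrt (d i))))"
    unfolding D_def by (simp only: mat_diag_diag of_real_mult)
  also have "\<dots> = mat_diag n (\<lambda>i. of_real (d i))"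
    using d by (intro eq_matI) (auto simp: mat_diag_def mult.assoc simp del: of_real_mult)
  finally have "(mat_adjoint X * X) * (mat_adjoint X * X) = A" using Ad by simp
  hence "psd (mat_adjoint X * X) \<and> dim_row (mat_adjoint X * X) = dim_row A
     \<and> (mat_adjoint X * X) * (mat_adjoint X * X) = A"
    using psd_adjoint_mult[OF X] X A(1) by simp
  hence "psd (psd_sqrt A) \<and> dim_row (psd_sqrt A) = dim_row A \<and> psd_sqrt A * psd_sqrt A = A"
    unfolding psd_sqrt_def by (rule someI)
  thus "psd (psd_sqrt A)" "dim_row (psd_sqrt A) = dim_row A" "psd_sqrt A * psd_sqrt A = A" by auto
qed

section \<open>Positive definite matrices\<close>

definition pos_def :: "nat \<Rightarrow> complex mat \<Rightarrow> bool" where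
  "pos_def n A \<longleftrightarrow> A \<in> carrier_mat n n \<and> mat_adjoint A = A \<and>
     (\<forall>v \<in> carrier_vec n. v \<noteq> 0\<^sub>v n \<longrightarrow> 0 < Re ((A *\<^sub>v v) \<bullet>c v))"

lemma pos_defD:
  assumes "pos_def n A"
  shows "A \<in> carrier_mat n n" "mat_adjoint A = A"
    "v \<in> carrier_vec n \<Longrightarrow> v \<noteq> 0\<^sub>v n \<Longrightarrow> 0 < Re ((A *\<^sub>v v) \<bullet>c v)"
    "v \<in> carrier_vec n \<Longrightarrow> 0 \<le> Re ((A *\<^sub>v v) \<bullet>c v)"
proof -
  show "A \<in> carrier_mat n n" "mat_adjoint A = A"
    "v \<in> carrier_vec n \<Longrightarrow> v \<noteq> 0\<^sub>v n \<Longrightarrow> 0 < Re ((A *\<^sub>v v) \<bullet>c v)"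
    using assms unfolding pos_def_def by blast+
  moreover have "(A *\<^sub>v 0\<^sub>v n) \<bullet>c 0\<^sub>v n = 0" using \<open>A \<in> carrier_mat n n\<close>
    by (subst cscalar_prod_conv_sum[of _ n]) auto
  ultimately show "v \<in> carrier_vec n \<Longrightarrow> 0 \<le> Re ((A *\<^sub>v v) \<bullet>c v)"
    by (cases "v = 0\<^sub>v n") (metis order.refl zero_complex.sel(1), metis less_imp_le)
qed

lemma pos_def_det:
  assumes "pos_def n A"
  shows "det A = of_real (Re (det A))" "Re (det A) > 0"
proof -
  note A = pos_defD[OF assms]
  obtain U d where U: "U \<in> carrier_mat n n" "mat_adjoint U * U = 1\<^sub>m n"
     and Ad: "A = U * mat_diag n (\<lambda>i. of_real (d i)) * mat_adjoint U"
    using hermitian_diagonalization[OF A(1,2)] by blast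
  have d: "0 < d i" if "i < n" for i
  proof -
    from A(3)[OF col_carrier[OF U(1), of i] diagonalization_eigenvalue(2)[OF U that Ad]] show ?thesis
      unfolding diagonalization_eigenvalue(1)[OF U that Ad] Re_complex_of_real .
  qed
  have 1: "det (mat_adjoint U) * det U = 1"
    using U by (subst det_mult[symmetric, of _ n]) auto
  have "det A = det (U * mat_diag n (\<lambda>i. of_real (d i))) * det (mat_adjoint U)"
    unfolding Ad using U by (intro det_mult) auto
  also have "\<dots> = (det (mat_adjoint U) * det U) * det (mat_diag n (\<lambda>i. of_real (d i)) :: complex mat)"
    using U by (subst det_mult[of _ n]) auto
  also have "\<dots> = of_real (\<Prod>i<n. d i)" by (simp add: 1 det_mat_diag)
  finally have "det A = of_real (\<Prod>i<n. d i)" .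
  moreover have "(\<Prod>i<n. d i) > 0" using d by (intro prod_pos) auto
  ultimately show "det A = of_real (Re (det A))" "Re (det A) > 0" by (simp_all del: of_real_prod)
qed

lemma mat_inverse_exists:
  fixes A :: "complex mat"
  assumes A: "A \<in> carrier_mat n n" and "det A \<noteq> 0"
  obtains B where "mat_inverse A = Some B" "A * B = 1\<^sub>m n" "B * A = 1\<^sub>m n" "B \<in> carrier_mat n n"
proof (cases "mat_inverse A")
  case None
  have "A \<notin> Units (ring_mat TYPE(complex) n ())" by (rule mat_inverse(1)[OF A None])
  moreover have "A \<in> Units (ring_mat TYPE(complex) n ())" by (rule det_non_zero_imp_unit[OF assms])
  ultimately show ?thesis by contradiction
next
  case (Some B)
  with mat_inverse(2)[OF A Some] that show ?thesis by blast
qed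

text \<open>With \<open>w = B v\<close>, hence \<open>v = A w\<close>, the form of \<open>B\<close>
  at \<open>v\<close> is the form of \<open>A\<close> at \<open>w\<close>. Self-adjointness follows
  because the adjoint of \<open>B\<close> is an inverse of \<open>A\<close> too.\<close>

lemma pos_def_inverse:
  assumes P: "pos_def n A" and B: "B \<in> carrier_mat n n" and AB: "A * B = 1\<^sub>m n"
  shows "pos_def n B"
proof -
  note A = pos_defD[OF P]
  have "mat_adjoint B * A = 1\<^sub>m n"
    using mat_adjoint_mult[OF A(1) B] A(2) AB by simp
  hence "mat_adjoint B * A * B = B" using left_mult_one_mat[OF B] by simp
  moreover have "mat_adjoint B * A * B = mat_adjoint B * (A * B)"
    using A(1) B by (intro assoc_mult_mat[of _ n n _ n _ n]) auto
  moreover have "mat_adjoint B * (A * B) = mat_adjoint B"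
    using B unfolding AB by (intro right_mult_one_mat[of _ n n]) auto
  ultimately have adj: "mat_adjoint B = B" by simp
  have "0 < Re ((B *\<^sub>v v) \<bullet>c v)" if v: "v \<in> carrier_vec n" "v \<noteq> 0\<^sub>v n" for v
  proof -
    have Bv: "B *\<^sub>v v \<in> carrier_vec n" using B v by auto
    have ABv: "A *\<^sub>v (B *\<^sub>v v) = v"
      using assoc_mult_mat_vec[OF A(1) B v(1)] one_mult_mat_vec[OF v(1)] unfolding AB by simp
    have "B *\<^sub>v v \<noteq> 0\<^sub>v n"
    proof
      assume "B *\<^sub>v v = 0\<^sub>v n"
      moreover have "A *\<^sub>v 0\<^sub>v n = 0\<^sub>v n" using A(1) by auto
      ultimately show False using ABv v(2) by metis
    qed
    hence "0 < Re ((A *\<^sub>v (B *\<^sub>v v)) \<bullet>c (B *\<^sub>v v))" using A(3) Bv by blast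
    also have "(A *\<^sub>v (B *\<^sub>v v)) \<bullet>c (B *\<^sub>v v) = v \<bullet>c (B *\<^sub>v v)" unfolding ABv ..
    also have "\<dots> = (B *\<^sub>v v) \<bullet>c v" using cscalar_prod_adjoint[OF B v(1) v(1)] unfolding adj by (rule sym)
    finally show ?thesis .
  qed
  thus ?thesis using adj B unfolding pos_def_def by blast
qed

text \<open>The Weinstein-Aronszajn identity. Multiplying \<open>M\<close> by the unimodular
  \<open>L\<close> on the right or on the left makes it block triangular, with a different
  nontrivial diagonal block in each case, and both products have the same determinant.\<close>

lemma det_one_plus_mult_commute:
  fixes X Y :: "'a :: idom mat"
  assumes X: "X \<in> carrier_mat n m" and Y: "Y \<in> carrier_mat m n"
  shows "det (1\<^sub>m n + X * Y) = det (1\<^sub>m m + Y * X)"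
proof -
  have X': "- X \<in> carrier_mat n m" and YX: "Y * X \<in> carrier_mat m m" and XY: "X * Y \<in> carrier_mat n n"
    using X Y by (auto intro: mult_carrier_mat)
  define M where "M = four_block_mat (1\<^sub>m n) (- X) Y (1\<^sub>m m)"
  define L where "L = four_block_mat (1\<^sub>m n) X (0\<^sub>m m n) (1\<^sub>m m)"
  have c: "M \<in> carrier_mat (n + m) (n + m)" "L \<in> carrier_mat (n + m) (n + m)"
    unfolding M_def L_def by (rule four_block_carrier_mat; simp)+
  have detL: "det L = 1" unfolding L_def
    using det_four_block_mat_lower_left_zero[OF one_carrier_mat X refl one_carrier_mat] by simp
  have "M * L = four_block_mat (1\<^sub>m n) (0\<^sub>m n m) Y (1\<^sub>m m + Y * X)"
  proof -
    have "1\<^sub>m n * X + - X * 1\<^sub>m m = 0\<^sub>m n m"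
      unfolding left_mult_one_mat[OF X] right_mult_one_mat[OF X'] using X by (intro eq_matI) simp_all
    moreover have "Y * X + 1\<^sub>m m * 1\<^sub>m m = 1\<^sub>m m + Y * X"
      unfolding left_mult_one_mat[OF one_carrier_mat] by (rule comm_add_mat[OF YX one_carrier_mat])
    moreover have "1\<^sub>m n * 1\<^sub>m n + - X * 0\<^sub>m m n = 1\<^sub>m n"
      unfolding left_mult_one_mat[OF one_carrier_mat] right_mult_zero_mat[OF X']
      by (rule right_add_zero_mat[OF one_carrier_mat])
    moreover have "Y * 1\<^sub>m n + 1\<^sub>m m * 0\<^sub>m m n = Y"
      unfolding right_mult_one_mat[OF Y] right_mult_zero_mat[OF one_carrier_mat]
      by (rule right_add_zero_mat[OF Y])
    ultimately show ?thesis
      unfolding M_def L_def mult_four_block_mat[OF one_carrier_mat X' Y one_carrier_mat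
          one_carrier_mat X zero_carrier_mat one_carrier_mat] by (simp only:)
  qed
  hence "det M * det L = det (1\<^sub>m m + Y * X)"
    unfolding det_mult[symmetric, OF c]
    using det_four_block_mat_upper_right_zero[OF one_carrier_mat refl Y add_carrier_mat[OF YX, of "1\<^sub>m m"]]
    by simp
  moreover have "L * M = four_block_mat (1\<^sub>m n + X * Y) (0\<^sub>m n m) Y (1\<^sub>m m)"
  proof -
    have "1\<^sub>m n * 1\<^sub>m n + X * Y = 1\<^sub>m n + X * Y"
      unfolding left_mult_one_mat[OF one_carrier_mat] ..
    moreover have "1\<^sub>m n * - X + X * 1\<^sub>m m = 0\<^sub>m n m"
      unfolding left_mult_one_mat[OF X'] right_mult_one_mat[OF X]
      using X by (rule uminus_l_inv_mat)
    moreover have "0\<^sub>m m n * 1\<^sub>m n + 1\<^sub>m m * Y = Y"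
      unfolding left_mult_one_mat[OF Y] left_mult_zero_mat[OF one_carrier_mat]
      by (rule left_add_zero_mat[OF Y])
    moreover have "0\<^sub>m m n * - X + 1\<^sub>m m * 1\<^sub>m m = 1\<^sub>m m"
      unfolding left_mult_one_mat[OF one_carrier_mat] left_mult_zero_mat[OF X']
      by (rule left_add_zero_mat[OF one_carrier_mat])
    ultimately show ?thesis
      unfolding M_def L_def mult_four_block_mat[OF one_carrier_mat X zero_carrier_mat one_carrier_mat
          one_carrier_mat X' Y one_carrier_mat] by (simp only:)
  qed
  hence "det L * det M = det (1\<^sub>m n + X * Y)"
    unfolding det_mult[symmetric, OF c(2,1)]
    using det_four_block_mat_upper_right_zero[OF add_carrier_mat[OF XY, of "1\<^sub>m n"] refl Y one_carrier_mat[of m]]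
    by simp
  ultimately show ?thesis using detL by simp
qed


section \<open>Rank-one updates and the Loewner order\<close>

lemma cscalar_prod_cnj:
  fixes v w :: "complex vec"
  assumes "v \<in> carrier_vec n" "w \<in> carrier_vec n"
  shows "w \<bullet>c v = cnj (v \<bullet>c w)"
  unfolding cscalar_prod_conv_sum[OF assms] cscalar_prod_conv_sum[OF assms(2,1)]
  by (simp add: mult.commute)

definition outer_prod :: "nat \<Rightarrow> complex vec \<Rightarrow> complex mat" where
  "outer_prod n s = mat n n (\<lambda>(i, j). s $ i * cnj (s $ j))"

lemma outer_prod_carrier: "outer_prod n s \<in> carrier_mat n n"
  by (simp add: outer_prod_def)

lemma quad_outer_prod:
  assumes s: "s \<in> carrier_vec n" and v: "v \<in> carrier_vec n"
  shows "(outer_prod n s *\<^sub>v v) \<bullet>c v = of_real ((cmod (v \<bullet>c s))\<^sup>2)"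
proof -
  have *: "outer_prod n s *\<^sub>v v = (v \<bullet>c s) \<cdot>\<^sub>v s"
  proof (rule eq_vecI)
    fix i assume "i < dim_vec ((v \<bullet>c s) \<cdot>\<^sub>v s)"
    hence i: "i < n" using s by simp
    have "(outer_prod n s *\<^sub>v v) $ i = (\<Sum>j<n. s $ i * cnj (s $ j) * v $ j)"
      using i v by (simp add: outer_prod_def scalar_prod_def lessThan_atLeast0)
    also have "\<dots> = (v \<bullet>c s) * s $ i"
      unfolding cscalar_prod_conv_sum[OF v s] by (simp add: sum_distrib_left mult_ac)
    finally show "(outer_prod n s *\<^sub>v v) $ i = ((v \<bullet>c s) \<cdot>\<^sub>v s) $ i" using i s by simp
  qed (use s in \<open>simp add: outer_prod_def\<close>)
  have "((v \<bullet>c s) \<cdot>\<^sub>v s) \<bullet>c v = (\<Sum>i<n. ((v \<bullet>c s) \<cdot>\<^sub>v s) $ i * cnj (v $ i))"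
    using s v by (intro cscalar_prod_conv_sum) auto
  also have "\<dots> = (\<Sum>i<n. (v \<bullet>c s) * (s $ i * cnj (v $ i)))"
    using s by (intro sum.cong) auto
  also have "\<dots> = (v \<bullet>c s) * (s \<bullet>c v)"
    unfolding cscalar_prod_conv_sum[OF s v] sum_distrib_left ..
  also have "\<dots> = of_real ((cmod (v \<bullet>c s))\<^sup>2)"
    unfolding cscalar_prod_cnj[OF v s] complex_norm_square ..
  finally show ?thesis unfolding * .
qed

lemma quad_add:
  assumes "A \<in> carrier_mat n n" "B \<in> carrier_mat n n" "v \<in> carrier_vec n"
  shows "((A + B) *\<^sub>v v) \<bullet>c v = (A *\<^sub>v v) \<bullet>c v + (B *\<^sub>v v) \<bullet>c (v :: complex vec)"
  unfolding add_mult_distrib_mat_vec[OF assms]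
  using assms by (intro add_scalar_prod_distrib[of _ n]) (auto intro: mult_mat_vec_carrier[of _ n n])

lemma mat_adjoint_add:
  fixes A B :: "complex mat"
  assumes "A \<in> carrier_mat n m" "B \<in> carrier_mat n m"
  shows "mat_adjoint (A + B) = mat_adjoint A + mat_adjoint B"
  using assms by (intro eq_matI) auto

lemma pos_def_add_outer_prod:
  assumes W: "pos_def n W" and s: "s \<in> carrier_vec n"
  shows "pos_def n (W + outer_prod n s)"
proof -
  note W' = pos_defD[OF W]
  note O = outer_prod_carrier[of n s]
  have "mat_adjoint (outer_prod n s) = outer_prod n s"
    by (intro eq_matI) (auto simp: outer_prod_def)
  hence "mat_adjoint (W + outer_prod n s) = W + outer_prod n s"
    unfolding mat_adjoint_add[OF W'(1) O] W'(2) by simp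
  moreover have "0 < Re (((W + outer_prod n s) *\<^sub>v v) \<bullet>c v)" if v: "v \<in> carrier_vec n" "v \<noteq> 0\<^sub>v n" for v
    unfolding quad_add[OF W'(1) O v(1)] quad_outer_prod[OF s v(1)] plus_complex.sel Re_complex_of_real
    by (intro add_pos_nonneg W'(3) v) simp
  ultimately show ?thesis using add_carrier_mat[OF O, of W] unfolding pos_def_def by blast
qed

text \<open>The matrix determinant lemma. Since \<open>B\<close> inverts \<open>W\<close>, the
  updated matrix is \<open>W\<close> times the identity plus the column \<open>B s\<close> times a
  row, and the preceding identity reduces the second determinant to size 1.\<close>

lemma det_add_outer_prod:
  assumes W: "W \<in> carrier_mat n n" and B: "B \<in> carrier_mat n n" and WB: "W * B = 1\<^sub>m n"
    and s: "s \<in> carrier_vec n"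
  shows "det (W + outer_prod n s) = det W * (1 + (B *\<^sub>v s) \<bullet>c s)"
proof -
  define X where "X = mat n 1 (\<lambda>(i, _). (B *\<^sub>v s) $ i)"
  define S where "S = mat n 1 (\<lambda>(i, _). s $ i)"
  define Y where "Y = mat 1 n (\<lambda>(_, j). cnj (s $ j))"
  have c: "X \<in> carrier_mat n 1" "S \<in> carrier_mat n 1" "Y \<in> carrier_mat 1 n"
    by (auto simp: X_def S_def Y_def)
  have Bs: "B *\<^sub>v s \<in> carrier_vec n" using B s by (rule mult_mat_vec_carrier)
  have WBs: "W *\<^sub>v (B *\<^sub>v s) = s"
    using assoc_mult_mat_vec[OF W B s] one_mult_mat_vec[OF s] unfolding WB by simp
  have "W * X = S"
  proof (rule eq_matI)
    fix i j assume "i < dim_row S" "j < dim_col S"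
    hence i: "i < n" "j = 0" by (auto simp: S_def)
    have "col X 0 = B *\<^sub>v s" using carrier_vecD[OF Bs]
      by (intro eq_vecI) (simp_all add: X_def del: index_mult_mat_vec dim_mult_mat_vec)
    hence "(W * X) $$ (i, 0) = (W *\<^sub>v (B *\<^sub>v s)) $ i" using i W c by simp
    thus "(W * X) $$ (i, j) = S $$ (i, j)" using i unfolding WBs by (simp add: S_def)
  qed (use W c in auto)
  moreover have "S * Y = outer_prod n s"
    by (intro eq_matI) (auto simp: S_def Y_def outer_prod_def scalar_prod_def)
  ultimately have "W * (X * Y) = outer_prod n s"
    using assoc_mult_mat[OF W c(1,3)] by simp
  moreover have XY: "X * Y \<in> carrier_mat n n" by (rule mult_carrier_mat[OF c(1,3)])
  ultimately have "W + outer_prod n s = W * (1\<^sub>m n + X * Y)"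
    using mult_add_distrib_mat[OF W one_carrier_mat XY] right_mult_one_mat[OF W] by simp
  hence "det (W + outer_prod n s) = det W * det (1\<^sub>m n + X * Y)"
    using det_mult[OF W add_carrier_mat[OF XY]] by simp
  also have "det (1\<^sub>m n + X * Y) = det (1\<^sub>m 1 + Y * X)"
    by (rule det_one_plus_mult_commute[OF c(1,3)])
  also have "\<dots> = (1\<^sub>m 1 + Y * X) $$ (0, 0)"
    by (rule det_single[OF add_carrier_mat[OF mult_carrier_mat[OF c(3,1)]]])
  also have "\<dots> = 1 + (\<Sum>i<n. cnj (s $ i) * (B *\<^sub>v s) $ i)"
    using c by (simp add: scalar_prod_def lessThan_atLeast0) (simp add: X_def Y_def)
  also have "(\<Sum>i<n. cnj (s $ i) * (B *\<^sub>v s) $ i) = (B *\<^sub>v s) \<bullet>c s"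
    unfolding cscalar_prod_conv_sum[OF Bs s] by (intro sum.cong) (auto simp: mult.commute)
  finally show ?thesis .
qed

definition loewner_le :: "nat \<Rightarrow> complex mat \<Rightarrow> complex mat \<Rightarrow> bool" where
  "loewner_le n A B \<longleftrightarrow> (\<forall>v \<in> carrier_vec n. Re ((A *\<^sub>v v) \<bullet>c v) \<le> Re ((B *\<^sub>v v) \<bullet>c v))"

text \<open>Inversion reverses the Loewner order. The solutions of \<open>W1 u = s\<close> and
  \<open>W2 v = s\<close> are compared by expanding the form of \<open>W1\<close> at
  \<open>u - v\<close>, which avoids square roots and simultaneous diagonalization.\<close>

lemma quad_inverse_antimono:
  assumes P1: "pos_def n W1" and P2: "pos_def n W2" and le: "loewner_le n W1 W2"
    and B1: "B1 \<in> carrier_mat n n" "W1 * B1 = 1\<^sub>m n"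
    and B2: "B2 \<in> carrier_mat n n" "W2 * B2 = 1\<^sub>m n"
    and s: "s \<in> carrier_vec n"
  shows "Re ((B2 *\<^sub>v s) \<bullet>c s) \<le> Re ((B1 *\<^sub>v s) \<bullet>c s)"
proof -
  note W1 = pos_defD[OF P1] and W2 = pos_defD[OF P2]
  define u where "u = B1 *\<^sub>v s"
  define v where "v = B2 *\<^sub>v s"
  have u: "u \<in> carrier_vec n" and v: "v \<in> carrier_vec n"
    unfolding u_def v_def using B1 B2 s by (auto intro: mult_mat_vec_carrier)
  have W1u: "W1 *\<^sub>v u = s"
    using assoc_mult_mat_vec[OF W1(1) B1(1) s] one_mult_mat_vec[OF s] unfolding B1(2) u_def by simp
  have W2v: "W2 *\<^sub>v v = s"
    using assoc_mult_mat_vec[OF W2(1) B2(1) s] one_mult_mat_vec[OF s] unfolding B2(2) v_def by simp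
  have W1v: "W1 *\<^sub>v v \<in> carrier_vec n" using W1(1) v by (rule mult_mat_vec_carrier)
  have Wuv: "W1 *\<^sub>v (u - v) = s - W1 *\<^sub>v v"
    using mult_minus_distrib_mat_vec[OF W1(1) u v] unfolding W1u .
  have sym: "(W1 *\<^sub>v v) \<bullet>c u = v \<bullet>c s"
    using cscalar_prod_adjoint[OF W1(1) v u] unfolding W1(2) W1u .
  \<comment> \<open>expanding this square gives \<open>0 \<le> s\<^sup>*u - 2 Re s\<^sup>*v + v\<^sup>*W1 v\<close>, and \<open>v\<^sup>*W1 v \<le> v\<^sup>*W2 v = s\<^sup>*v\<close>\<close>
  have "0 \<le> Re ((W1 *\<^sub>v (u - v)) \<bullet>c (u - v))" using u v by (intro W1(4)) auto
  also have "(W1 *\<^sub>v (u - v)) \<bullet>c (u - v) = (\<Sum>i<n. (s - W1 *\<^sub>v v) $ i * cnj ((u - v) $ i))"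
    unfolding Wuv using s W1v u v by (intro cscalar_prod_conv_sum) auto
  also have "\<dots> = (\<Sum>i<n. s $ i * cnj (u $ i) - s $ i * cnj (v $ i)
      - (W1 *\<^sub>v v) $ i * cnj (u $ i) + (W1 *\<^sub>v v) $ i * cnj (v $ i))"
  proof (intro sum.cong refl)
    fix i assume "i \<in> {..<n}"
    hence "(s - W1 *\<^sub>v v) $ i = s $ i - (W1 *\<^sub>v v) $ i" "(u - v) $ i = u $ i - v $ i"
      using carrier_vecD[OF W1v] carrier_vecD[OF v]
      by (simp_all del: index_mult_mat_vec dim_mult_mat_vec)
    thus "(s - W1 *\<^sub>v v) $ i * cnj ((u - v) $ i) = s $ i * cnj (u $ i) - s $ i * cnj (v $ i)
      - (W1 *\<^sub>v v) $ i * cnj (u $ i) + (W1 *\<^sub>v v) $ i * cnj (v $ i)"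
      by (simp only: complex_cnj_diff) (simp only: algebra_simps)
  qed
  also have "\<dots> = s \<bullet>c u - s \<bullet>c v - (W1 *\<^sub>v v) \<bullet>c u + (W1 *\<^sub>v v) \<bullet>c v"
    unfolding cscalar_prod_conv_sum[OF s u] cscalar_prod_conv_sum[OF s v]
      cscalar_prod_conv_sum[OF W1v u] cscalar_prod_conv_sum[OF W1v v] sum_subtractf sum.distrib ..
  finally have "0 \<le> Re (s \<bullet>c u) - Re (s \<bullet>c v) - Re (v \<bullet>c s) + Re ((W1 *\<^sub>v v) \<bullet>c v)"
    unfolding sym plus_complex.sel minus_complex.sel .
  moreover have "Re ((W1 *\<^sub>v v) \<bullet>c v) \<le> Re (s \<bullet>c v)"
    using le v W2v unfolding loewner_le_def by metis
  moreover have "Re (s \<bullet>c u) = Re (u \<bullet>c s)" unfolding cscalar_prod_cnj[OF u s] by simp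
  ultimately show ?thesis unfolding u_def[symmetric] v_def[symmetric] by linarith
qed

text \<open>Leads from \<open>W\<close> to \<open>W\<close> plus the Gram matrix of \<open>S\<close>
  in rank-one steps, one column of \<open>S\<close> at a time.\<close>

definition add_gram :: "nat \<Rightarrow> complex mat \<Rightarrow> complex mat \<Rightarrow> nat \<Rightarrow> complex mat" where
  "add_gram n W S m = mat n n (\<lambda>(i, j). W $$ (i, j) + (\<Sum>k<m. S $$ (i, k) * cnj (S $$ (j, k))))"

lemma add_gram_0: "W \<in> carrier_mat n n \<Longrightarrow> add_gram n W S 0 = W"
  by (intro eq_matI) (auto simp: add_gram_def)

lemma add_gram_Suc:
  "S \<in> carrier_mat n p \<Longrightarrow> m < p \<Longrightarrow> add_gram n W S (Suc m) = add_gram n W S m + outer_prod n (col S m)"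
  by (intro eq_matI) (auto simp: add_gram_def outer_prod_def)

lemma add_gram_full:
  "W \<in> carrier_mat n n \<Longrightarrow> S \<in> carrier_mat n p \<Longrightarrow> add_gram n W S p = W + S * mat_adjoint S"
  by (intro eq_matI) (auto simp: add_gram_def scalar_prod_def lessThan_atLeast0)

lemma loewner_le_add_outer_prod:
  assumes "loewner_le n A B" "A \<in> carrier_mat n n" "B \<in> carrier_mat n n"
  shows "loewner_le n (A + outer_prod n s) (B + outer_prod n s)"
  unfolding loewner_le_def
  using assms(1) unfolding loewner_le_def
  by (auto simp only: quad_add[OF assms(2) outer_prod_carrier] quad_add[OF assms(3) outer_prod_carrier]
      plus_complex.sel)

text \<open>By the matrix determinant lemma each column \<open>s\<close> multiplies the ratio by 1
  plus the inverse form of the current matrix at \<open>s\<close>, and this factor is smaller for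
  the larger matrix. The order survives every step because the same outer product is added on both
  sides.\<close>

lemma det_ratio_antimono:
  assumes P1: "pos_def n W1" and P2: "pos_def n W2" and le: "loewner_le n W1 W2"
    and S: "S \<in> carrier_mat n p"
  shows "pos_def n (W1 + S * mat_adjoint S)"
    "Re (det (W2 + S * mat_adjoint S)) / Re (det W2) \<le> Re (det (W1 + S * mat_adjoint S)) / Re (det W1)"
proof -
  define A where "A W m = add_gram n W S m" for W m
  have "m \<le> p \<Longrightarrow> pos_def n (A W1 m) \<and> pos_def n (A W2 m) \<and> loewner_le n (A W1 m) (A W2 m) \<and>
     Re (det (A W2 m)) / Re (det W2) \<le> Re (det (A W1 m)) / Re (det W1)" for m
  proof (induction m)
    case 0
    show ?case unfolding A_def using P1 P2 le pos_def_det(2)[OF P1] pos_def_det(2)[OF P2]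
      by (simp add: add_gram_0 pos_defD(1))
  next
    case (Suc m)
    define s where "s = col S m"
    have s: "s \<in> carrier_vec n" unfolding s_def by (rule col_carrier[OF S])
    have IH: "pos_def n (A W1 m)" "pos_def n (A W2 m)" "loewner_le n (A W1 m) (A W2 m)"
       "Re (det (A W2 m)) / Re (det W2) \<le> Re (det (A W1 m)) / Re (det W1)"
      using Suc by auto
    have AS: "A W (Suc m) = A W m + outer_prod n s" for W
      unfolding A_def s_def using S Suc.prems by (intro add_gram_Suc) auto
    have nz: "det (A W1 m) \<noteq> 0" "det (A W2 m) \<noteq> 0"
      using pos_def_det(2)[OF IH(1)] pos_def_det(2)[OF IH(2)] by auto
    obtain B1 where B1: "B1 \<in> carrier_mat n n" "A W1 m * B1 = 1\<^sub>m n"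
      using mat_inverse_exists[OF pos_defD(1)[OF IH(1)] nz(1)] by blast
    obtain B2 where B2: "B2 \<in> carrier_mat n n" "A W2 m * B2 = 1\<^sub>m n"
      using mat_inverse_exists[OF pos_defD(1)[OF IH(2)] nz(2)] by blast
    have step: "Re (det (A W (Suc m))) = Re (det (A W m)) * (1 + Re ((B *\<^sub>v s) \<bullet>c s))"
      if P: "pos_def n (A W m)" and B: "B \<in> carrier_mat n n" "A W m * B = 1\<^sub>m n" for W B
      unfolding AS det_add_outer_prod[OF pos_defD(1)[OF P] B s]
      by (subst pos_def_det(1)[OF P]) (simp only: times_complex.sel Re_complex_of_real Im_complex_of_real
          plus_complex.sel one_complex.sel mult_zero_left diff_zero)
    have q: "Re ((B2 *\<^sub>v s) \<bullet>c s) \<le> Re ((B1 *\<^sub>v s) \<bullet>c s)"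
      by (rule quad_inverse_antimono[OF IH(1-3) B1 B2 s])
    have q0: "0 \<le> Re ((B2 *\<^sub>v s) \<bullet>c s)"
      by (rule pos_defD(4)[OF pos_def_inverse[OF IH(2) B2] s])
    have "Re (det (A W2 m)) / Re (det W2) * (1 + Re ((B2 *\<^sub>v s) \<bullet>c s))
        \<le> Re (det (A W1 m)) / Re (det W1) * (1 + Re ((B1 *\<^sub>v s) \<bullet>c s))"
      using pos_def_det(2)[OF P1] pos_def_det(2)[OF IH(1)]
      by (intro mult_mono IH(4) add_left_mono q add_nonneg_nonneg q0 divide_nonneg_nonneg) simp_all
    hence "Re (det (A W2 (Suc m))) / Re (det W2) \<le> Re (det (A W1 (Suc m))) / Re (det W1)"
      unfolding step[OF IH(1) B1] step[OF IH(2) B2] times_divide_eq_left .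
    thus ?case unfolding AS
      using pos_def_add_outer_prod[OF IH(1) s] pos_def_add_outer_prod[OF IH(2) s]
        loewner_le_add_outer_prod[OF IH(3) pos_defD(1)[OF IH(1)] pos_defD(1)[OF IH(2)]] by blast
  qed
  from this[of p] show "pos_def n (W1 + S * mat_adjoint S)"
    "Re (det (W2 + S * mat_adjoint S)) / Re (det W2) \<le> Re (det (W1 + S * mat_adjoint S)) / Re (det W1)"
    unfolding A_def add_gram_full[OF pos_defD(1)[OF P1] S] add_gram_full[OF pos_defD(1)[OF P2] S] by auto
qed

section \<open>Determinants of channels with coloured noise\<close>

text \<open>
  For a channel \<open>S\<close> with noise covariance \<open>W\<close> this is the determinant of the whitened channel, without
  the square root of the inverse of \<open>W\<close>, and so visibly a measurable function of the entries.
\<close>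
definition noisy_det :: "complex mat \<Rightarrow> complex mat \<Rightarrow> real \<Rightarrow> real" where
  "noisy_det W S \<rho> = Re (det (W + of_real \<rho> \<cdot>\<^sub>m (S * mat_adjoint S))) / Re (det W)"

lemma mat_adjoint_smult_real:
  fixes A :: "complex mat"
  shows "mat_adjoint (of_real c \<cdot>\<^sub>m A) = of_real c \<cdot>\<^sub>m mat_adjoint A"
  by (rule eq_matI) auto

lemma smult_smult_mat: "a \<cdot>\<^sub>m (b \<cdot>\<^sub>m A) = (a * b :: 'a :: semigroup_mult) \<cdot>\<^sub>m A"
  by (rule eq_matI) (auto simp: mult.assoc)

lemma gram_smult_real:
  fixes S :: "complex mat"
  assumes S: "S \<in> carrier_mat n p"
  shows "(of_real c \<cdot>\<^sub>m S) * mat_adjoint (of_real c \<cdot>\<^sub>m S) = of_real (c\<^sup>2) \<cdot>\<^sub>m (S * mat_adjoint S)"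
proof -
  have "(of_real c \<cdot>\<^sub>m S) * mat_adjoint (of_real c \<cdot>\<^sub>m S) = of_real c \<cdot>\<^sub>m (of_real c \<cdot>\<^sub>m (S * mat_adjoint S))"
    unfolding mat_adjoint_smult_real
      mult_smult_assoc_mat[OF S smult_carrier_mat[OF mat_adjoint_carrier[OF S]]]
      mult_smult_distrib[OF S mat_adjoint_carrier[OF S]] ..
  also have "\<dots> = of_real (c\<^sup>2) \<cdot>\<^sub>m (S * mat_adjoint S)"
    by (simp add: smult_smult_mat power2_eq_square)
  finally show ?thesis .
qed

lemma noisy_det_sqrt:
  assumes S: "S \<in> carrier_mat n p" and "0 \<le> \<rho>"
  shows "noisy_det W S \<rho> = Re (det (W + (of_real (sqrt \<rho>) \<cdot>\<^sub>m S) * mat_adjoint (of_real (sqrt \<rho>) \<cdot>\<^sub>m S))) / Re (det W)"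
  unfolding noisy_det_def gram_smult_real[OF S] using assms(2) by simp

lemma noisy_det_antimono:
  assumes "pos_def n W1" "pos_def n W2" "loewner_le n W1 W2" "S \<in> carrier_mat n p" "0 \<le> \<rho>"
  shows "noisy_det W2 S \<rho> \<le> noisy_det W1 S \<rho>"
  unfolding noisy_det_sqrt[OF assms(4,5)]
  by (rule det_ratio_antimono(2)[OF assms(1-3) smult_carrier_mat[OF assms(4)]])

lemma noisy_det_pos:
  assumes W: "pos_def n W" and S: "S \<in> carrier_mat n p" and "0 \<le> \<rho>"
  shows "0 < noisy_det W S \<rho>"
proof -
  have "loewner_le n W W" by (simp add: loewner_le_def)
  note P = det_ratio_antimono(1)[OF W W this smult_carrier_mat[OF S]]
  show ?thesis unfolding noisy_det_sqrt[OF assms(2,3)]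
    by (rule divide_pos_pos[OF pos_def_det(2)[OF P] pos_def_det(2)[OF W]])
qed

lemma quad_smult_one:
  assumes v: "v \<in> carrier_vec n"
  shows "((of_real c \<cdot>\<^sub>m 1\<^sub>m n) *\<^sub>v v) \<bullet>c v = (of_real (c * (\<Sum>i<n. (cmod (v $ i))\<^sup>2)) :: complex)"
proof -
  have cv: "(of_real c \<cdot>\<^sub>m 1\<^sub>m n) *\<^sub>v v = (of_real c :: complex) \<cdot>\<^sub>v v"
    using v by (intro eq_vecI) (auto simp: scalar_prod_def if_distrib if_distribR sum.delta cong: if_cong)
  have "(of_real c \<cdot>\<^sub>v v) \<bullet>c v = (\<Sum>i<n. (of_real c \<cdot>\<^sub>v v) $ i * cnj (v $ i))"
    using v by (intro cscalar_prod_conv_sum) auto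
  also have "\<dots> = (\<Sum>i<n. of_real (c * (cmod (v $ i))\<^sup>2))"
    using v by (intro sum.cong) (auto simp: complex_norm_square[symmetric] simp flip: of_real_power)
  finally show ?thesis unfolding cv sum_distrib_left of_real_sum .
qed

lemma sum_norm_square_pos:
  assumes "v \<in> carrier_vec n" "v \<noteq> 0\<^sub>v n"
  shows "0 < (\<Sum>i<n. (cmod (v $ i))\<^sup>2)"
proof -
  have "\<not> (\<forall>i<n. v $ i = 0)"
    using assms by (auto intro!: eq_vecI)
  then obtain i where "i < n" "v $ i \<noteq> 0" by blast
  thus ?thesis by (intro sum_pos2[of _ i]) auto
qed

lemma pos_def_smult_one:
  assumes "0 < c"
  shows "pos_def n (of_real c \<cdot>\<^sub>m 1\<^sub>m n)"
  unfolding pos_def_def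
proof (intro conjI ballI impI)
  show "mat_adjoint (of_real c \<cdot>\<^sub>m 1\<^sub>m n) = (of_real c \<cdot>\<^sub>m 1\<^sub>m n :: complex mat)"
    by (simp only: mat_adjoint_smult_real mat_adjoint_one)
  fix v :: "complex vec" assume "v \<in> carrier_vec n" "v \<noteq> 0\<^sub>v n"
  thus "0 < Re (((of_real c \<cdot>\<^sub>m 1\<^sub>m n) *\<^sub>v v) \<bullet>c v)"
    unfolding quad_smult_one[OF \<open>v \<in> carrier_vec n\<close>] Re_complex_of_real
    using assms sum_norm_square_pos by simp
qed simp

lemma noisy_det_smult_one:
  assumes S: "S \<in> carrier_mat n p" and c: "0 < c"
  shows "noisy_det (of_real c \<cdot>\<^sub>m 1\<^sub>m n) S \<rho> = noisy_det (1\<^sub>m n) S (\<rho> / c)"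
proof -
  have SS: "S * mat_adjoint S \<in> carrier_mat n n"
    by (rule mult_carrier_mat[OF S mat_adjoint_carrier[OF S]])
  have "of_real c \<cdot>\<^sub>m 1\<^sub>m n + of_real \<rho> \<cdot>\<^sub>m (S * mat_adjoint S)
      = of_real c \<cdot>\<^sub>m (1\<^sub>m n + of_real (\<rho> / c) \<cdot>\<^sub>m (S * mat_adjoint S))"
    using SS c by (intro eq_matI) (auto simp: distrib_left simp del: index_mult_mat(1))
  hence "det (of_real c \<cdot>\<^sub>m 1\<^sub>m n + of_real \<rho> \<cdot>\<^sub>m (S * mat_adjoint S))
      = of_real (c ^ n) * det (1\<^sub>m n + of_real (\<rho> / c) \<cdot>\<^sub>m (S * mat_adjoint S))"
    using SS S by simp
  moreover have "det (of_real c \<cdot>\<^sub>m 1\<^sub>m n :: complex mat) = of_real (c ^ n)" by simp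
  ultimately show ?thesis using c unfolding noisy_det_def
    by (simp only: Re_complex_of_real times_complex.sel Im_complex_of_real) simp
qed

text \<open>An SNR of \<open>\<rho>\<close> amounts to SNR 1 with noise power
  \<open>1 / \<rho>\<close>, so this is an instance of monotonicity in the noise.\<close>

lemma noisy_det_one_mono:
  assumes S: "S \<in> carrier_mat n p" and \<rho>: "0 < \<rho>1" "\<rho>1 \<le> \<rho>2"
  shows "noisy_det (1\<^sub>m n) S \<rho>1 \<le> noisy_det (1\<^sub>m n) S \<rho>2"
proof -
  have "loewner_le n (of_real (1 / \<rho>2) \<cdot>\<^sub>m 1\<^sub>m n) (of_real (1 / \<rho>1) \<cdot>\<^sub>m 1\<^sub>m n)"
    unfolding loewner_le_def
    using \<rho> by (auto simp only: quad_smult_one Re_complex_of_real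
        intro!: mult_right_mono sum_nonneg frac_le zero_le_power2)
  from noisy_det_antimono[OF pos_def_smult_one pos_def_smult_one this S, of 1] \<rho>
  show ?thesis by (simp add: noisy_det_smult_one[OF S] del: of_real_divide)
qed

lemma noisy_det_smult:
  assumes S: "S \<in> carrier_mat n p"
  shows "noisy_det W (of_real c \<cdot>\<^sub>m S) \<rho> = noisy_det W S (c\<^sup>2 * \<rho>)"
  unfolding noisy_det_def gram_smult_real[OF S]
  by (simp add: smult_smult_mat mult.commute)

lemma noisy_det_one:
  assumes "S \<in> carrier_mat n p"
  shows "noisy_det (1\<^sub>m n) S \<rho> = Re (det (1\<^sub>m (dim_row S) + of_real \<rho> \<cdot>\<^sub>m (S * mat_adjoint S)))"
  using assms by (simp add: noisy_det_def)

text \<open>For \<open>Q\<close>, the root of the inverse of \<open>W\<close>, the identity matrix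
  equals \<open>Q W Q\<close>. Hence \<open>Q\<close> can be pulled out of the whitened determinant
  on both sides, and the determinant of \<open>Q Q\<close> is \<open>1 / det W\<close>.\<close>

lemma noisy_det_whitened:
  assumes W: "pos_def n W" and S: "S \<in> carrier_mat n p"
  defines "C \<equiv> psd_sqrt (the (mat_inverse W)) * S"
  shows "Re (det (1\<^sub>m (dim_row C) + of_real \<rho> \<cdot>\<^sub>m (C * mat_adjoint C))) = noisy_det W S \<rho>"
proof -
  note W' = pos_defD[OF W]
  have "det W \<noteq> 0" using pos_def_det(2)[OF W] by auto
  then obtain B where B: "mat_inverse W = Some B" "W * B = 1\<^sub>m n" "B * W = 1\<^sub>m n" "B \<in> carrier_mat n n"
    using mat_inverse_exists[OF W'(1)] by blast
  define Q where "Q = psd_sqrt B"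
  note PB = pos_defD[OF pos_def_inverse[OF W B(4,2)]]
  have "psd B" unfolding psd_def carrier_matD[OF B(4)] using PB by blast
  note Q' = psd_sqrt_props[OF this, folded Q_def]
  have dQ: "dim_row Q = n" using Q'(2) B(4) by simp
  have Q: "Q \<in> carrier_mat n n" "mat_adjoint Q = Q" using Q'(1) unfolding psd_def dQ by blast+
  have CQ: "C = Q * S" unfolding C_def Q_def B(1) by simp
  define A where "A = S * mat_adjoint S"
  have A: "A \<in> carrier_mat n n" unfolding A_def by (rule mult_carrier_mat[OF S mat_adjoint_carrier[OF S]])
  have C: "C \<in> carrier_mat n p" unfolding CQ by (rule mult_carrier_mat[OF Q(1) S])
  have CC: "C * mat_adjoint C = Q * A * Q"
  proof -
    have "C * mat_adjoint C = Q * S * (mat_adjoint S * Q)"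
      unfolding CQ mat_adjoint_mult[OF Q(1) S] Q(2) ..
    also have "\<dots> = Q * (S * (mat_adjoint S * Q))"
      by (rule assoc_mult_mat[OF Q(1) S mult_carrier_mat[OF mat_adjoint_carrier[OF S] Q(1)]])
    also have "S * (mat_adjoint S * Q) = A * Q"
      unfolding A_def by (rule assoc_mult_mat[OF S mat_adjoint_carrier[OF S] Q(1), symmetric])
    also have "Q * (A * Q) = Q * A * Q" by (rule assoc_mult_mat[OF Q(1) A Q(1), symmetric])
    finally show ?thesis .
  qed
  have QW: "Q * W \<in> carrier_mat n n" by (rule mult_carrier_mat[OF Q(1) W'(1)])
  \<comment> \<open>So \<open>Q W\<close> is a right inverse of \<open>Q\<close>, and for square
    matrices a left inverse as well.\<close>
  have "Q * (Q * W) = 1\<^sub>m n"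
    using assoc_mult_mat[OF Q(1) Q(1) W'(1)] unfolding Q'(3) B(3) by (rule sym)
  hence QWQ: "Q * W * Q = 1\<^sub>m n" by (rule mat_mult_left_right_inverse[OF Q(1) QW])
  let ?r = "of_real \<rho> :: complex"
  have rA: "?r \<cdot>\<^sub>m A \<in> carrier_mat n n" using A by simp
  have "1\<^sub>m n + ?r \<cdot>\<^sub>m (C * mat_adjoint C) = Q * W * Q + Q * (?r \<cdot>\<^sub>m A) * Q"
    unfolding CC QWQ mult_smult_distrib[OF Q(1) A]
      mult_smult_assoc_mat[OF mult_carrier_mat[OF Q(1) A] Q(1)] ..
  also have "\<dots> = (Q * W + Q * (?r \<cdot>\<^sub>m A)) * Q"
    by (rule add_mult_distrib_mat[OF QW mult_carrier_mat[OF Q(1) rA] Q(1), symmetric])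
  also have "Q * W + Q * (?r \<cdot>\<^sub>m A) = Q * (W + ?r \<cdot>\<^sub>m A)"
    by (rule mult_add_distrib_mat[OF Q(1) W'(1) rA, symmetric])
  finally have e: "1\<^sub>m (dim_row C) + ?r \<cdot>\<^sub>m (C * mat_adjoint C) = Q * (W + ?r \<cdot>\<^sub>m A) * Q"
    unfolding carrier_matD[OF C] .
  have WA: "W + ?r \<cdot>\<^sub>m A \<in> carrier_mat n n" by (rule add_carrier_mat[OF rA])
  have "det (Q * (W + ?r \<cdot>\<^sub>m A) * Q) = det (Q * Q) * det (W + ?r \<cdot>\<^sub>m A)"
    unfolding det_mult[OF mult_carrier_mat[OF Q(1) WA] Q(1)] det_mult[OF Q(1) WA] det_mult[OF Q(1) Q(1)]
    by (simp only: mult_ac)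
  also have "det (Q * Q) = 1 / det W"
  proof -
    have "det W * det B = 1" using det_mult[OF W'(1) B(4)] unfolding B(2) by simp
    thus ?thesis unfolding Q'(3) by (metis nonzero_mult_div_cancel_left mult_zero_left zero_neq_one)
  qed
  also have "\<dots> * det (W + ?r \<cdot>\<^sub>m A) = det (W + ?r \<cdot>\<^sub>m A) / of_real (Re (det W))"
    by (subst pos_def_det(1)[OF W]) simp
  finally show ?thesis unfolding e noisy_det_def A_def[symmetric] by (simp only: Re_divide_of_real)
qed

section \<open>Products of channel matrices\<close>

text \<open>Coefficients are indexed by (hop, row, column), so that those of all hops together form
  one point of a product space.\<close>

definition chan_mat :: "(nat \<Rightarrow> nat) \<Rightarrow> (nat \<times> nat \<times> nat \<Rightarrow> complex) \<Rightarrow> nat \<Rightarrow> complex mat" where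
  "chan_mat n x i = mat (n i) (n (i - 1)) (\<lambda>(j, k). x (i, j, k))"

definition chan_prod :: "(nat \<Rightarrow> nat) \<Rightarrow> nat \<Rightarrow> (nat \<Rightarrow> complex mat) \<Rightarrow> complex mat" where
  "chan_prod n m h = mat_prod_list (n 0) (map h (rev [1..<m + 1]))"

definition relay_gain :: "(nat \<Rightarrow> nat) \<Rightarrow> real \<Rightarrow> real \<Rightarrow> (nat \<times> nat \<times> nat \<Rightarrow> complex) \<Rightarrow> nat \<Rightarrow> nat \<Rightarrow> real" where
  "relay_gain n \<kappa> \<rho> x i j = min \<kappa>
     (sqrt (1 / (\<rho> / real (n (i - 1)) * (\<Sum>k < n (i - 1). (cmod (x (i, j, k)))\<^sup>2) + 1))
        * sqrt (\<rho> / real (n i)))"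

definition chan_index :: "nat \<Rightarrow> (nat \<Rightarrow> nat) \<Rightarrow> (nat \<times> nat \<times> nat) set" where
  "chan_index N n = (SIGMA i:{1..N}. {..<n i} \<times> {..<n (i - 1)})"

lemma chan_mat_carrier [simp]: "chan_mat n x i \<in> carrier_mat (n i) (n (i - 1))"
  by (simp add: chan_mat_def)

lemma mat_prod_list_simps [simp]:
  "mat_prod_list d [] = 1\<^sub>m d" "mat_prod_list d (A # As) = A * mat_prod_list d As"
  by (simp_all add: mat_prod_list_def)

lemma chan_prod_0: "chan_prod n 0 h = 1\<^sub>m (n 0)"
  and chan_prod_Suc: "chan_prod n (Suc m) h = h (Suc m) * chan_prod n m h"
  by (simp_all add: chan_prod_def)

lemma chan_prod_carrier:
  assumes "\<And>i. 1 \<le> i \<Longrightarrow> i \<le> m \<Longrightarrow> h i \<in> carrier_mat (n i) (n (i - 1))"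
  shows "chan_prod n m h \<in> carrier_mat (n m) (n 0)"
  using assms
proof (induction m)
  case (Suc m)
  have "h (Suc m) \<in> carrier_mat (n (Suc m)) (n m)" using Suc.prems[of "Suc m"] by simp
  moreover have "chan_prod n m h \<in> carrier_mat (n m) (n 0)" using Suc by simp
  ultimately show ?case unfolding chan_prod_Suc by (rule mult_carrier_mat)
qed (simp add: chan_prod_0)

lemma chan_prod_cong:
  "(\<And>i. 1 \<le> i \<Longrightarrow> i \<le> m \<Longrightarrow> h i = h' i) \<Longrightarrow> chan_prod n m h = chan_prod n m h'"
  unfolding chan_prod_def by (intro arg_cong[of _ _ "mat_prod_list (n 0)"] map_cong) auto

lemma chan_mat_cong:
  "(\<And>p. p \<in> chan_index N n \<Longrightarrow> x p = y p) \<Longrightarrow> 1 \<le> i \<Longrightarrow> i \<le> N \<Longrightarrow> chan_mat n x i = chan_mat n y i"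
  by (rule eq_matI) (auto simp: chan_mat_def chan_index_def)

lemma chan_mat_smult: "chan_mat n (\<lambda>p. c * x p) i = c \<cdot>\<^sub>m chan_mat n x i"
  by (rule eq_matI) (auto simp: chan_mat_def)

lemma chan_prod_smult:
  assumes "\<And>i. h i \<in> carrier_mat (n i) (n (i - 1))"
  shows "chan_prod n m (\<lambda>i. c \<cdot>\<^sub>m h i) = c ^ m \<cdot>\<^sub>m chan_prod n m h"
proof (induction m)
  case 0
  show ?case by (rule eq_matI) (auto simp: chan_prod_0)
next
  case (Suc m)
  have h: "h (Suc m) \<in> carrier_mat (n (Suc m)) (n m)" using assms[of "Suc m"] by simp
  have P: "chan_prod n m h \<in> carrier_mat (n m) (n 0)" using assms by (intro chan_prod_carrier)
  show ?case
    unfolding chan_prod_Suc Suc.IH mult_smult_assoc_mat[OF h smult_carrier_mat[OF P]]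
      mult_smult_distrib[OF h P] smult_smult_mat power_Suc ..
qed

lemma af_relay_eq:
  "af_relay N n \<kappa> \<rho> (chan_mat n x) i = (if i = N then 1\<^sub>m (n N) else
     mat_diag (n i) (\<lambda>j. of_real (relay_gain n \<kappa> \<rho> x i j)))"
proof (cases "i = N")
  case False
  have "mat_diag (n i) (\<lambda>j. of_real (min \<kappa>
       (sqrt (1 / (\<rho> / real (n (i - 1)) * (\<Sum>k < n (i - 1). (cmod (chan_mat n x i $$ (j, k)))\<^sup>2) + 1))
        * sqrt (\<rho> / real (n i))))) = mat_diag (n i) (\<lambda>j. complex_of_real (relay_gain n \<kappa> \<rho> x i j))"
    unfolding mat_diag_def relay_gain_def by (rule eq_matI) (auto simp: chan_mat_def)
  thus ?thesis using False by (simp add: af_relay_def)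
qed (simp add: af_relay_def)

text \<open>Multiplication by \<open>D_{i-1}\<close> on the right scales the columns of
  \<open>H_i\<close>, hence the gain of antenna \<open>k\<close> of layer \<open>i - 1\<close>. The
  source has no relay gain, so the first hop gets the factor 1.\<close>

definition relay_factor :: "(nat \<Rightarrow> nat) \<Rightarrow> real \<Rightarrow> real \<Rightarrow> nat \<times> nat \<times> nat \<Rightarrow> (nat \<times> nat \<times> nat \<Rightarrow> complex) \<Rightarrow> real" where
  "relay_factor n \<kappa> \<rho> = (\<lambda>(i, j, k) x. if i \<le> 1 then 1 else relay_gain n \<kappa> \<rho> x (i - 1) k)"

text \<open>
  The relay matrix \<open>D\<^sub>i\<close> is attached to \<open>H\<^sub>i\<^sub>+\<^sub>1\<close>, of which it is independent, instead of \<open>H\<^sub>i\<close>: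
  the factor of a coefficient of hop \<open>i\<close> then depends on hop \<open>i - 1\<close> only.
\<close>
lemma af_signal_mat_regroup:
  assumes N: "N \<ge> 1"
  shows "af_signal_mat N n \<kappa> \<rho> (chan_mat n x)
    = chan_prod n N (chan_mat n (\<lambda>p. of_real (relay_factor n \<kappa> \<rho> p x) * x p))"
proof -
  define D where "D i = af_relay N n \<kappa> \<rho> (chan_mat n x) i" for i
  \<comment> \<open>\<open>E m\<close> is the relay matrix not yet absorbed by the following hop.
    There is none at the source, and at the destination it is the identity.\<close>
  define E where "E i = (if i = 0 then 1\<^sub>m (n 0) else D i)" for i
  define y where "y p = of_real (relay_factor n \<kappa> \<rho> p x) * x p" for p
  have D: "D i \<in> carrier_mat (n i) (n i)" for i by (simp add: D_def af_relay_eq)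
  have E: "E i \<in> carrier_mat (n i) (n i)" for i using D[of i] by (simp add: E_def)
  have Y: "chan_mat n x (Suc m) * E m = chan_mat n y (Suc m)" if "m < N" for m
  proof (cases "m = 0")
    case True
    thus ?thesis
      by (intro eq_matI) (auto simp: E_def chan_mat_def y_def relay_factor_def scalar_prod_def
          if_distrib[of "\<lambda>x. _ * x"] sum.delta cong: if_cong)
  next
    case False
    have "chan_mat n x (Suc m) * E m = chan_mat n x (Suc m) * mat_diag (n m) (\<lambda>j. of_real (relay_gain n \<kappa> \<rho> x m j))"
      using False that by (simp add: E_def D_def af_relay_eq)
    also have "\<dots> = mat (n (Suc m)) (n m) (\<lambda>(i, j). chan_mat n x (Suc m) $$ (i, j) * of_real (relay_gain n \<kappa> \<rho> x m j))"
      using chan_mat_carrier[of n x "Suc m"] by (intro mat_diag_mult_right) simp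
    also have "\<dots> = chan_mat n y (Suc m)"
      using False by (intro eq_matI) (auto simp: chan_mat_def y_def relay_factor_def mult.commute)
    finally show ?thesis .
  qed
  have "m \<le> N \<Longrightarrow> chan_prod n m (\<lambda>i. D i * chan_mat n x i) = E m * chan_prod n m (chan_mat n y)" for m
  proof (induction m)
    case 0
    show ?case by (simp add: chan_prod_0 E_def)
  next
    case (Suc m)
    have h: "chan_mat n x (Suc m) \<in> carrier_mat (n (Suc m)) (n m)"
      using chan_mat_carrier[of n x "Suc m"] by simp
    have P: "chan_prod n m (chan_mat n y) \<in> carrier_mat (n m) (n 0)"
      by (intro chan_prod_carrier chan_mat_carrier)
    have "chan_prod n (Suc m) (\<lambda>i. D i * chan_mat n x i)
        = D (Suc m) * chan_mat n x (Suc m) * (E m * chan_prod n m (chan_mat n y))"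
      using Suc by (simp only: chan_prod_Suc)
    also have "\<dots> = D (Suc m) * (chan_mat n x (Suc m) * (E m * chan_prod n m (chan_mat n y)))"
      by (rule assoc_mult_mat[OF D h mult_carrier_mat[OF E P]])
    also have "chan_mat n x (Suc m) * (E m * chan_prod n m (chan_mat n y))
        = chan_mat n x (Suc m) * E m * chan_prod n m (chan_mat n y)"
      by (rule assoc_mult_mat[OF h E P, symmetric])
    also have "\<dots> = chan_prod n (Suc m) (chan_mat n y)"
      using Y[of m] Suc.prems by (simp add: chan_prod_Suc)
    finally show ?case by (simp add: E_def)
  qed
  from this[of N] have "chan_prod n N (\<lambda>i. D i * chan_mat n x i) = E N * chan_prod n N (chan_mat n y)"
    by simp
  also have "E N = 1\<^sub>m (n N)" using N by (simp add: E_def D_def af_relay_eq)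
  also have "1\<^sub>m (n N) * chan_prod n N (chan_mat n y) = chan_prod n N (chan_mat n y)"
    by (rule left_mult_one_mat[OF chan_prod_carrier[OF chan_mat_carrier]])
  finally show ?thesis by (simp add: af_signal_mat_def chan_prod_def D_def y_def[abs_def])
qed

section \<open>Relay gains and the covariance of the accumulated noise\<close>

lemma relay_gain_bounds:
  assumes "\<kappa> > 0" "\<rho> \<ge> 0"
  shows "0 \<le> relay_gain n \<kappa> \<rho> x i j" "relay_gain n \<kappa> \<rho> x i j \<le> \<kappa>"
  using assms by (auto simp: relay_gain_def intro!: divide_nonneg_nonneg mult_nonneg_nonneg add_nonneg_nonneg sum_nonneg)

text \<open>Here \<open>s\<close> is the variance of a noise sample.\<close>
definition noise_cov_mat ::
  "real \<Rightarrow> nat \<Rightarrow> (nat \<Rightarrow> nat) \<Rightarrow> real \<Rightarrow> real \<Rightarrow> (nat \<Rightarrow> complex mat) \<Rightarrow> complex mat" where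
  "noise_cov_mat s N n \<kappa> \<rho> h = mat (n N) (n N) (\<lambda>(a, b). of_real s *
     (\<Sum>j=1..N. \<Sum>l<n j. af_noise_mat N n \<kappa> \<rho> h j $$ (a, l) * cnj (af_noise_mat N n \<kappa> \<rho> h j $$ (b, l))))"

lemma noise_cov_mat_carrier [simp]: "noise_cov_mat s N n \<kappa> \<rho> h \<in> carrier_mat (n N) (n N)"
  by (simp add: noise_cov_mat_def)

text \<open>Writes the form as a sum of squares, one for each noise sample. Both the lower and the
  upper Loewner bound on the noise are read off from it.\<close>

lemma quad_noise_cov_mat:
  assumes v: "v \<in> carrier_vec (n N)"
  shows "(noise_cov_mat s N n \<kappa> \<rho> h *\<^sub>v v) \<bullet>c v = of_real (s *
    (\<Sum>j=1..N. \<Sum>l<n j. (cmod (\<Sum>a<n N. v $ a * cnj (af_noise_mat N n \<kappa> \<rho> h j $$ (a, l))))\<^sup>2))"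
proof -
  define F where "F j = af_noise_mat N n \<kappa> \<rho> h j" for j
  let ?d = "n N"
  let ?W = "noise_cov_mat s N n \<kappa> \<rho> h"
  let ?t = "\<lambda>a b j l. of_real s * (F j $$ (a, l) * cnj (F j $$ (b, l)) * v $ b * cnj (v $ a))"
  have "(?W *\<^sub>v v) \<bullet>c v = (\<Sum>a<?d. (?W *\<^sub>v v) $ a * cnj (v $ a))"
    by (rule cscalar_prod_conv_sum[OF mult_mat_vec_carrier[OF noise_cov_mat_carrier[of s N n] v] v])
  also have "\<dots> = (\<Sum>a<?d. (\<Sum>b<?d. ?W $$ (a, b) * v $ b) * cnj (v $ a))"
    using v by (intro sum.cong) (auto simp: scalar_prod_def lessThan_atLeast0 noise_cov_mat_def)
  also have "\<dots> = (\<Sum>a<?d. \<Sum>b<?d. \<Sum>j=1..N. \<Sum>l<n j. ?t a b j l)"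
    by (simp add: noise_cov_mat_def F_def sum_distrib_right sum_distrib_left mult_ac)
  also have "\<dots> = (\<Sum>a<?d. \<Sum>j=1..N. \<Sum>b<?d. \<Sum>l<n j. ?t a b j l)"
    by (intro sum.cong refl sum.swap)
  also have "\<dots> = (\<Sum>j=1..N. \<Sum>a<?d. \<Sum>b<?d. \<Sum>l<n j. ?t a b j l)"
    by (rule sum.swap)
  also have "\<dots> = (\<Sum>j=1..N. \<Sum>a<?d. \<Sum>l<n j. \<Sum>b<?d. ?t a b j l)"
    by (intro sum.cong refl sum.swap)
  also have "\<dots> = (\<Sum>j=1..N. \<Sum>l<n j. \<Sum>a<?d. \<Sum>b<?d. ?t a b j l)"
    by (intro sum.cong refl sum.swap)
  also have "\<dots> = (\<Sum>j=1..N. \<Sum>l<n j. of_real (s * (cmod (\<Sum>a<?d. v $ a * cnj (F j $$ (a, l))))\<^sup>2))"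
  proof (intro sum.cong refl)
    fix j l
    define g where "g = (\<Sum>a<?d. v $ a * cnj (F j $$ (a, l)))"
    have "(\<Sum>a<?d. \<Sum>b<?d. of_real s * (F j $$ (a, l) * cnj (F j $$ (b, l)) * v $ b * cnj (v $ a)))
        = of_real s * (cnj g * g)"
    proof -
      have "cnj g * g = (\<Sum>a<?d. \<Sum>b<?d. cnj (v $ a * cnj (F j $$ (a, l))) * (v $ b * cnj (F j $$ (b, l))))"
        unfolding g_def cnj_sum by (rule sum_product)
      thus ?thesis by (simp add: sum_distrib_left mult_ac)
    qed
    also have "cnj g * g = of_real ((cmod g)\<^sup>2)"
      by (simp only: complex_norm_square mult.commute[of "cnj g"])
    finally show "(\<Sum>a<?d. \<Sum>b<?d. of_real s * (F j $$ (a, l) * cnj (F j $$ (b, l)) * v $ b * cnj (v $ a)))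
      = of_real (s * (cmod g)\<^sup>2)" by simp
  qed
  finally show ?thesis by (simp add: F_def sum_distrib_left)
qed

lemma af_noise_mat_last:
  "af_noise_mat N n \<kappa> \<rho> h N = 1\<^sub>m (n N)"
  by (simp add: af_noise_mat_def af_relay_def)

text \<open>The noise of the destination itself arrives unchanged, and the other sources contribute
  nonnegative squares.\<close>

lemma loewner_le_noise_cov_mat:
  assumes "s > 0" "N \<ge> 1"
  shows "loewner_le (n N) (of_real s \<cdot>\<^sub>m 1\<^sub>m (n N)) (noise_cov_mat s N n \<kappa> \<rho> h)"
  unfolding loewner_le_def
proof
  fix v :: "complex vec" assume v: "v \<in> carrier_vec (n N)"
  let ?g = "\<lambda>j. \<Sum>l<n j. (cmod (\<Sum>a<n N. v $ a * cnj (af_noise_mat N n \<kappa> \<rho> h j $$ (a, l))))\<^sup>2"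
  have "?g N = (\<Sum>l<n N. (cmod (v $ l))\<^sup>2)"
  proof (intro sum.cong refl)
    fix l assume "l \<in> {..<n N}"
    hence "(\<Sum>a<n N. v $ a * cnj (af_noise_mat N n \<kappa> \<rho> h N $$ (a, l))) = (\<Sum>a<n N. if a = l then v $ a else 0)"
      unfolding af_noise_mat_last by (intro sum.cong) auto
    also have "\<dots> = v $ l" using \<open>l \<in> _\<close> by simp
    finally show "(cmod (\<Sum>a<n N. v $ a * cnj (af_noise_mat N n \<kappa> \<rho> h N $$ (a, l))))\<^sup>2 = (cmod (v $ l))\<^sup>2"
      by (rule arg_cong)
  qed
  moreover have "?g N \<le> (\<Sum>j=1..N. ?g j)"
    using assms by (intro member_le_sum sum_nonneg) auto
  ultimately show "Re (((of_real s \<cdot>\<^sub>m 1\<^sub>m (n N)) *\<^sub>v v) \<bullet>c v) \<le> Re ((noise_cov_mat s N n \<kappa> \<rho> h *\<^sub>v v) \<bullet>c v)"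
    unfolding quad_smult_one[OF v] quad_noise_cov_mat[where n=n and N=N, OF v] Re_complex_of_real
    using assms(1) by (intro mult_left_mono) auto
qed

lemma pos_def_noise_cov_mat:
  assumes "s > 0" "N \<ge> 1"
  shows "pos_def (n N) (noise_cov_mat s N n \<kappa> \<rho> h)"
  unfolding pos_def_def
proof (intro conjI ballI impI)
  show "mat_adjoint (noise_cov_mat s N n \<kappa> \<rho> h) = noise_cov_mat s N n \<kappa> \<rho> h"
    by (intro eq_matI) (auto simp: noise_cov_mat_def mult.commute)
  fix v :: "complex vec" assume v: "v \<in> carrier_vec (n N)" "v \<noteq> 0\<^sub>v (n N)"
  have "0 < Re (((of_real s \<cdot>\<^sub>m 1\<^sub>m (n N)) *\<^sub>v v) \<bullet>c v)"
    by (rule pos_defD(3)[OF pos_def_smult_one[OF assms(1)] v])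
  also have "\<dots> \<le> Re ((noise_cov_mat s N n \<kappa> \<rho> h *\<^sub>v v) \<bullet>c v)"
    using loewner_le_noise_cov_mat[OF assms] v(1) unfolding loewner_le_def by blast
  finally show "0 < Re ((noise_cov_mat s N n \<kappa> \<rho> h *\<^sub>v v) \<bullet>c v)" .
qed simp

text \<open>A factor has entries of modulus at most \<open>B * max 1 \<kappa>\<close>, and a matrix
  product sums over at most \<open>q\<close> indices, so each factor costs at most \<open>L\<close>.
  As \<open>L \<ge> 1\<close>, one exponent \<open>N\<close> serves for every source
  \<open>j\<close>.\<close>

lemma af_noise_mat_entry_bound:
  assumes \<kappa>: "\<kappa> > 0" and \<rho>: "\<rho> \<ge> 0" and B: "1 \<le> B" and j: "1 \<le> j" "j \<le> N"
    and x: "\<And>p. p \<in> chan_index N n \<Longrightarrow> cmod (x p) \<le> B"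
    and nmax: "\<And>i. i \<le> N \<Longrightarrow> n i \<le> q" "1 \<le> q"
    and L: "L = real q * max 1 \<kappa> * B"
  shows "af_noise_mat N n \<kappa> \<rho> (chan_mat n x) j \<in> carrier_mat (n N) (n j)"
    "a < n N \<Longrightarrow> b < n j \<Longrightarrow> cmod (af_noise_mat N n \<kappa> \<rho> (chan_mat n x) j $$ (a, b)) \<le> L ^ N"
proof -
  have L1: "1 \<le> L"
  proof -
    have "1 * 1 * 1 \<le> real q * max 1 \<kappa> * B" using nmax(2) B by (intro mult_mono) auto
    thus ?thesis by (simp add: L)
  qed
  define f where "f i = (if i = N then 1\<^sub>m (n N) else chan_mat n x (i + 1)) * af_relay N n \<kappa> \<rho> (chan_mat n x) i" for i
  define Q where "Q m = mat_prod_list (n j) (map f (rev [j..<m + 1]))" for m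
  \<comment> \<open>The number of rows of \<open>Q m\<close>. A factor of index \<open>i < N\<close>
    ends with \<open>H_{i+1}\<close> and leads into layer \<open>i + 1\<close>; the factor of index
    \<open>N\<close> is the identity and stays in layer \<open>N\<close>.\<close>
  define r where "r m = (if m < j then n j else if m = N then n N else n (m + 1))" for m
  have Q_Suc: "Q (Suc m) = f (Suc m) * Q m" if "j \<le> Suc m" for m
    using that by (simp add: Q_def)
  have f: "f i = (if i = N then 1\<^sub>m (n N) else mat (n (Suc i)) (n i)
      (\<lambda>(a, k). x (Suc i, a, k) * of_real (relay_gain n \<kappa> \<rho> x i k)))" for i
  proof (cases "i = N")
    case False
    have "chan_mat n x (Suc i) * mat_diag (n i) (\<lambda>j. of_real (relay_gain n \<kappa> \<rho> x i j))
      = mat (n (Suc i)) (n i) (\<lambda>(a, k). chan_mat n x (Suc i) $$ (a, k) * of_real (relay_gain n \<kappa> \<rho> x i k))"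
      using chan_mat_carrier[of n x "Suc i"] by (intro mat_diag_mult_right) simp
    also have "\<dots> = mat (n (Suc i)) (n i) (\<lambda>(a, k). x (Suc i, a, k) * of_real (relay_gain n \<kappa> \<rho> x i k))"
      by (rule eq_matI) (auto simp: chan_mat_def)
    finally show ?thesis using False by (simp add: f_def af_relay_eq)
  qed (simp add: f_def af_relay_eq)
  have main: "m \<le> N \<Longrightarrow> j \<le> Suc m \<Longrightarrow> Q m \<in> carrier_mat (r m) (n j) \<and>
      (\<forall>a<r m. \<forall>b<n j. cmod (Q m $$ (a, b)) \<le> L ^ m)" for m
  proof (induction m)
    case 0
    hence "j = 1" using j by simp
    thus ?case by (auto simp: Q_def r_def)
  next
    case (Suc m)
    show ?case
    proof (cases "j = Suc (Suc m)")
      case True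
      have "1 \<le> L ^ Suc m" using L1 by (rule one_le_power)
      moreover have "Q (Suc m) = 1\<^sub>m (n j)" using True by (simp add: Q_def)
      ultimately show ?thesis using True by (auto simp: r_def intro: order_trans[of _ 1])
    next
      case False
      hence jm: "j \<le> Suc m" using Suc.prems by simp
      have IH: "Q m \<in> carrier_mat (r m) (n j)" "\<And>a b. a < r m \<Longrightarrow> b < n j \<Longrightarrow> cmod (Q m $$ (a, b)) \<le> L ^ m"
        using Suc jm by auto
      have rm: "r m = n (Suc m)" using jm Suc.prems by (auto simp: r_def le_Suc_eq)
      show ?thesis
      proof (cases "Suc m = N")
        case True
        have "Q (Suc m) = Q m"
          unfolding Q_Suc[OF jm] using True f[of N] left_mult_one_mat[OF IH(1)] rm by simp
        moreover have "L ^ m \<le> L ^ Suc m" using L1 by (intro power_increasing) auto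
        moreover have "r (Suc m) = r m" using True rm jm by (simp add: r_def)
        ultimately show ?thesis using IH by (metis order_trans)
      next
        case F: False
        have rS: "r (Suc m) = n (Suc (Suc m))" using jm F by (simp add: r_def)
        define A where "A = mat (n (Suc (Suc m))) (n (Suc m))
            (\<lambda>(a, k). x (Suc (Suc m), a, k) * complex_of_real (relay_gain n \<kappa> \<rho> x (Suc m) k))"
        have QS: "Q (Suc m) = A * Q m" unfolding Q_Suc[OF jm] A_def using f[of "Suc m"] F by simp
        have A: "A \<in> carrier_mat (n (Suc (Suc m))) (n (Suc m))" by (simp add: A_def)
        have Qc: "Q m \<in> carrier_mat (n (Suc m)) (n j)" using IH(1) rm by simp
        have "cmod ((A * Q m) $$ (a, b)) \<le> L ^ Suc m" if ab: "a < n (Suc (Suc m))" "b < n j" for a b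
        proof -
          have "(A * Q m) $$ (a, b) = (\<Sum>k<n (Suc m). A $$ (a, k) * Q m $$ (k, b))"
            using A Qc ab by (simp add: scalar_prod_def lessThan_atLeast0)
          also have "cmod \<dots> \<le> (\<Sum>k<n (Suc m). (B * max 1 \<kappa>) * L ^ m)"
          proof (rule sum_norm_le)
            fix k assume k: "k \<in> {..<n (Suc m)}"
            have "(Suc (Suc m), a, k) \<in> chan_index N n"
              using ab k Suc.prems F by (auto simp: chan_index_def)
            hence "cmod (A $$ (a, k)) \<le> B * max 1 \<kappa>"
              using ab k relay_gain_bounds[OF \<kappa> \<rho>, of n x "Suc m" k] B x[of "(Suc (Suc m), a, k)"]
              by (auto simp: A_def norm_mult intro!: mult_mono)
            moreover have "cmod (Q m $$ (k, b)) \<le> L ^ m" using IH(2) k ab rm by simp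
            ultimately show "cmod (A $$ (a, k) * Q m $$ (k, b)) \<le> (B * max 1 \<kappa>) * L ^ m"
              unfolding norm_mult using B by (intro mult_mono) auto
          qed
          also have "\<dots> = real (n (Suc m)) * ((B * max 1 \<kappa>) * L ^ m)" by simp
          also have "\<dots> \<le> real q * ((B * max 1 \<kappa>) * L ^ m)"
            using nmax(1)[of "Suc m"] Suc.prems B L1 by (intro mult_right_mono) auto
          also have "\<dots> = L ^ Suc m" by (simp add: L)
          finally show ?thesis .
        qed
        thus ?thesis unfolding QS rS using mult_carrier_mat[OF A Qc] by blast
      qed
    qed
  qed
  have "Q N = af_noise_mat N n \<kappa> \<rho> (chan_mat n x) j"
    unfolding Q_def af_noise_mat_def f_def[abs_def] ..
  moreover have "r N = n N" using j by (simp add: r_def)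
  ultimately show "af_noise_mat N n \<kappa> \<rho> (chan_mat n x) j \<in> carrier_mat (n N) (n j)"
    "a < n N \<Longrightarrow> b < n j \<Longrightarrow> cmod (af_noise_mat N n \<kappa> \<rho> (chan_mat n x) j $$ (a, b)) \<le> L ^ N"
    using main[of N] j by auto
qed

text \<open>Cauchy-Schwarz with the crude entry bound. One factor \<open>q\<close> comes from
  Cauchy-Schwarz, the other from the number of samples per layer, and \<open>N\<close> from the
  number of layers that contribute noise.\<close>

lemma noise_cov_mat_loewner_le:
  assumes \<kappa>: "\<kappa> > 0" and \<rho>: "\<rho> \<ge> 0" and B: "1 \<le> B" and s: "s > 0"
    and x: "\<And>p. p \<in> chan_index N n \<Longrightarrow> cmod (x p) \<le> B"
    and nmax: "\<And>i. i \<le> N \<Longrightarrow> n i \<le> q" "1 \<le> q"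
    and L: "L = real q * max 1 \<kappa> * B"
    and w: "s * (real N * (real q)\<^sup>2 * (L ^ N)\<^sup>2) \<le> w"
  shows "loewner_le (n N) (noise_cov_mat s N n \<kappa> \<rho> (chan_mat n x)) (of_real w \<cdot>\<^sub>m 1\<^sub>m (n N))"
  unfolding loewner_le_def
proof
  fix v :: "complex vec" assume v: "v \<in> carrier_vec (n N)"
  define F where "F = af_noise_mat N n \<kappa> \<rho> (chan_mat n x)"
  define V where "V = (\<Sum>a<n N. (cmod (v $ a))\<^sup>2)"
  have V0: "0 \<le> V" by (simp add: V_def sum_nonneg)
  have "(cmod (\<Sum>a<n N. v $ a * cnj (F j $$ (a, l))))\<^sup>2 \<le> real q * (L ^ N)\<^sup>2 * V"
    if j: "j \<in> {1..N}" and l: "l < n j" for j l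
  proof -
    have Fb: "cmod (F j $$ (a, l)) \<le> L ^ N" if "a < n N" for a
      unfolding F_def using j l that by (intro af_noise_mat_entry_bound(2)[OF \<kappa> \<rho> B _ _ x nmax L]) auto
    have "cmod (\<Sum>a<n N. v $ a * cnj (F j $$ (a, l))) \<le> (\<Sum>a<n N. cmod (v $ a) * L ^ N)"
      using Fb by (intro sum_norm_le) (auto simp: norm_mult intro!: mult_left_mono)
    hence "(cmod (\<Sum>a<n N. v $ a * cnj (F j $$ (a, l))))\<^sup>2 \<le> (\<Sum>a<n N. cmod (v $ a) * L ^ N)\<^sup>2"
      by (intro power_mono) auto
    also have "\<dots> \<le> (\<Sum>a<n N. (cmod (v $ a))\<^sup>2) * (\<Sum>a<n N. (L ^ N)\<^sup>2)"
      by (rule Cauchy_Schwarz_ineq_sum)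
    also have "\<dots> = real (n N) * ((L ^ N)\<^sup>2 * V)" by (simp add: V_def)
    also have "\<dots> \<le> real q * ((L ^ N)\<^sup>2 * V)"
      using nmax(1)[of N] V0 by (intro mult_right_mono mult_nonneg_nonneg) auto
    finally show ?thesis by simp
  qed
  hence "(\<Sum>j=1..N. \<Sum>l<n j. (cmod (\<Sum>a<n N. v $ a * cnj (F j $$ (a, l))))\<^sup>2)
      \<le> (\<Sum>j=1..N. \<Sum>l<n j. real q * (L ^ N)\<^sup>2 * V)"
    by (intro sum_mono) auto
  also have "\<dots> = (\<Sum>j=1..N. real (n j) * (real q * (L ^ N)\<^sup>2 * V))" by simp
  also have "\<dots> \<le> (\<Sum>j=1..N. real q * (real q * (L ^ N)\<^sup>2 * V))"
    using nmax(1) V0 by (intro sum_mono mult_right_mono mult_nonneg_nonneg) auto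
  also have "\<dots> = (real N * (real q)\<^sup>2 * (L ^ N)\<^sup>2) * V" by (simp add: power2_eq_square)
  finally have "s * (\<Sum>j=1..N. \<Sum>l<n j. (cmod (\<Sum>a<n N. v $ a * cnj (F j $$ (a, l))))\<^sup>2)
     \<le> s * ((real N * (real q)\<^sup>2 * (L ^ N)\<^sup>2) * V)"
    using s by (intro mult_left_mono) auto
  also have "\<dots> \<le> w * V" using mult_right_mono[OF w V0] by (simp only: mult.assoc)
  finally show "Re ((noise_cov_mat s N n \<kappa> \<rho> (chan_mat n x) *\<^sub>v v) \<bullet>c v)
     \<le> Re (((of_real w \<cdot>\<^sub>m 1\<^sub>m (n N)) *\<^sub>v v) \<bullet>c v)"
    unfolding quad_smult_one[OF v] quad_noise_cov_mat[where n=n and N=N, OF v] Re_complex_of_real F_def V_def .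
qed

section \<open>Measurability and noise covariance\<close>

text \<open>Measurability is entrywise. The size is required at every argument, not only on the
  space of \<open>M\<close>, so that matrix identities can be rewritten without membership
  conditions.\<close>

definition mat_measurable :: "'x measure \<Rightarrow> nat \<Rightarrow> nat \<Rightarrow> ('x \<Rightarrow> complex mat) \<Rightarrow> bool" where
  "mat_measurable M r c A \<longleftrightarrow> (\<forall>x. A x \<in> carrier_mat r c) \<and>
     (\<forall>i<r. \<forall>j<c. (\<lambda>x. A x $$ (i, j)) \<in> borel_measurable M)"

lemma mat_measurableD:
  assumes "mat_measurable M r c A"
  shows "A x \<in> carrier_mat r c" "i < r \<Longrightarrow> j < c \<Longrightarrow> (\<lambda>x. A x $$ (i, j)) \<in> borel_measurable M"
  using assms by (auto simp: mat_measurable_def)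

lemma mat_measurable_mat:
  assumes "\<And>i j. i < r \<Longrightarrow> j < c \<Longrightarrow> (\<lambda>x. f x i j) \<in> borel_measurable M"
  shows "mat_measurable M r c (\<lambda>x. mat r c (\<lambda>(i, j). f x i j))"
  using assms by (simp add: mat_measurable_def)

lemma mat_measurable_one: "mat_measurable M r r (\<lambda>x. 1\<^sub>m r)"
  by (simp add: mat_measurable_def)

lemma mat_measurable_mult:
  assumes A: "mat_measurable M r m A" and B: "mat_measurable M m c B"
  shows "mat_measurable M r c (\<lambda>x. A x * B x)"
  unfolding mat_measurable_def
proof (intro conjI allI impI)
  show "A x * B x \<in> carrier_mat r c" for x
    by (rule mult_carrier_mat[OF mat_measurableD(1)[OF A] mat_measurableD(1)[OF B]])
  fix i j assume ij: "i < r" "j < c"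
  have "(A x * B x) $$ (i, j) = (\<Sum>k<m. A x $$ (i, k) * B x $$ (k, j))" for x
    using ij mat_measurableD(1)[OF A, of x] mat_measurableD(1)[OF B, of x]
    by (simp add: scalar_prod_def lessThan_atLeast0)
  moreover have "(\<lambda>x. \<Sum>k<m. A x $$ (i, k) * B x $$ (k, j)) \<in> borel_measurable M"
    using ij mat_measurableD(2)[OF A] mat_measurableD(2)[OF B]
    by (intro borel_measurable_sum borel_measurable_times) auto
  ultimately show "(\<lambda>x. (A x * B x) $$ (i, j)) \<in> borel_measurable M" by simp
qed

lemma mat_measurable_add:
  assumes A: "mat_measurable M r c A" and B: "mat_measurable M r c B"
  shows "mat_measurable M r c (\<lambda>x. A x + B x)"
  unfolding mat_measurable_def
proof (intro conjI allI impI)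
  show "A x + B x \<in> carrier_mat r c" for x
    by (rule add_carrier_mat[OF mat_measurableD(1)[OF B]])
  fix i j assume ij: "i < r" "j < c"
  have "(A x + B x) $$ (i, j) = A x $$ (i, j) + B x $$ (i, j)" for x
    using ij mat_measurableD(1)[OF A, of x] mat_measurableD(1)[OF B, of x] by simp
  moreover have "(\<lambda>x. A x $$ (i, j) + B x $$ (i, j)) \<in> borel_measurable M"
    by (intro borel_measurable_add mat_measurableD(2)[OF A] mat_measurableD(2)[OF B] ij)
  ultimately show "(\<lambda>x. (A x + B x) $$ (i, j)) \<in> borel_measurable M" by simp
qed

lemma mat_measurable_smult:
  assumes A: "mat_measurable M r c A"
  shows "mat_measurable M r c (\<lambda>x. k \<cdot>\<^sub>m A x)"
  unfolding mat_measurable_def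
proof (intro conjI allI impI)
  show "k \<cdot>\<^sub>m A x \<in> carrier_mat r c" for x
    by (rule smult_carrier_mat[OF mat_measurableD(1)[OF A]])
  fix i j assume ij: "i < r" "j < c"
  have "(k \<cdot>\<^sub>m A x) $$ (i, j) = k * A x $$ (i, j)" for x
    using ij mat_measurableD(1)[OF A, of x] by simp
  moreover have "(\<lambda>x. k * A x $$ (i, j)) \<in> borel_measurable M"
    by (intro borel_measurable_times borel_measurable_const mat_measurableD(2)[OF A] ij)
  ultimately show "(\<lambda>x. (k \<cdot>\<^sub>m A x) $$ (i, j)) \<in> borel_measurable M" by simp
qed

lemma borel_measurable_cnj [measurable (raw)]:
  "f \<in> borel_measurable M \<Longrightarrow> (\<lambda>x. cnj (f x)) \<in> borel_measurable M"
  by (rule borel_measurable_continuous_on[OF continuous_on_cnj[OF continuous_on_id]])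

lemma mat_measurable_adjoint:
  assumes A: "mat_measurable M r c A"
  shows "mat_measurable M c r (\<lambda>x. mat_adjoint (A x))"
  unfolding mat_measurable_def
proof (intro conjI allI impI)
  show "mat_adjoint (A x) \<in> carrier_mat c r" for x
    by (rule mat_adjoint_carrier[OF mat_measurableD(1)[OF A]])
  fix i j assume ij: "i < c" "j < r"
  have "mat_adjoint (A x) $$ (i, j) = cnj (A x $$ (j, i))" for x
    using ij mat_measurableD(1)[OF A, of x] by simp
  moreover have "(\<lambda>x. cnj (A x $$ (j, i))) \<in> borel_measurable M"
    by (intro borel_measurable_cnj mat_measurableD(2)[OF A] ij)
  ultimately show "(\<lambda>x. mat_adjoint (A x) $$ (i, j)) \<in> borel_measurable M" by simp
qed

lemma borel_measurable_det:
  assumes A: "mat_measurable M r r A"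
  shows "(\<lambda>x. det (A x)) \<in> borel_measurable M"
proof -
  have "(\<lambda>x. det (A x)) = (\<lambda>x. \<Sum>p\<in>{p. p permutes {0..<r}}. signof p * (\<Prod>i=0..<r. A x $$ (i, p i)))"
    using det_def'[OF mat_measurableD(1)[OF A]] by (intro ext)
  also have "\<dots> \<in> borel_measurable M"
    by (intro borel_measurable_sum borel_measurable_times borel_measurable_const borel_measurable_prod
        mat_measurableD(2)[OF A]) (auto dest: permutes_in_image)
  finally show ?thesis .
qed

lemma borel_measurable_noisy_det:
  assumes W: "mat_measurable M r r W" and S: "mat_measurable M r c S"
  shows "(\<lambda>x. noisy_det (W x) (S x) \<rho>) \<in> borel_measurable M"
proof -
  note SS = mat_measurable_add[OF W mat_measurable_smult[OF mat_measurable_mult[OF S mat_measurable_adjoint[OF S]]]]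
  have [measurable]: "(\<lambda>x. det (W x)) \<in> borel_measurable M"
    "(\<lambda>x. det (W x + of_real \<rho> \<cdot>\<^sub>m (S x * mat_adjoint (S x)))) \<in> borel_measurable M"
    by (rule borel_measurable_det[OF W], rule borel_measurable_det[OF SS])
  show ?thesis unfolding noisy_det_def by measurable
qed

lemma mat_measurable_prod_list:
  assumes "\<And>i. j \<le> i \<Longrightarrow> i < k \<Longrightarrow> mat_measurable M (r (Suc i)) (r i) (f i)" "j \<le> k"
  shows "mat_measurable M (r k) (r j) (\<lambda>x. mat_prod_list (r j) (map (\<lambda>i. f i x) (rev [j..<k])))"
  using assms(2,1)
proof (induction k rule: dec_induct)
  case base
  show ?case by (simp add: mat_measurable_one)
next
  case (step k)
  have "mat_measurable M (r (Suc k)) (r j) (\<lambda>x. f k x * mat_prod_list (r j) (map (\<lambda>i. f i x) (rev [j..<k])))"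
    using step by (intro mat_measurable_mult[of _ _ "r k"]) auto
  thus ?case using step.hyps by simp
qed

lemma measurable_relay_gain [measurable]:
  "(\<lambda>x. relay_gain n \<kappa> \<rho> x i j) \<in> borel_measurable (cgauss_prod S)"
  unfolding relay_gain_def supply measurable_PiM_coord[measurable] by measurable

lemma measurable_relay_factor [measurable]:
  "(\<lambda>x. relay_factor n \<kappa> \<rho> p x) \<in> borel_measurable (cgauss_prod S)"
  unfolding relay_factor_def by (cases p) (auto simp: split_beta)

lemma mat_measurable_chan_mat:
  assumes "\<And>p. (\<lambda>x. f x p) \<in> borel_measurable M"
  shows "mat_measurable M (n i) (n (i - 1)) (\<lambda>x. chan_mat n (f x) i)"
  unfolding chan_mat_def by (rule mat_measurable_mat) (rule assms)

lemma mat_measurable_chan_prod: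
  assumes "\<And>p. (\<lambda>x. f x p) \<in> borel_measurable M"
  shows "mat_measurable M (n m) (n 0) (\<lambda>x. chan_prod n m (chan_mat n (f x)))"
  using mat_measurable_prod_list[of 1 "Suc m" M "\<lambda>i. n (i - 1)" "\<lambda>i x. chan_mat n (f x) i"]
    mat_measurable_chan_mat[OF assms, of n] by (simp add: chan_prod_def)

lemma mat_measurable_af_relay:
  "mat_measurable (cgauss_prod S) (n i) (n i) (\<lambda>x. af_relay N n \<kappa> \<rho> (chan_mat n x) i)"
proof (cases "i = N")
  case False
  have "mat_measurable (cgauss_prod S) (n i) (n i)
     (\<lambda>x. mat (n i) (n i) (\<lambda>(k, j). if k = j then of_real (relay_gain n \<kappa> \<rho> x i j) else 0))"
    by (rule mat_measurable_mat) auto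
  thus ?thesis using False unfolding af_relay_eq mat_diag_def by simp
qed (simp add: af_relay_eq mat_measurable_one)

lemma mat_measurable_af_noise_mat:
  assumes "j \<le> N"
  shows "mat_measurable (cgauss_prod S) (n N) (n j) (\<lambda>x. af_noise_mat N n \<kappa> \<rho> (chan_mat n x) j)"
proof -
  \<comment> \<open>The convention \<open>H_{N+1} = I\<close>: the fictitious layer
    \<open>N + 1\<close> has the size of layer \<open>N\<close>.\<close>
  define r where "r i = n (if i = Suc N then N else i)" for i
  let ?f = "\<lambda>i x. (if i = N then 1\<^sub>m (n N) else chan_mat n x (i + 1)) * af_relay N n \<kappa> \<rho> (chan_mat n x) i"
  have "mat_measurable (cgauss_prod S) (r (Suc i)) (r i) (?f i)" if "i < Suc N" for i
  proof -
    have "mat_measurable (cgauss_prod S) (r (Suc i)) (n i) (\<lambda>x. if i = N then 1\<^sub>m (n N) else chan_mat n x (i + 1))"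
      using mat_measurable_chan_mat[OF measurable_PiM_coord, of S n "Suc i"] that
      by (cases "i = N") (auto simp: r_def mat_measurable_one)
    from mat_measurable_mult[OF this mat_measurable_af_relay[of S n i N \<kappa> \<rho>]] that show ?thesis
      by (simp add: r_def)
  qed
  from mat_measurable_prod_list[of j "Suc N" _ r ?f, OF this] assms
  show ?thesis by (simp add: af_noise_mat_def r_def)
qed

lemma mat_measurable_noise_cov_mat:
  "mat_measurable (cgauss_prod S) (n N) (n N) (\<lambda>x. noise_cov_mat s N n \<kappa> \<rho> (chan_mat n x))"
  unfolding noise_cov_mat_def
  by (intro mat_measurable_mat borel_measurable_times borel_measurable_const borel_measurable_sum
      borel_measurable_cnj mat_measurableD(2)[OF mat_measurable_af_noise_mat]) auto

section \<open>Joint law and second moments of Gaussian families\<close>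

lemma distr_indep_complex_std_normal:
  assumes M: "prob_space M" and indep: "prob_space.indep_vars M (\<lambda>_. borel) X I"
    and X: "\<And>i. i \<in> I \<Longrightarrow> complex_std_normal M (X i)" and I: "I \<noteq> {}"
  shows "(\<lambda>\<omega>. \<lambda>i\<in>I. X i \<omega>) \<in> measurable M (cgauss_prod I)"
    "distr M (cgauss_prod I) (\<lambda>\<omega>. \<lambda>i\<in>I. X i \<omega>) = cgauss_prod I"
proof -
  interpret prob_space M by fact
  note Xm = complex_std_normalD(1)[OF X]
  show "(\<lambda>\<omega>. \<lambda>i\<in>I. X i \<omega>) \<in> measurable M (cgauss_prod I)"
    using Xm by (intro measurable_restrict) (simp add: measurable_cong_sets[OF refl sets_cgauss])
  have "distr M (PiM I (\<lambda>_. borel)) (\<lambda>\<omega>. \<lambda>i\<in>I. X i \<omega>) = PiM I (\<lambda>i. distr M borel (X i))"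
    using indep_vars_iff_distr_eq_PiM'[OF I Xm] indep by simp
  also have "\<dots> = cgauss_prod I"
    by (intro PiM_cong refl complex_std_normalD(2) X)
  also have "distr M (PiM I (\<lambda>_. borel)) (\<lambda>\<omega>. \<lambda>i\<in>I. X i \<omega>)
      = distr M (cgauss_prod I) (\<lambda>\<omega>. \<lambda>i\<in>I. X i \<omega>)"
    by (intro distr_cong sets_PiM_cong) auto
  finally show "distr M (cgauss_prod I) (\<lambda>\<omega>. \<lambda>i\<in>I. X i \<omega>) = cgauss_prod I" .
qed

text \<open>With \<open>t\<close> the squared modulus, \<open>t exp(-t) \<le> 2 exp(-t/2)\<close>,
  and the right side is a multiple of the dilated density.\<close>

lemma nn_integral_cgauss_norm_square:
  assumes P: "prob_space cgauss"
  shows "(\<integral>\<^sup>+ w. ennreal ((cmod w)\<^sup>2) \<partial>cgauss) < \<infinity>"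
proof -
  have "(\<integral>\<^sup>+ w. ennreal ((cmod w)\<^sup>2) \<partial>cgauss) = (\<integral>\<^sup>+ w. cgauss_density w * ennreal ((cmod w)\<^sup>2) \<partial>lborel)"
    unfolding cgauss_def by (subst nn_integral_density) auto
  also have "\<dots> \<le> (\<integral>\<^sup>+ w. ennreal 2 * cgauss_density (of_real (1 / sqrt 2) * w) \<partial>lborel)"
  proof (intro nn_integral_mono)
    fix w :: complex
    define t where "t = (cmod w)\<^sup>2"
    have "t \<le> 2 * exp (t / 2)" using exp_ge_add_one_self[of "t / 2"] by linarith
    hence "exp (- t) * t \<le> exp (- t) * (2 * exp (t / 2))" by (intro mult_left_mono) auto
    also have "\<dots> = 2 * exp (- (t / 2))" by (simp add: mult_exp_exp)
    finally have "exp (- t) / pi * t \<le> 2 * (exp (- (t / 2)) / pi)"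
      by (simp add: divide_right_mono)
    hence "ennreal (exp (- t) / pi) * ennreal t \<le> ennreal 2 * ennreal (exp (- (t / 2)) / pi)"
      by (simp only: ennreal_mult''[symmetric] ennreal_leI divide_nonneg_nonneg exp_ge_zero pi_ge_zero
          t_def zero_le_power2 zero_le_numeral)
    thus "cgauss_density w * ennreal ((cmod w)\<^sup>2) \<le> ennreal 2 * cgauss_density (of_real (1 / sqrt 2) * w)"
      unfolding cgauss_density_scale by (simp only: cgauss_density_def t_def)
  qed
  also have "\<dots> < \<infinity>" unfolding nn_integral_cgauss_density_scale[OF P] by (simp add: ennreal_mult_less_top)
  finally show ?thesis .
qed

lemma cgauss_integrable:
  assumes "prob_space cgauss"
  shows "integrable cgauss (\<lambda>w. (cmod (w - m))\<^sup>2)" "integrable cgauss (\<lambda>w. w)"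
proof -
  interpret prob_space cgauss by fact
  have sq: "integrable cgauss (\<lambda>w. (cmod w)\<^sup>2)"
    using nn_integral_cgauss_norm_square[OF assms] by (intro integrableI_bounded) auto
  show "integrable cgauss (\<lambda>w. (cmod (w - m))\<^sup>2)"
  proof (rule Bochner_Integration.integrable_bound)
    show "integrable cgauss (\<lambda>w. 2 * (cmod w)\<^sup>2 + 2 * (cmod m)\<^sup>2)" using sq by auto
    show "AE w in cgauss. norm ((cmod (w - m))\<^sup>2) \<le> norm (2 * (cmod w)\<^sup>2 + 2 * (cmod m)\<^sup>2)"
    proof (rule AE_I2)
      fix w
      have "(cmod (w - m))\<^sup>2 \<le> (cmod w + cmod m)\<^sup>2" by (intro power_mono norm_triangle_ineq4) auto
      also have "\<dots> \<le> 2 * (cmod w)\<^sup>2 + 2 * (cmod m)\<^sup>2"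
        using zero_le_power2[of "cmod w - cmod m"] by (simp add: power2_eq_square algebra_simps)
      finally show "norm ((cmod (w - m))\<^sup>2) \<le> norm (2 * (cmod w)\<^sup>2 + 2 * (cmod m)\<^sup>2)" by simp
    qed
  qed auto
  show "integrable cgauss (\<lambda>w. w)"
  proof (rule Bochner_Integration.integrable_bound)
    show "integrable cgauss (\<lambda>w. 1 + (cmod w)\<^sup>2)" using sq by auto
    show "AE w in cgauss. norm w \<le> norm (1 + (cmod w)\<^sup>2)"
    proof (rule AE_I2)
      fix w
      have "0 \<le> (cmod w - 1)\<^sup>2" by simp
      also have "\<dots> = (cmod w)\<^sup>2 - 2 * cmod w + 1" by (simp add: power2_eq_square algebra_simps)
      finally have "cmod w \<le> 1 + (cmod w)\<^sup>2" using norm_ge_zero[of w] by linarith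
      thus "norm w \<le> norm (1 + (cmod w)\<^sup>2)" by simp
    qed
  qed auto
qed

text \<open>The value of the variance is 1, but only its positivity matters for the exponents.\<close>
definition cgauss_variance :: real where
  "cgauss_variance = (LINT w|cgauss. (cmod (w - (LINT w'|cgauss. w')))\<^sup>2)"

text \<open>Zero variance would concentrate the law in its mean, but a law with a density does not
  charge points.\<close>

lemma cgauss_variance_pos:
  assumes "prob_space cgauss"
  shows "cgauss_variance > 0"
proof -
  interpret prob_space cgauss by fact
  define m where "m = (LINT w|cgauss. w)"
  have "AE w in cgauss. w \<noteq> m"
    unfolding cgauss_def by (subst AE_density) (auto intro: AE_mp[OF AE_lborel_singleton[of m]])
  moreover have False if "AE w in cgauss. w \<noteq> m" "AE w in cgauss. w = m"
  proof -
    have "AE w in cgauss. False" using that by eventually_elim auto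
    thus False using AE_False by simp
  qed
  moreover have "cgauss_variance = 0 \<longleftrightarrow> (AE w in cgauss. (cmod (w - m))\<^sup>2 = 0)"
    unfolding cgauss_variance_def m_def[symmetric]
    by (intro integral_nonneg_eq_0_iff_AE cgauss_integrable assms) auto
  moreover have "cgauss_variance \<ge> 0" unfolding cgauss_variance_def by simp
  ultimately show ?thesis by force
qed


text \<open>After centering, independence annihilates the mixed terms and every diagonal term is the
  common variance. The mean \<open>m\<close> cancels in the centering, so its value need not be
  computed.\<close>

lemma covariance_lincomb:
  assumes M: "prob_space M" and indep: "prob_space.indep_vars M (\<lambda>_. borel) \<zeta> J"
    and \<zeta>: "\<And>p. p \<in> J \<Longrightarrow> complex_std_normal M (\<zeta> p)" and J: "finite J" "J \<noteq> {}"
  shows "(LINT \<omega>|M. ((\<Sum>p\<in>J. c p * \<zeta> p \<omega>) - (LINT \<omega>'|M. (\<Sum>p\<in>J. c p * \<zeta> p \<omega>')))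
      * cnj ((\<Sum>p\<in>J. d p * \<zeta> p \<omega>) - (LINT \<omega>'|M. (\<Sum>p\<in>J. d p * \<zeta> p \<omega>'))))
    = of_real cgauss_variance * (\<Sum>p\<in>J. c p * cnj (d p))"
proof -
  interpret prob_space M by fact
  obtain p0 where "p0 \<in> J" using J by blast
  hence cg: "prob_space cgauss"
    using prob_space_distr[OF complex_std_normalD(1)[OF \<zeta>]] complex_std_normalD(2)[OF \<zeta>] by metis
  define m where "m = (LINT w|cgauss. w)"
  note \<zeta>m = complex_std_normalD(1)[OF \<zeta>]
  have int: "integrable M (\<zeta> p)" and E: "(LINT \<omega>|M. \<zeta> p \<omega>) = m" if "p \<in> J" for p
  proof -
    have "integrable (distr M borel (\<zeta> p)) (\<lambda>w. w)"
      unfolding complex_std_normalD(2)[OF \<zeta>[OF that]] by (rule cgauss_integrable(2)[OF cg])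
    thus "integrable M (\<zeta> p)" by (subst (asm) integrable_distr_eq[OF \<zeta>m[OF that]]) auto
    have "(LINT w|distr M borel (\<zeta> p). w) = (LINT \<omega>|M. \<zeta> p \<omega>)"
      by (rule integral_distr[OF \<zeta>m[OF that]]) simp
    thus "(LINT \<omega>|M. \<zeta> p \<omega>) = m" unfolding complex_std_normalD(2)[OF \<zeta>[OF that]] m_def by simp
  qed
  define \<eta> where "\<eta> p \<omega> = \<zeta> p \<omega> - m" for p \<omega>
  have \<eta>int: "integrable M (\<eta> p)" and \<eta>0: "(LINT \<omega>|M. \<eta> p \<omega>) = 0" if "p \<in> J" for p
    using int[OF that] E[OF that] unfolding \<eta>_def by (auto simp: prob_space)
  have centered: "(\<Sum>p\<in>J. b p * \<zeta> p \<omega>) - (LINT \<omega>'|M. (\<Sum>p\<in>J. b p * \<zeta> p \<omega>')) = (\<Sum>p\<in>J. b p * \<eta> p \<omega>)" for b \<omega>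
  proof -
    have "(LINT \<omega>'|M. (\<Sum>p\<in>J. b p * \<zeta> p \<omega>')) = (\<Sum>p\<in>J. b p * m)"
      using int E by (subst Bochner_Integration.integral_sum) auto
    thus ?thesis by (simp add: \<eta>_def algebra_simps sum_subtractf)
  qed
  have diag: "integrable M (\<lambda>\<omega>. \<eta> p \<omega> * cnj (\<eta> p \<omega>))"
      "(LINT \<omega>|M. \<eta> p \<omega> * cnj (\<eta> p \<omega>)) = of_real cgauss_variance" if p: "p \<in> J" for p
  proof -
    have eq: "\<eta> p \<omega> * cnj (\<eta> p \<omega>) = of_real ((cmod (\<zeta> p \<omega> - m))\<^sup>2)" for \<omega>
      unfolding \<eta>_def by (rule complex_norm_square[symmetric])
    have "integrable (distr M borel (\<zeta> p)) (\<lambda>w. (cmod (w - m))\<^sup>2)"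
      unfolding complex_std_normalD(2)[OF \<zeta>[OF p]] by (rule cgauss_integrable(1)[OF cg])
    hence i: "integrable M (\<lambda>\<omega>. (cmod (\<zeta> p \<omega> - m))\<^sup>2)"
      by (subst (asm) integrable_distr_eq[OF \<zeta>m[OF p]]) auto
    have "(LINT w|distr M borel (\<zeta> p). (cmod (w - m))\<^sup>2) = (LINT \<omega>|M. (cmod (\<zeta> p \<omega> - m))\<^sup>2)"
      by (rule integral_distr[OF \<zeta>m[OF p]]) simp
    hence "(LINT \<omega>|M. (cmod (\<zeta> p \<omega> - m))\<^sup>2) = cgauss_variance"
      unfolding complex_std_normalD(2)[OF \<zeta>[OF p]] cgauss_variance_def m_def by simp
    thus "integrable M (\<lambda>\<omega>. \<eta> p \<omega> * cnj (\<eta> p \<omega>))"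
      "(LINT \<omega>|M. \<eta> p \<omega> * cnj (\<eta> p \<omega>)) = of_real cgauss_variance"
      unfolding eq using i by (simp_all del: of_real_power)
  qed
  have off: "integrable M (\<lambda>\<omega>. \<eta> p \<omega> * cnj (\<eta> q \<omega>))" "(LINT \<omega>|M. \<eta> p \<omega> * cnj (\<eta> q \<omega>)) = 0"
    if p: "p \<in> J" and q: "q \<in> J" and pq: "p \<noteq> q" for p q
  proof -
    \<comment> \<open>Conjugation is assigned to the index \<open>q\<close> only, so that the
      product over \<open>{p, q}\<close> is the mixed term and the product rule for independent
      families applies.\<close>
    define Y where "Y r = (\<lambda>w. if r = p then w - m else cnj (w - m))" for r
    have Y: "Y r \<in> measurable borel borel" for r by (cases "r = p") (auto simp: Y_def)
    have ind: "indep_vars (\<lambda>_. borel) (\<lambda>r \<omega>. Y r (\<zeta> r \<omega>)) {p, q}"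
      using p q by (intro indep_vars_compose2[OF indep_vars_subset[OF indep]] Y) auto
    have I: "integrable M (\<lambda>\<omega>. Y r (\<zeta> r \<omega>))" if "r \<in> {p, q}" for r
    proof (cases "r = p")
      case True
      hence "(\<lambda>\<omega>. Y r (\<zeta> r \<omega>)) = \<eta> p" by (auto simp: Y_def \<eta>_def)
      thus ?thesis using \<eta>int[OF p] by simp
    next
      case False
      hence "(\<lambda>\<omega>. Y r (\<zeta> r \<omega>)) = (\<lambda>\<omega>. cnj (\<eta> q \<omega>))" using that by (auto simp: Y_def \<eta>_def)
      thus ?thesis using \<eta>int[OF q] by simp
    qed
    have prod: "(\<Prod>r\<in>{p, q}. Y r (\<zeta> r \<omega>)) = \<eta> p \<omega> * cnj (\<eta> q \<omega>)" for \<omega>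
      using pq by (simp add: Y_def \<eta>_def)
    show "integrable M (\<lambda>\<omega>. \<eta> p \<omega> * cnj (\<eta> q \<omega>))"
      using indep_vars_integrable[OF _ ind I] unfolding prod by simp
    have "(LINT \<omega>|M. \<eta> p \<omega> * cnj (\<eta> q \<omega>)) = (\<Prod>r\<in>{p, q}. LINT \<omega>|M. Y r (\<zeta> r \<omega>))"
      using indep_vars_lebesgue_integral[OF _ ind I] unfolding prod by simp
    also have "\<dots> = (LINT \<omega>|M. \<eta> p \<omega>) * (LINT \<omega>|M. cnj (\<eta> q \<omega>))"
      using pq by (simp add: Y_def \<eta>_def)
    finally show "(LINT \<omega>|M. \<eta> p \<omega> * cnj (\<eta> q \<omega>)) = 0" using \<eta>0[OF p] by simp
  qed
  have I: "integrable M (\<lambda>\<omega>. \<eta> p \<omega> * cnj (\<eta> q \<omega>))"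
    and L: "(LINT \<omega>|M. \<eta> p \<omega> * cnj (\<eta> q \<omega>)) = (if p = q then of_real cgauss_variance else 0)"
    if "p \<in> J" "q \<in> J" for p q
    using diag[OF that(1)] off[OF that] by (cases "p = q", auto)+
  have "(LINT \<omega>|M. (\<Sum>p\<in>J. c p * \<eta> p \<omega>) * cnj (\<Sum>p\<in>J. d p * \<eta> p \<omega>))
      = (LINT \<omega>|M. (\<Sum>p\<in>J. \<Sum>q\<in>J. (c p * cnj (d q)) * (\<eta> p \<omega> * cnj (\<eta> q \<omega>))))"
    by (simp add: sum_product mult_ac)
  also have "\<dots> = (\<Sum>p\<in>J. \<Sum>q\<in>J. (c p * cnj (d q)) * (LINT \<omega>|M. \<eta> p \<omega> * cnj (\<eta> q \<omega>)))"
    using I by (subst Bochner_Integration.integral_sum, force intro!: Bochner_Integration.integrable_sum,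
      intro sum.cong refl, subst Bochner_Integration.integral_sum) auto
  also have "\<dots> = (\<Sum>p\<in>J. \<Sum>q\<in>J. if p = q then c p * cnj (d p) * of_real cgauss_variance else 0)"
    using L by (intro sum.cong refl) auto
  also have "\<dots> = of_real cgauss_variance * (\<Sum>p\<in>J. c p * cnj (d p))"
    using J by (simp add: sum_distrib_left mult_ac)
  finally show ?thesis unfolding centered .
qed

text \<open>The two channels of the theorem live on different probability spaces. Their outage
  events are transported to this common one, where they can be compared.\<close>

definition fading :: "nat \<Rightarrow> (nat \<Rightarrow> nat) \<Rightarrow> (nat \<times> nat \<times> nat \<Rightarrow> complex) measure" where
  "fading N n = PiM (chan_index N n) (\<lambda>_. cgauss)"

definition rp_log_det :: "nat \<Rightarrow> (nat \<Rightarrow> nat) \<Rightarrow> real \<Rightarrow> (nat \<times> nat \<times> nat \<Rightarrow> complex) \<Rightarrow> real" where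
  "rp_log_det N n \<rho> x = ln (noisy_det (1\<^sub>m (n N)) (chan_prod n N (chan_mat n x)) \<rho>)"

definition af_log_det ::
  "nat \<Rightarrow> (nat \<Rightarrow> nat) \<Rightarrow> real \<Rightarrow> real \<Rightarrow> (nat \<times> nat \<times> nat \<Rightarrow> complex) \<Rightarrow> real" where
  "af_log_det N n \<kappa> \<rho> x = ln (noisy_det (noise_cov_mat cgauss_variance N n \<kappa> \<rho> (chan_mat n x))
     (chan_prod n N (chan_mat n (\<lambda>p. of_real (relay_factor n \<kappa> \<rho> p x) * x p))) \<rho>)"

lemma measurable_rp_log_det:
  assumes "\<And>p. (\<lambda>x. f x p) \<in> borel_measurable M"
  shows "(\<lambda>x. rp_log_det N n \<rho> (f x)) \<in> borel_measurable M"
  unfolding rp_log_det_def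
  by (intro borel_measurable_ln borel_measurable_noisy_det[OF mat_measurable_one mat_measurable_chan_prod[OF assms]])

lemma measurable_af_log_det: "af_log_det N n \<kappa> \<rho> \<in> borel_measurable (fading N n)"
proof -
  have [measurable]: "(\<lambda>x. of_real (relay_factor n \<kappa> \<rho> p x) * x p :: complex) \<in> borel_measurable (fading N n)" for p
    unfolding fading_def supply measurable_PiM_coord[measurable] measurable_relay_factor[measurable] by measurable
  have "(\<lambda>x. noisy_det (noise_cov_mat cgauss_variance N n \<kappa> \<rho> (chan_mat n x))
     (chan_prod n N (chan_mat n (\<lambda>p. of_real (relay_factor n \<kappa> \<rho> p x) * x p))) \<rho>) \<in> borel_measurable (fading N n)"
    by (rule borel_measurable_noisy_det[OF mat_measurable_noise_cov_mat[of "chan_index N n", folded fading_def] mat_measurable_chan_prod]) simp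
  thus ?thesis unfolding af_log_det_def[abs_def] by (rule borel_measurable_ln)
qed

lemma measure_fading_event:
  assumes M: "prob_space M" and indep: "prob_space.indep_vars M (\<lambda>_. borel) X (chan_index N n)"
    and X: "\<And>i. i \<in> chan_index N n \<Longrightarrow> complex_std_normal M (X i)" and I: "chan_index N n \<noteq> {}"
    and f: "f \<in> borel_measurable (fading N n)"
  shows "measure M {\<omega> \<in> space M. f (\<lambda>i\<in>chan_index N n. X i \<omega>) < R}
    = measure (fading N n) {x \<in> space (fading N n). f x < (R :: real)}"
proof -
  let ?X = "\<lambda>\<omega>. \<lambda>i\<in>chan_index N n. X i \<omega>"
  note D = distr_indep_complex_std_normal[OF M indep X I, folded fading_def]
  have S: "{x \<in> space (fading N n). f x < R} \<in> sets (fading N n)"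
    using f by measurable
  have "measure (fading N n) {x \<in> space (fading N n). f x < R}
     = measure (distr M (fading N n) ?X) {x \<in> space (fading N n). f x < R}"
    using D(2) by metis
  also have "\<dots> = measure M (?X -` {x \<in> space (fading N n). f x < R} \<inter> space M)"
    by (rule measure_distr[OF D(1) S])
  also have "?X -` {x \<in> space (fading N n). f x < R} \<inter> space M = {\<omega> \<in> space M. f (?X \<omega>) < R}"
    using measurable_space[OF D(1)] by auto
  finally show ?thesis by (rule sym)
qed

section \<open>Outage probabilities as probabilities of fading events\<close>

text \<open>An injection carries finite subfamilies to finite subfamilies, and independence is a
  condition on those. It serves to reverse the numbering of the hops in the Rayleigh product, and to
  split the multihop family, indexed by a disjoint sum, into fading and noise.\<close>

lemma (in prob_space) indep_vars_reindex:
  assumes inj: "inj_on \<phi> I" and X: "indep_vars M' X (\<phi> ` I)"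
  shows "indep_vars (\<lambda>i. M' (\<phi> i)) (\<lambda>i. X (\<phi> i)) I"
  unfolding indep_vars_def2
proof
  show "\<forall>i\<in>I. random_variable (M' (\<phi> i)) (X (\<phi> i))"
    using X unfolding indep_vars_def2 by blast
  define F where "F i = {X i -` A \<inter> space M |A. A \<in> sets (M' i)}" for i
  have F: "indep_sets F (\<phi> ` I)" using X unfolding indep_vars_def2 F_def by blast
  have "indep_sets (\<lambda>i. F (\<phi> i)) I"
  proof (rule indep_setsI)
    show "F (\<phi> i) \<subseteq> events" if "i \<in> I" for i using F that unfolding indep_sets_def by blast
    fix A J assume J: "J \<noteq> {}" "J \<subseteq> I" "finite J" and A: "\<forall>j\<in>J. A j \<in> F (\<phi> j)"
    define B where "B j = A (the_inv_into I \<phi> j)" for j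
    have B: "B (\<phi> j) = A j" if "j \<in> J" for j
      using that J inj by (simp add: B_def the_inv_into_f_f subset_iff)
    have injJ: "inj_on \<phi> J" by (rule inj_on_subset[OF inj J(2)])
    have "prob (\<Inter>j\<in>\<phi> ` J. B j) = (\<Prod>j\<in>\<phi> ` J. prob (B j))"
      using A J B by (intro indep_setsD[OF F]) auto
    moreover have "(\<Inter>j\<in>\<phi> ` J. B j) = (\<Inter>j\<in>J. A j)" using B by auto
    moreover have "(\<Prod>j\<in>\<phi> ` J. prob (B j)) = (\<Prod>j\<in>J. prob (A j))"
      using B by (simp add: prod.reindex[OF injJ])
    ultimately show "prob (\<Inter>j\<in>J. A j) = (\<Prod>j\<in>J. prob (A j))" by simp
  qed
  thus "indep_sets (\<lambda>i. {X (\<phi> i) -` A \<inter> space M |A. A \<in> sets (M' (\<phi> i))}) I"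
    unfolding F_def .
qed

lemma finite_chan_index: "finite (chan_index N n)"
  by (auto simp: chan_index_def)

lemma chan_index_nonempty:
  assumes "N \<ge> 1" "\<And>i. i \<le> N \<Longrightarrow> n i \<ge> 1"
  shows "chan_index N n \<noteq> {}"
proof -
  have "(1, 0, 0) \<in> chan_index N n"
    using assms(1) assms(2)[of 0] assms(2)[of 1] by (auto simp: chan_index_def)
  thus ?thesis by blast
qed

lemma chan_mat_restrict_entries:
  assumes "i \<in> {1..N}" "A i \<in> carrier_mat (n i) (n (i - 1))"
  shows "chan_mat n (\<lambda>p\<in>chan_index N n. (\<lambda>(i, j, k). A i $$ (j, k)) p) i = A i"
  using assms by (intro eq_matI) (auto simp: chan_mat_def chan_index_def)

lemma outage_prob_rp_matrix:
  assumes M: "prob_space M" and N: "N \<ge> 1" and n: "\<And>i. i \<le> N \<Longrightarrow> n i \<ge> 1"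
    and G: "rayleigh_product M N (\<lambda>i. n (N - i)) G"
  shows "outage_prob M (rp_matrix N (\<lambda>i. n (N - i)) G) \<rho> R
    = measure (fading N n) {x \<in> space (fading N n). rp_log_det N n \<rho> x < R}"
proof -
  interpret prob_space M by fact
  let ?C = "rp_matrix N (\<lambda>i. n (N - i)) G"
  define I where "I = chan_index N n"
  let ?I' = "SIGMA i:{1..N}. {..<n (N - (i - 1))} \<times> {..<n (N - i)}"
  \<comment> \<open>\<open>G (N + 1 - i)\<close> has exactly the shape of \<open>H_i\<close>.
    Reversing the numbering also turns \<open>G_1 ... G_N\<close> into the order
    \<open>H_N ... H_1\<close>, so no transposition is involved.\<close>
  define \<phi> where "\<phi> = (\<lambda>(i, j, k). (Suc N - i, j, k) :: nat \<times> nat \<times> nat)"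
  define X where "X = (\<lambda>(i, j, k) \<omega>. G (Suc N - i) \<omega> $$ (j, k))"
  have inj: "inj_on \<phi> I" by (auto simp: inj_on_def \<phi>_def I_def chan_index_def)
  have img: "\<phi> ` I \<subseteq> ?I'"
    by (auto simp: \<phi>_def I_def chan_index_def Suc_diff_le)
  have "indep_vars (\<lambda>_. borel) (\<lambda>(i, j, k) \<omega>. G i \<omega> $$ (j, k)) ?I'"
    using G unfolding rayleigh_product_def by blast
  from indep_vars_reindex[OF inj indep_vars_subset[OF this img]]
  have ind: "indep_vars (\<lambda>_. borel) X I"
    by (simp add: X_def \<phi>_def case_prod_beta' comp_def)
  have X: "complex_std_normal M (X p)" if "p \<in> I" for p
  proof -
    obtain i j k where p1: "p = (i, j, k)" by (cases p)
    hence p: "p = (i, j, k)" "i \<in> {1..N}" "j < n i" "k < n (i - 1)"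
      using that by (auto simp: I_def chan_index_def)
    have "Suc N - i \<in> {1..N}" "N - (Suc N - i - 1) = i" "N - (Suc N - i) = i - 1" using p(2) by auto
    thus ?thesis using G p unfolding rayleigh_product_def X_def by auto
  qed
  have "rp_log_det N n \<rho> (\<lambda>p\<in>I. X p \<omega>)
      = ln (Re (det (1\<^sub>m (dim_row (?C \<omega>)) + of_real \<rho> \<cdot>\<^sub>m
         (?C \<omega> * mat_adjoint (?C \<omega>)))))"
    if \<omega>: "\<omega> \<in> space M" for \<omega>
  proof -
    have "map (\<lambda>i. G i \<omega>) [1..<N + 1] = map (\<lambda>i. G (Suc N - i) \<omega>) (rev [1..<N + 1])"
      by (rule nth_equalityI) (auto simp: rev_nth simp del: upt_Suc)
    hence "rp_matrix N (\<lambda>i. n (N - i)) G \<omega> = chan_prod n N (\<lambda>i. G (Suc N - i) \<omega>)"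
      by (simp only: rp_matrix_def chan_prod_def diff_self_eq_0)
    also have "\<dots> = chan_prod n N (chan_mat n (\<lambda>p\<in>I. X p \<omega>))"
    proof (intro chan_prod_cong)
      fix i assume i: "1 \<le> i" "i \<le> N"
      have "Suc N - i \<in> {1..N}" "N - (Suc N - i - 1) = i" "N - (Suc N - i) = i - 1" using i by auto
      note e = this
      have "G (Suc N - i) \<omega> \<in> carrier_mat (n (N - (Suc N - i - 1))) (n (N - (Suc N - i)))"
        using G \<omega> e(1) unfolding rayleigh_product_def by blast
      hence "G (Suc N - i) \<omega> \<in> carrier_mat (n i) (n (i - 1))" unfolding e(2,3) .
      with chan_mat_restrict_entries[of i N "\<lambda>i. G (Suc N - i) \<omega>" n] i
      show "G (Suc N - i) \<omega> = chan_mat n (\<lambda>p\<in>I. X p \<omega>) i"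
        by (simp add: I_def X_def case_prod_beta')
    qed
    finally have rp: "rp_matrix N (\<lambda>i. n (N - i)) G \<omega> = chan_prod n N (chan_mat n (\<lambda>p\<in>I. X p \<omega>))" .
    show ?thesis unfolding rp_log_det_def rp
      by (simp only: noisy_det_one[OF chan_prod_carrier[of N "chan_mat n (\<lambda>p\<in>I. X p \<omega>)" n, OF chan_mat_carrier]])
  qed
  hence "outage_prob M (rp_matrix N (\<lambda>i. n (N - i)) G) \<rho> R
    = measure M {\<omega> \<in> space M. rp_log_det N n \<rho> (\<lambda>p\<in>I. X p \<omega>) < R}"
    unfolding outage_prob_def by (intro arg_cong[of _ _ "measure M"] Collect_cong) auto
  also have "\<dots> = measure (fading N n) {x \<in> space (fading N n). rp_log_det N n \<rho> x < R}"
    unfolding I_def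
    by (intro measure_fading_event M ind[unfolded I_def] X[unfolded I_def] chan_index_nonempty N n)
       (simp_all add: fading_def measurable_rp_log_det measurable_PiM_coord)
  finally show ?thesis .
qed

lemma af_signal_mat_cong:
  assumes "\<And>i. 1 \<le> i \<Longrightarrow> i \<le> N \<Longrightarrow> h i = h' i"
  shows "af_signal_mat N n \<kappa> \<rho> h = af_signal_mat N n \<kappa> \<rho> h'"
  unfolding af_signal_mat_def af_relay_def
  using assms by (intro arg_cong[of _ _ "mat_prod_list (n 0)"] map_cong) auto

lemma af_noise_mat_cong:
  assumes "\<And>i. 1 \<le> i \<Longrightarrow> i \<le> N \<Longrightarrow> h i = h' i" "1 \<le> j"
  shows "af_noise_mat N n \<kappa> \<rho> h j = af_noise_mat N n \<kappa> \<rho> h' j"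
  unfolding af_noise_mat_def af_relay_def
  using assms by (intro arg_cong[of _ _ "mat_prod_list (n j)"] map_cong) auto

text \<open>At a fixed outcome the noise is integrated out with the channel matrices frozen, so the
  covariance is an explicit matrix function of the fading coefficients. The outage event then
  involves the fading only.\<close>

lemma outage_prob_af_matrix:
  assumes M: "prob_space M" and N: "N \<ge> 1" and n: "\<And>i. i \<le> N \<Longrightarrow> n i \<ge> 1"
    and H: "multihop M N n H z"
  shows "outage_prob M (af_matrix M N n \<kappa> H z \<rho>) \<rho> R
    = measure (fading N n) {x \<in> space (fading N n). af_log_det N n \<kappa> \<rho> x < R}"
proof -
  interpret prob_space M by fact
  let ?C = "af_matrix M N n \<kappa> H z \<rho>"
  define I where "I = chan_index N n"
  define J where "J = (SIGMA i:{1..N}. {..<n i})"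
  define X where "X = (\<lambda>(i, j, k) \<omega>. H i \<omega> $$ (j, k))"
  define \<zeta> where "\<zeta> = (\<lambda>(i, j) \<omega>. z i \<omega> $ j)"
  have all: "indep_vars (\<lambda>_. borel) (case_sum X \<zeta>) (I <+> J)"
    using H unfolding multihop_def X_def \<zeta>_def I_def J_def chan_index_def by blast
  have "indep_vars (\<lambda>_. borel) (\<lambda>i. case_sum X \<zeta> (Inl i)) I"
    by (rule indep_vars_reindex[OF _ indep_vars_subset[OF all]]) auto
  hence indX: "indep_vars (\<lambda>_. borel) X I" by simp
  have "indep_vars (\<lambda>_. borel) (\<lambda>i. case_sum X \<zeta> (Inr i)) J"
    by (rule indep_vars_reindex[OF _ indep_vars_subset[OF all]]) auto
  hence ind\<zeta>: "indep_vars (\<lambda>_. borel) \<zeta> J" by simp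
  have X: "complex_std_normal M (X p)" if "p \<in> I" for p
    using that H unfolding multihop_def X_def I_def chan_index_def by auto
  have \<zeta>: "complex_std_normal M (\<zeta> p)" if "p \<in> J" for p
    using that H unfolding multihop_def \<zeta>_def J_def by auto
  have J: "finite J" "J \<noteq> {}"
  proof -
    show "finite J" by (auto simp: J_def)
    have "(1, 0) \<in> J" using N n[of 1] by (auto simp: J_def)
    thus "J \<noteq> {}" by blast
  qed
  have cg: "prob_space cgauss"
  proof -
    obtain p where "p \<in> I" unfolding I_def using chan_index_nonempty[of N n] N n by blast
    thus ?thesis
      using prob_space_distr[OF complex_std_normalD(1)[OF X]] complex_std_normalD(2)[OF X] by metis
  qed
  have key: "af_log_det N n \<kappa> \<rho> (\<lambda>p\<in>I. X p \<omega>)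
      = ln (Re (det (1\<^sub>m (dim_row (?C \<omega>)) + of_real \<rho> \<cdot>\<^sub>m
         (?C \<omega> * mat_adjoint (?C \<omega>)))))"
    if \<omega>: "\<omega> \<in> space M" for \<omega>
  proof -
    define x where "x = (\<lambda>p\<in>I. X p \<omega>)"
    define F where "F j = af_noise_mat N n \<kappa> \<rho> (chan_mat n x) j" for j
    have Hx: "H i \<omega> = chan_mat n x i" if i: "1 \<le> i" "i \<le> N" for i
    proof -
      have "H i \<omega> \<in> carrier_mat (n i) (n (i - 1))" using H \<omega> i unfolding multihop_def by auto
      with chan_mat_restrict_entries[of i N "\<lambda>i. H i \<omega>" n] i show ?thesis
        by (simp add: x_def I_def X_def case_prod_beta')
    qed
    \<comment> \<open>Only the size statement inside \<open>mat_measurable\<close> is wanted, which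
      holds for any index set of the product measure; the empty one is taken.\<close>
    have Fc: "F j \<in> carrier_mat (n N) (n j)" if "j \<le> N" for j
      unfolding F_def by (rule mat_measurableD(1)[OF mat_measurable_af_noise_mat[OF that, of "{}"]])
    have noise: "af_noise N n \<kappa> \<rho> (\<lambda>i. H i \<omega>) (\<lambda>j. z j \<omega>') $ a = (\<Sum>p\<in>J. F (fst p) $$ (a, snd p) * \<zeta> p \<omega>')"
      if a: "a < n N" and \<omega>': "\<omega>' \<in> space M" for a \<omega>'
    proof -
      have "af_noise N n \<kappa> \<rho> (\<lambda>i. H i \<omega>) (\<lambda>j. z j \<omega>') $ a = (\<Sum>j=1..N. (F j *\<^sub>v z j \<omega>') $ a)"
        using a af_noise_mat_cong[of N "\<lambda>i. H i \<omega>" "chan_mat n x", OF Hx] unfolding af_noise_def F_def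
        by simp
      also have "\<dots> = (\<Sum>j=1..N. \<Sum>l<n j. F j $$ (a, l) * \<zeta> (j, l) \<omega>')"
      proof (intro sum.cong refl)
        fix j assume j: "j \<in> {1..N}"
        hence "z j \<omega>' \<in> carrier_vec (n j)" using H \<omega>' unfolding multihop_def by auto
        thus "(F j *\<^sub>v z j \<omega>') $ a = (\<Sum>l<n j. F j $$ (a, l) * \<zeta> (j, l) \<omega>')"
          using Fc[of j] j a by (simp add: scalar_prod_def lessThan_atLeast0 \<zeta>_def)
      qed
      also have "\<dots> = (\<Sum>p\<in>J. F (fst p) $$ (a, snd p) * \<zeta> p \<omega>')"
        unfolding J_def by (subst sum.Sigma) (auto simp: case_prod_beta')
      finally show ?thesis .
    qed
    have cov: "af_noise_cov M N n \<kappa> H z \<rho> \<omega> = noise_cov_mat cgauss_variance N n \<kappa> \<rho> (chan_mat n x)"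
    proof (rule eq_matI)
      fix a b assume "a < dim_row (noise_cov_mat cgauss_variance N n \<kappa> \<rho> (chan_mat n x))"
        "b < dim_col (noise_cov_mat cgauss_variance N n \<kappa> \<rho> (chan_mat n x))"
      hence ab: "a < n N" "b < n N" by (auto simp: noise_cov_mat_def)
      define v where "v \<omega>' = af_noise N n \<kappa> \<rho> (\<lambda>i. H i \<omega>) (\<lambda>j. z j \<omega>')" for \<omega>'
      define c where "c a p = F (fst p) $$ (a, snd p)" for a p
      have mean: "(LINT \<omega>'|M. v \<omega>' $ a) = (LINT \<omega>'|M. (\<Sum>p\<in>J. c a p * \<zeta> p \<omega>'))" if "a < n N" for a
        unfolding v_def c_def by (intro Bochner_Integration.integral_cong refl noise that)
      have "af_noise_cov M N n \<kappa> H z \<rho> \<omega> $$ (a, b)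
          = (LINT \<omega>'|M. (v \<omega>' $ a - (LINT \<omega>'|M. v \<omega>' $ a)) * cnj (v \<omega>' $ b - (LINT \<omega>'|M. v \<omega>' $ b)))"
        using ab by (simp add: af_noise_cov_def covariance_mat_def v_def)
      also have "\<dots> = (LINT \<omega>'|M. ((\<Sum>p\<in>J. c a p * \<zeta> p \<omega>') - (LINT \<omega>'|M. (\<Sum>p\<in>J. c a p * \<zeta> p \<omega>')))
          * cnj ((\<Sum>p\<in>J. c b p * \<zeta> p \<omega>') - (LINT \<omega>'|M. (\<Sum>p\<in>J. c b p * \<zeta> p \<omega>'))))"
        unfolding mean[OF ab(1)] mean[OF ab(2)]
        using noise[OF ab(1)] noise[OF ab(2)] unfolding v_def c_def
        by (intro Bochner_Integration.integral_cong refl) simp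
      also have "\<dots> = of_real cgauss_variance * (\<Sum>p\<in>J. c a p * cnj (c b p))"
        by (rule covariance_lincomb[OF M ind\<zeta> \<zeta> J])
      also have "(\<Sum>p\<in>J. c a p * cnj (c b p)) = (\<Sum>j=1..N. \<Sum>l<n j. F j $$ (a, l) * cnj (F j $$ (b, l)))"
        unfolding J_def c_def by (subst sum.Sigma) (auto simp: case_prod_beta')
      finally show "af_noise_cov M N n \<kappa> H z \<rho> \<omega> $$ (a, b)
          = noise_cov_mat cgauss_variance N n \<kappa> \<rho> (chan_mat n x) $$ (a, b)"
        using ab by (simp add: noise_cov_mat_def F_def)
    qed (auto simp: af_noise_cov_def covariance_mat_def noise_cov_mat_def)
    have "af_signal_mat N n \<kappa> \<rho> (\<lambda>i. H i \<omega>) = af_signal_mat N n \<kappa> \<rho> (chan_mat n x)"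
      by (rule af_signal_mat_cong) (rule Hx)
    hence sig: "af_signal_mat N n \<kappa> \<rho> (\<lambda>i. H i \<omega>)
        = chan_prod n N (chan_mat n (\<lambda>p. of_real (relay_factor n \<kappa> \<rho> p x) * x p))"
      by (simp only: af_signal_mat_regroup[OF N])
    have "af_log_det N n \<kappa> \<rho> x = ln (Re (det (1\<^sub>m (dim_row (?C \<omega>)) + of_real \<rho> \<cdot>\<^sub>m
         (?C \<omega> * mat_adjoint (?C \<omega>)))))"
      unfolding af_matrix_def cov sig af_log_det_def
        noisy_det_whitened[OF pos_def_noise_cov_mat[where n=n and \<kappa>=\<kappa> and \<rho>=\<rho> and h="chan_mat n x",
          OF cgauss_variance_pos[OF cg] N]
          chan_prod_carrier[of N "chan_mat n (\<lambda>p. of_real (relay_factor n \<kappa> \<rho> p x) * x p)" n,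
            OF chan_mat_carrier]] ..
    thus ?thesis unfolding x_def .
  qed
  hence "outage_prob M (af_matrix M N n \<kappa> H z \<rho>) \<rho> R
    = measure M {\<omega> \<in> space M. af_log_det N n \<kappa> \<rho> (\<lambda>p\<in>I. X p \<omega>) < R}"
    unfolding outage_prob_def by (intro arg_cong[of _ _ "measure M"] Collect_cong) auto
  also have "\<dots> = measure (fading N n) {x \<in> space (fading N n). af_log_det N n \<kappa> \<rho> x < R}"
    unfolding I_def
    by (intro measure_fading_event M indX[unfolded I_def] X[unfolded I_def] chan_index_nonempty N n
        measurable_af_log_det)
  finally show ?thesis .
qed

section \<open>Outage events under scaling\<close>

text \<open>The integral inequalities for scaled coordinates, applied to the indicator of the event
  \<open>h x < R\<close> and converted to real probabilities.\<close>

lemma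
  fixes lev :: "'i \<Rightarrow> nat" and u :: "'i \<Rightarrow> ('i \<Rightarrow> complex) \<Rightarrow> real" and h :: "('i \<Rightarrow> complex) \<Rightarrow> real"
  assumes P: "prob_space cgauss" and fin: "finite I" and a: "0 < a"
    and u_bounds: "\<And>i x. i \<in> I \<Longrightarrow> a \<le> u i x" "\<And>i x. i \<in> I \<Longrightarrow> u i x \<le> 1"
    and u_meas: "\<And>i S. i \<in> I \<Longrightarrow> S \<subseteq> I \<Longrightarrow> u i \<in> borel_measurable (cgauss_prod S)"
    and u_pred: "\<And>i x y. i \<in> I \<Longrightarrow> (\<And>j. lev j < lev i \<Longrightarrow> x j = y j) \<Longrightarrow> u i x = u i y"
    and h: "h \<in> borel_measurable (cgauss_prod I)"
  defines "\<mu> \<equiv> cgauss_prod I"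
  shows measure_predictable_scale_le:
      "measure \<mu> {x \<in> space \<mu>. h (\<lambda>i\<in>I. of_real (u i x) * x i) < R}
        \<le> (1 / a\<^sup>2) ^ card I * measure \<mu> {x \<in> space \<mu>. h x < R}" (is ?A)
    and measure_le_predictable_scale:
      "measure \<mu> {x \<in> space \<mu>. h (\<lambda>i\<in>I. of_real a * x i) < R}
        \<le> (1 / a\<^sup>2) ^ card I * measure \<mu> {x \<in> space \<mu>. h (\<lambda>i\<in>I. of_real (u i x) * x i) < R}" (is ?B)
proof -
  interpret C: prob_space cgauss by fact
  interpret prob_space \<mu> unfolding \<mu>_def by (rule prob_space_PiM) (rule P)
  define A where "A = {x \<in> space \<mu>. h x < R}"
  have hm: "h \<in> borel_measurable \<mu>" using h unfolding \<mu>_def .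
  have A: "A \<in> sets \<mu>" unfolding A_def using hm by measurable
  have T: "(\<lambda>x. \<lambda>i\<in>I. of_real (v i x) * x i) \<in> measurable \<mu> \<mu>"
    if v: "\<And>i. i \<in> I \<Longrightarrow> v i \<in> borel_measurable \<mu>" for v :: "'i \<Rightarrow> ('i \<Rightarrow> complex) \<Rightarrow> real"
    using v unfolding \<mu>_def by (rule measurable_PiM_scale)
  have emb: "(\<integral>\<^sup>+ x. indicator A (\<lambda>i\<in>I. of_real (v i x) * x i) \<partial>\<mu>)
      = ennreal (measure \<mu> {x \<in> space \<mu>. h (\<lambda>i\<in>I. of_real (v i x) * x i) < R})"
    if v: "\<And>i. i \<in> I \<Longrightarrow> v i \<in> borel_measurable \<mu>" for v :: "'i \<Rightarrow> ('i \<Rightarrow> complex) \<Rightarrow> real"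
  proof -
    let ?S = "{x \<in> space \<mu>. h (\<lambda>i\<in>I. of_real (v i x) * x i) < R}"
    have "(\<lambda>x. h (\<lambda>i\<in>I. of_real (v i x) * x i)) \<in> borel_measurable \<mu>"
      using measurable_compose[OF T[OF v] hm] .
    hence S: "?S \<in> sets \<mu>" by measurable
    have "(\<integral>\<^sup>+ x. indicator A (\<lambda>i\<in>I. of_real (v i x) * x i) \<partial>\<mu>) = (\<integral>\<^sup>+ x. indicator ?S x \<partial>\<mu>)"
    proof (rule nn_integral_cong)
      fix x assume x: "x \<in> space \<mu>"
      have "(\<lambda>i\<in>I. of_real (v i x) * x i) \<in> space \<mu>" by (auto simp: \<mu>_def space_PiM)
      thus "(indicator A (\<lambda>i\<in>I. of_real (v i x) * x i) :: ennreal) = indicator ?S x"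
        using x by (simp add: A_def indicator_def)
    qed
    also have "\<dots> = emeasure \<mu> ?S" using S by (rule nn_integral_indicator)
    finally show ?thesis by (simp only: emeasure_eq_measure)
  qed
  have um: "u i \<in> borel_measurable \<mu>" if "i \<in> I" for i unfolding \<mu>_def by (rule u_meas[OF that]) simp
  have ind: "(indicator A :: _ \<Rightarrow> ennreal) \<in> borel_measurable (cgauss_prod I)"
    using A unfolding \<mu>_def by (rule borel_measurable_indicator)
  have c: "ennreal (1 / a\<^sup>2) ^ card I = ennreal ((1 / a\<^sup>2) ^ card I)"
    by (rule ennreal_power) simp
  have eA: "(\<integral>\<^sup>+ x. indicator A x \<partial>\<mu>) = ennreal (measure \<mu> {x \<in> space \<mu>. h x < R})"
    by (simp only: nn_integral_indicator[OF A] emeasure_eq_measure) (simp only: A_def)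
  note L = nn_integral_PiM_predictable_scale_le[where u=u and lev=lev, OF P fin a u_bounds u_meas u_pred ind]
    nn_integral_PiM_le_predictable_scale[where u=u and lev=lev, OF P fin a u_bounds u_meas u_pred ind]
  have eU: "(\<integral>\<^sup>+ x. indicator A (\<lambda>i\<in>I. of_real (u i x) * x i) \<partial>\<mu>)
      = ennreal (measure \<mu> {x \<in> space \<mu>. h (\<lambda>i\<in>I. of_real (u i x) * x i) < R})"
    by (rule emb) (rule um)
  have ea: "(\<integral>\<^sup>+ x. indicator A (\<lambda>i\<in>I. of_real a * x i) \<partial>\<mu>)
      = ennreal (measure \<mu> {x \<in> space \<mu>. h (\<lambda>i\<in>I. of_real a * x i) < R})"
    by (rule emb) simp
  from L(1) have "ennreal (measure \<mu> {x \<in> space \<mu>. h (\<lambda>i\<in>I. of_real (u i x) * x i) < R})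
      \<le> ennreal ((1 / a\<^sup>2) ^ card I * measure \<mu> {x \<in> space \<mu>. h x < R})"
    unfolding \<mu>_def[symmetric] eU c eA by (simp add: ennreal_mult)
  thus ?A by (subst (asm) ennreal_le_iff) (auto intro!: mult_nonneg_nonneg)
  from L(2) have "ennreal (measure \<mu> {x \<in> space \<mu>. h (\<lambda>i\<in>I. of_real a * x i) < R})
      \<le> ennreal ((1 / a\<^sup>2) ^ card I * measure \<mu> {x \<in> space \<mu>. h (\<lambda>i\<in>I. of_real (u i x) * x i) < R})"
    unfolding \<mu>_def[symmetric] eU ea c
    by (simp add: ennreal_mult)
  thus ?B by (subst (asm) ennreal_le_iff) (auto intro!: mult_nonneg_nonneg)
qed

lemma rp_log_det_cong:
  "(\<And>p. p \<in> chan_index N n \<Longrightarrow> x p = y p) \<Longrightarrow> rp_log_det N n \<rho> x = rp_log_det N n \<rho> y"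
  unfolding rp_log_det_def
  using chan_prod_cong[of N "chan_mat n x" "chan_mat n y" n] chan_mat_cong[of N n x y] by metis

lemma rp_log_det_mono:
  assumes "0 < \<rho>1" "\<rho>1 \<le> \<rho>2"
  shows "rp_log_det N n \<rho>1 x \<le> rp_log_det N n \<rho>2 x"
proof -
  have P: "chan_prod n N (chan_mat n x) \<in> carrier_mat (n N) (n 0)"
    by (rule chan_prod_carrier[OF chan_mat_carrier])
  have 1: "pos_def (n N) (1\<^sub>m (n N))"
  proof -
    have e: "of_real 1 \<cdot>\<^sub>m 1\<^sub>m (n N) = (1\<^sub>m (n N) :: complex mat)" by (rule eq_matI) auto
    have "pos_def (n N) (of_real 1 \<cdot>\<^sub>m 1\<^sub>m (n N))" by (rule pos_def_smult_one) simp
    thus ?thesis unfolding e .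
  qed
  show ?thesis unfolding rp_log_det_def
    using noisy_det_one_mono[OF P assms] noisy_det_pos[OF 1 P, of \<rho>1] assms by (intro ln_mono) auto
qed

text \<open>A common factor enters the product once per hop and the Gram matrix twice as often, so
  it acts as a change of SNR. Noise power and SNR can thus be traded for a scaling of the
  coefficients.\<close>

lemma rp_log_det_smult:
  "rp_log_det N n \<rho> (\<lambda>p. of_real c * x p) = rp_log_det N n (c ^ (2 * N) * \<rho>) x"
proof -
  have P: "chan_prod n N (chan_mat n x) \<in> carrier_mat (n N) (n 0)"
    by (rule chan_prod_carrier[OF chan_mat_carrier])
  have "chan_prod n N (chan_mat n (\<lambda>p. of_real c * x p)) = of_real (c ^ N) \<cdot>\<^sub>m chan_prod n N (chan_mat n x)"
    unfolding chan_mat_smult chan_prod_smult[of "chan_mat n x" n, OF chan_mat_carrier] of_real_power ..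
  thus ?thesis unfolding rp_log_det_def
    by (simp add: noisy_det_smult[OF P] power_mult[symmetric] mult.commute del: of_real_power)
qed

lemma rp_log_det_scale_le:
  assumes "0 < \<rho>" "0 < c" "c \<le> 1"
  shows "rp_log_det N n \<rho> (\<lambda>p. of_real c * x p) \<le> rp_log_det N n \<rho> x"
  unfolding rp_log_det_smult using assms
  by (intro rp_log_det_mono) (auto simp: power_le_one mult_left_le_one_le)

lemma relay_factor_bounds:
  assumes "\<kappa> > 0" "\<rho> \<ge> 0"
  shows "relay_factor n \<kappa> \<rho> p x \<le> max 1 \<kappa>"
  using relay_gain_bounds(2)[OF assms, of n x] by (cases p) (auto simp: relay_factor_def intro: le_max_iff_disj[THEN iffD2])

lemma relay_factor_predictable:
  assumes "\<And>q. fst q < fst p \<Longrightarrow> x q = y q"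
  shows "relay_factor n \<kappa> \<rho> p x = relay_factor n \<kappa> \<rho> p y"
  using assms by (cases p) (auto simp: relay_factor_def relay_gain_def)

text \<open>A relay antenna receives power at most \<open>\<rho> B^2 + 1 \<le> 2 \<rho> B^2\<close>,
  so the square of its normalizing gain is at least \<open>1 / (2 q B^2)\<close>: the SNR cancels.
  The conditions \<open>t \<le> \<kappa>\<close> and \<open>t \<le> 1\<close> cover the cap and the
  factor of the first hop.\<close>

lemma relay_factor_lower_bound:
  assumes t: "0 < t" "t \<le> 1" "t \<le> \<kappa>" "2 * real q * B\<^sup>2 * t\<^sup>2 \<le> 1" and B: "1 \<le> B" and \<rho>: "1 \<le> \<rho>"
    and n: "\<And>i. i \<le> N \<Longrightarrow> n i \<ge> 1" "\<And>i. i \<le> N \<Longrightarrow> n i \<le> q"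
    and x: "\<And>p. p \<in> chan_index N n \<Longrightarrow> cmod (x p) \<le> B" and p: "p \<in> chan_index N n"
  shows "t \<le> relay_factor n \<kappa> \<rho> p x"
proof -
  obtain i j k where p1: "p = (i, j, k)" by (cases p)
  show ?thesis
  proof (cases "i \<le> 1")
    case True
    thus ?thesis using t by (simp add: p1 relay_factor_def)
  next
    case False
    define m where "m = i - 1"
    have m: "1 \<le> m" "m \<le> N" "k < n m" using p False by (auto simp: p1 chan_index_def m_def)
    define s where "s = (\<Sum>l<n (m - 1). (cmod (x (m, k, l)))\<^sup>2)"
    have "m - 1 \<le> N" using m by simp
    hence n0: "real (n (m - 1)) > 0" using n(1)[of "m - 1"] by linarith
    have nm: "real (n m) > 0" "real (n m) \<le> real q" using n(1)[of m] n(2)[of m] m by auto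
    have s0: "0 \<le> s" by (simp add: s_def sum_nonneg)
    have "s \<le> (\<Sum>l<n (m - 1). B\<^sup>2)"
      unfolding s_def using m by (intro sum_mono power_mono x) (auto simp: chan_index_def)
    hence s: "s \<le> real (n (m - 1)) * B\<^sup>2" by simp
    have "\<rho> / real (n (m - 1)) * s \<le> \<rho> / real (n (m - 1)) * (real (n (m - 1)) * B\<^sup>2)"
      using s \<rho> n0 by (intro mult_left_mono) auto
    hence d: "\<rho> / real (n (m - 1)) * s + 1 \<le> \<rho> * B\<^sup>2 + 1" using n0 by simp
    have "1 * 1 \<le> \<rho> * B\<^sup>2" using \<rho> B by (intro mult_mono) (auto intro: one_le_power)
    hence d2: "\<rho> / real (n (m - 1)) * s + 1 \<le> 2 * \<rho> * B\<^sup>2" using d by simp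
    have d0: "0 < \<rho> / real (n (m - 1)) * s + 1" using s0 \<rho> n0 by (intro add_nonneg_pos mult_nonneg_nonneg) auto
    have "t\<^sup>2 * (2 * real q * B\<^sup>2) \<le> 1" using t(4) by (simp add: mult_ac)
    hence "t\<^sup>2 * (2 * \<rho> * B\<^sup>2 * real (n m)) \<le> \<rho>"
    proof -
      have "t\<^sup>2 * (2 * \<rho> * B\<^sup>2 * real (n m)) \<le> t\<^sup>2 * (2 * \<rho> * B\<^sup>2 * real q)"
        using nm \<rho> by (intro mult_left_mono) auto
      also have "\<dots> = \<rho> * (t\<^sup>2 * (2 * real q * B\<^sup>2))" by simp
      also have "\<dots> \<le> \<rho> * 1" using \<open>t\<^sup>2 * (2 * real q * B\<^sup>2) \<le> 1\<close> \<rho> by (intro mult_left_mono) auto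
      finally show ?thesis by simp
    qed
    moreover have "t\<^sup>2 * ((\<rho> / real (n (m - 1)) * s + 1) * real (n m)) \<le> t\<^sup>2 * (2 * \<rho> * B\<^sup>2 * real (n m))"
      using d2 nm by (intro mult_left_mono mult_right_mono) auto
    ultimately have "t\<^sup>2 * ((\<rho> / real (n (m - 1)) * s + 1) * real (n m)) \<le> \<rho>" by linarith
    hence "t\<^sup>2 \<le> (1 / (\<rho> / real (n (m - 1)) * s + 1)) * (\<rho> / real (n m))"
      using d0 nm by (simp add: pos_le_divide_eq mult.assoc)
    hence "t \<le> sqrt ((1 / (\<rho> / real (n (m - 1)) * s + 1)) * (\<rho> / real (n m)))"
      by (rule real_le_rsqrt)
    also have "\<dots> = sqrt (1 / (\<rho> / real (n (m - 1)) * s + 1)) * sqrt (\<rho> / real (n m))"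
      by (rule real_sqrt_mult)
    finally show ?thesis using t(3) False
      by (simp add: p1 relay_factor_def relay_gain_def m_def s_def)
  qed
qed

definition large_fading :: "nat \<Rightarrow> (nat \<Rightarrow> nat) \<Rightarrow> real \<Rightarrow> (nat \<times> nat \<times> nat \<Rightarrow> complex) set" where
  "large_fading N n B = {x \<in> space (fading N n). \<exists>p \<in> chan_index N n. B < cmod (x p)}"

lemma large_fading:
  assumes cg: "prob_space cgauss" and B: "0 \<le> B"
  shows "large_fading N n B \<in> sets (fading N n)"
    "measure (fading N n) (large_fading N n B) \<le> real (card (chan_index N n)) * (2 * exp (- B\<^sup>2 / 2))"
proof -
  interpret C: prob_space cgauss by fact
  interpret F: prob_space "fading N n" unfolding fading_def by (rule prob_space_PiM) (rule cg)
  interpret product_prob_space "\<lambda>_. cgauss" "chan_index N n" by standard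
  let ?E = "\<lambda>p. {x \<in> space (fading N n). B < cmod (x p)}"
  have E: "?E p \<in> sets (fading N n)" for p
    unfolding fading_def supply measurable_PiM_coord[measurable] by measurable
  have U: "large_fading N n B = (\<Union>p\<in>chan_index N n. ?E p)" by (auto simp: large_fading_def)
  show "large_fading N n B \<in> sets (fading N n)"
    unfolding U using E finite_chan_index by (intro sets.finite_UN) auto
  have "measure (fading N n) (?E p) \<le> 2 * exp (- B\<^sup>2 / 2)" if p: "p \<in> chan_index N n" for p
  proof -
    have pm: "(\<lambda>x. x p) \<in> measurable (fading N n) cgauss"
      unfolding fading_def by (rule measurable_component_singleton[OF p])
    have "emeasure (fading N n) (?E p) = emeasure (distr (fading N n) cgauss (\<lambda>x. x p)) {w. B < cmod w}"
      by (subst emeasure_distr[OF pm]) (auto intro!: arg_cong[of _ _ "emeasure (fading N n)"])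
    also have "distr (fading N n) cgauss (\<lambda>x. x p) = cgauss"
      unfolding fading_def by (rule PiM_component[OF p])
    also have "emeasure cgauss {w. B < cmod w} \<le> ennreal (2 * exp (- B\<^sup>2 / 2))"
      by (rule emeasure_cgauss_tail[OF cg B])
    finally show ?thesis unfolding F.emeasure_eq_measure by (subst (asm) ennreal_le_iff) auto
  qed
  hence "(\<Sum>p\<in>chan_index N n. measure (fading N n) (?E p)) \<le> (\<Sum>p\<in>chan_index N n. 2 * exp (- B\<^sup>2 / 2))"
    by (rule sum_mono)
  moreover have "measure (fading N n) (large_fading N n B) \<le> (\<Sum>p\<in>chan_index N n. measure (fading N n) (?E p))"
    unfolding U by (intro F.finite_measure_subadditive_finite finite_chan_index) (use E in auto)
  ultimately show "measure (fading N n) (large_fading N n B) \<le> real (card (chan_index N n)) * (2 * exp (- B\<^sup>2 / 2))"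
    by simp
qed

section \<open>Comparison of the two outage probabilities\<close>

text \<open>The assumption \<open>cg\<close> can be discharged by any single fading coefficient,
  whose law \<open>cgauss\<close> is. The number \<open>q\<close> bounds all layer sizes at
  once.\<close>

locale relay_network =
  fixes N :: nat and n :: "nat \<Rightarrow> nat" and \<kappa> :: real and q :: nat
  assumes cg: "prob_space cgauss" and N: "N \<ge> 1" and n1: "\<And>i. i \<le> N \<Longrightarrow> n i \<ge> 1"
    and nq: "\<And>i. i \<le> N \<Longrightarrow> n i \<le> q" and \<kappa>: "\<kappa> > 0"
begin

definition rp_prob :: "real \<Rightarrow> real \<Rightarrow> real" where
  "rp_prob \<rho> R = measure (fading N n) {x \<in> space (fading N n). rp_log_det N n \<rho> x < R}"

definition af_prob :: "real \<Rightarrow> real \<Rightarrow> real" where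
  "af_prob \<rho> R = measure (fading N n) {x \<in> space (fading N n). af_log_det N n \<kappa> \<rho> x < R}"

definition large_prob :: "real \<Rightarrow> real" where
  "large_prob B = measure (fading N n) (large_fading N n B)"

abbreviation "I \<equiv> chan_index N n"

sublocale F: prob_space "fading N n"
  unfolding fading_def by (rule prob_space_PiM) (rule cg)

lemma q1: "1 \<le> q" using n1[of 0] nq[of 0] by simp

lemma s_pos: "cgauss_variance > 0" by (rule cgauss_variance_pos[OF cg])

lemma measurable_scaled:
  assumes "\<And>p. p \<in> I \<Longrightarrow> u p \<in> borel_measurable (fading N n)"
  shows "(\<lambda>x. rp_log_det N n \<rho> (\<lambda>p. of_real c * (\<lambda>p\<in>I. of_real (u p x) * x p) p)) \<in> borel_measurable (fading N n)"
proof (rule measurable_rp_log_det)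
  fix p
  show "(\<lambda>x. of_real c * (\<lambda>p\<in>I. of_real (u p x) * x p) p) \<in> borel_measurable (fading N n)"
  proof (cases "p \<in> I")
    case True
    have "(\<lambda>x. x p) \<in> borel_measurable (fading N n)" unfolding fading_def by (rule measurable_PiM_coord)
    thus ?thesis using True assms[OF True]
      by (auto intro!: borel_measurable_times borel_measurable_continuous_on[OF continuous_on_of_real[OF continuous_on_id]])
  qed simp
qed

lemma measurable_clamped_factor:
  "(\<lambda>x. max t (relay_factor n \<kappa> \<rho> p x) / b) \<in> borel_measurable (cgauss_prod S)"
  using measurable_relay_factor[of n \<kappa> \<rho> p S] by measurable

text \<open>White noise of power \<open>b ^ (2 * N)\<close> dominates the accumulated noise while
  the fading is bounded. Such a power is the same as a factor \<open>1 / b\<close> on each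
  coefficient, which is merged with the relay factor.\<close>

lemma af_log_det_ge:
  assumes \<rho>: "1 \<le> \<rho>" and B: "1 \<le> B" and b: "0 < b"
    and w: "cgauss_variance * (real N * (real q)\<^sup>2 * ((real q * max 1 \<kappa> * B) ^ N)\<^sup>2) \<le> b ^ (2 * N)"
    and x: "\<And>p. p \<in> I \<Longrightarrow> cmod (x p) \<le> B"
  shows "rp_log_det N n \<rho> (\<lambda>p. of_real (relay_factor n \<kappa> \<rho> p x / b) * x p) \<le> af_log_det N n \<kappa> \<rho> x"
proof -
  define y where "y = (\<lambda>p. of_real (relay_factor n \<kappa> \<rho> p x) * x p)"
  define W where "W = noise_cov_mat cgauss_variance N n \<kappa> \<rho> (chan_mat n x)"
  have P: "chan_prod n N (chan_mat n y) \<in> carrier_mat (n N) (n 0)"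
    by (rule chan_prod_carrier[OF chan_mat_carrier])
  have pW: "pos_def (n N) W" unfolding W_def by (rule pos_def_noise_cov_mat[OF s_pos N])
  have b0: "0 < b ^ (2 * N)" using b by simp
  have "loewner_le (n N) W (of_real (b ^ (2 * N)) \<cdot>\<^sub>m 1\<^sub>m (n N))"
    unfolding W_def using \<rho> by (intro noise_cov_mat_loewner_le[OF \<kappa> _ B s_pos x nq q1 refl w]) auto
  hence "noisy_det (of_real (b ^ (2 * N)) \<cdot>\<^sub>m 1\<^sub>m (n N)) (chan_prod n N (chan_mat n y)) \<rho>
      \<le> noisy_det W (chan_prod n N (chan_mat n y)) \<rho>"
    using \<rho> by (intro noisy_det_antimono[OF pW pos_def_smult_one[OF b0] _ P]) auto
  moreover have "0 < noisy_det (of_real (b ^ (2 * N)) \<cdot>\<^sub>m 1\<^sub>m (n N)) (chan_prod n N (chan_mat n y)) \<rho>"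
    using \<rho> by (intro noisy_det_pos[OF pos_def_smult_one[OF b0] P]) auto
  ultimately have "rp_log_det N n (\<rho> / b ^ (2 * N)) y \<le> af_log_det N n \<kappa> \<rho> x"
    unfolding rp_log_det_def af_log_det_def y_def[symmetric] W_def[symmetric]
    unfolding noisy_det_smult_one[OF P b0] by (intro ln_mono)
  also have "\<rho> / b ^ (2 * N) = (1 / b) ^ (2 * N) * \<rho>" by (simp add: power_divide)
  also have "rp_log_det N n ((1 / b) ^ (2 * N) * \<rho>) y = rp_log_det N n \<rho> (\<lambda>p. of_real (1 / b) * y p)"
    by (rule rp_log_det_smult[symmetric])
  also have "(\<lambda>p. of_real (1 / b) * y p) = (\<lambda>p. of_real (relay_factor n \<kappa> \<rho> p x / b) * x p)"
    by (simp add: y_def fun_eq_iff)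
  finally show ?thesis .
qed

text \<open>Here the accumulated noise is bounded below by the destination noise, which holds for
  all fading values. The factor \<open>e\<close> per coefficient compensates a noise variance below
  1.\<close>

lemma af_log_det_le:
  assumes \<rho>: "1 \<le> \<rho>" and e: "0 < e" "1 \<le> e ^ (2 * N) * cgauss_variance"
  shows "af_log_det N n \<kappa> \<rho> x \<le> rp_log_det N n \<rho> (\<lambda>p. of_real (e * relay_factor n \<kappa> \<rho> p x) * x p)"
proof -
  define y where "y = (\<lambda>p. of_real (relay_factor n \<kappa> \<rho> p x) * x p)"
  define W where "W = noise_cov_mat cgauss_variance N n \<kappa> \<rho> (chan_mat n x)"
  have P: "chan_prod n N (chan_mat n y) \<in> carrier_mat (n N) (n 0)"
    by (rule chan_prod_carrier[OF chan_mat_carrier])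
  have pW: "pos_def (n N) W" unfolding W_def by (rule pos_def_noise_cov_mat[OF s_pos N])
  have "loewner_le (n N) (of_real cgauss_variance \<cdot>\<^sub>m 1\<^sub>m (n N)) W"
    unfolding W_def by (rule loewner_le_noise_cov_mat[OF s_pos N])
  hence "noisy_det W (chan_prod n N (chan_mat n y)) \<rho>
      \<le> noisy_det (of_real cgauss_variance \<cdot>\<^sub>m 1\<^sub>m (n N)) (chan_prod n N (chan_mat n y)) \<rho>"
    using \<rho> by (intro noisy_det_antimono[OF pos_def_smult_one[OF s_pos] pW _ P]) auto
  moreover have "0 < noisy_det W (chan_prod n N (chan_mat n y)) \<rho>"
    using \<rho> by (intro noisy_det_pos[OF pW P]) auto
  ultimately have "af_log_det N n \<kappa> \<rho> x \<le> rp_log_det N n (\<rho> / cgauss_variance) y"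
    unfolding rp_log_det_def af_log_det_def y_def[symmetric] W_def[symmetric]
    unfolding noisy_det_smult_one[OF P s_pos] by (intro ln_mono)
  also have "\<dots> \<le> rp_log_det N n (e ^ (2 * N) * \<rho>) y"
  proof (rule rp_log_det_mono)
    show "0 < \<rho> / cgauss_variance" using \<rho> s_pos by simp
    have "\<rho> * 1 \<le> \<rho> * (e ^ (2 * N) * cgauss_variance)" using e \<rho> by (intro mult_left_mono) auto
    thus "\<rho> / cgauss_variance \<le> e ^ (2 * N) * \<rho>" using s_pos by (simp add: pos_divide_le_eq mult_ac)
  qed
  also have "\<dots> = rp_log_det N n \<rho> (\<lambda>p. of_real e * y p)" by (rule rp_log_det_smult[symmetric])
  also have "(\<lambda>p. of_real e * y p) = (\<lambda>p. of_real (e * relay_factor n \<kappa> \<rho> p x) * x p)"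
    by (simp add: y_def fun_eq_iff)
  finally show ?thesis .
qed

text \<open>Unless the fading is large, an AF outage is an outage of the Rayleigh product with
  coefficients scaled by \<open>u\<close>. The number \<open>b\<close> has two tasks: it absorbs the
  noise, and it brings the gains below 1 as the scaling estimate demands.\<close>

lemma af_prob_le:
  assumes \<rho>: "1 \<le> \<rho>" and B: "1 \<le> B" and b: "max 1 \<kappa> \<le> b"
    and t: "0 < t" "t \<le> 1" "t \<le> \<kappa>" "2 * real q * B\<^sup>2 * t\<^sup>2 \<le> 1"
    and w: "cgauss_variance * (real N * (real q)\<^sup>2 * ((real q * max 1 \<kappa> * B) ^ N)\<^sup>2) \<le> b ^ (2 * N)"
  shows "af_prob \<rho> R \<le> large_prob B + (1 / (t / b)\<^sup>2) ^ card I * rp_prob \<rho> R"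
proof -
  \<comment> \<open>The scaling estimate needs its lower bound on the whole space. The maximum with
    \<open>t\<close> supplies it, keeps the factor predictable, and has no effect outside
    \<open>large_fading\<close>.\<close>
  define u where "u p x = max t (relay_factor n \<kappa> \<rho> p x) / b" for p x
  define S2 where "S2 = {x \<in> space (fading N n). rp_log_det N n \<rho> (\<lambda>p\<in>I. of_real (u p x) * x p) < R}"
  have b0: "0 < b" using b by simp
  have um: "u p \<in> borel_measurable (cgauss_prod S)" for p S
    unfolding u_def by (rule measurable_clamped_factor)
  have S2: "S2 \<in> sets (fading N n)"
  proof -
    have [measurable]: "(\<lambda>x. rp_log_det N n \<rho> (\<lambda>p\<in>I. of_real (u p x) * x p)) \<in> borel_measurable (fading N n)"
      using measurable_scaled[of u \<rho> 1, OF um[of _ I, folded fading_def]] by (simp only: of_real_1 mult_1)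
    show ?thesis unfolding S2_def by measurable
  qed
  have bound: "F.prob S2 \<le> (1 / (t / b)\<^sup>2) ^ card I * rp_prob \<rho> R"
    unfolding S2_def rp_prob_def fading_def
  proof (rule measure_predictable_scale_le[OF cg finite_chan_index, where lev=fst])
    show "0 < t / b" using t b0 by simp
    show "t / b \<le> u i x" for i x unfolding u_def using b0 by (intro divide_right_mono) auto
    show "u i x \<le> 1" for i x
      unfolding u_def using order_trans[OF relay_factor_bounds[of \<kappa> \<rho> n i x] b] \<kappa> \<rho> t b b0
      by (simp add: pos_divide_le_eq)
    show "u i x = u i y" if "\<And>j. fst j < fst i \<Longrightarrow> x j = y j" for i x y
      unfolding u_def using relay_factor_predictable[of i x y n \<kappa> \<rho>] that by simp
    show "rp_log_det N n \<rho> \<in> borel_measurable (cgauss_prod I)"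
      by (rule measurable_rp_log_det[OF measurable_PiM_coord])
  qed (rule um)
  have "{x \<in> space (fading N n). af_log_det N n \<kappa> \<rho> x < R} \<subseteq> large_fading N n B \<union> S2"
  proof
    fix x assume x: "x \<in> {x \<in> space (fading N n). af_log_det N n \<kappa> \<rho> x < R}"
    show "x \<in> large_fading N n B \<union> S2"
    proof (cases "x \<in> large_fading N n B")
      case False
      hence xB: "cmod (x p) \<le> B" if "p \<in> I" for p
        using x that by (auto simp: large_fading_def not_less)
      have "rp_log_det N n \<rho> (\<lambda>p\<in>I. of_real (u p x) * x p)
          = rp_log_det N n \<rho> (\<lambda>p. of_real (relay_factor n \<kappa> \<rho> p x / b) * x p)"
        using relay_factor_lower_bound[OF t B \<rho> n1 nq xB]
        by (intro rp_log_det_cong) (simp add: u_def max_absorb2)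
      also have "\<dots> \<le> af_log_det N n \<kappa> \<rho> x"
        by (rule af_log_det_ge[OF \<rho> B b0 w xB])
      also have "\<dots> < R" using x by simp
      finally show ?thesis using x by (simp add: S2_def)
    qed simp
  qed
  hence "af_prob \<rho> R \<le> F.prob (large_fading N n B \<union> S2)"
    unfolding af_prob_def using S2 large_fading(1)[OF cg, of B] B by (intro F.finite_measure_mono) auto
  also have "\<dots> \<le> large_prob B + F.prob S2"
    unfolding large_prob_def using S2 large_fading(1)[OF cg, of B] B by (intro measure_Un_le) auto
  finally show ?thesis using bound by linarith
qed

text \<open>The common factor \<open>e * max 1 \<kappa> * a \<le> 1\<close> can only lower the
  determinant, so it preserves outage. The scaling estimate then replaces the constant
  \<open>a\<close> by the true factors, and the resulting event is an AF outage unless the fading is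
  large.\<close>

lemma rp_prob_le:
  assumes \<rho>: "1 \<le> \<rho>" and B: "1 \<le> B"
    and t: "0 < t" "t \<le> 1" "t \<le> \<kappa>" "2 * real q * B\<^sup>2 * t\<^sup>2 \<le> 1"
    and e: "0 < e" "1 \<le> e ^ (2 * N) * cgauss_variance"
    and a: "0 < a" "a \<le> t / max 1 \<kappa>" "e * max 1 \<kappa> * a \<le> 1"
  shows "rp_prob \<rho> R \<le> (1 / a\<^sup>2) ^ card I * (af_prob \<rho> R + large_prob B)"
proof -
  define K where "K = max 1 \<kappa>"
  have K: "1 \<le> K" by (simp add: K_def)
  define u where "u p x = max t (relay_factor n \<kappa> \<rho> p x) / K" for p x
  \<comment> \<open>The factors \<open>u\<close> must not exceed 1, so the gains are divided by
    \<open>K\<close>. The function \<open>h\<close> restores \<open>K\<close> and at the same time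
    includes the noise compensation \<open>e\<close>.\<close>
  define h where "h y = rp_log_det N n \<rho> (\<lambda>p. of_real (e * K) * y p)" for y
  define S2 where "S2 = {x \<in> space (fading N n). h (\<lambda>p\<in>I. of_real (u p x) * x p) < R}"
  define S1 where "S1 = {x \<in> space (fading N n). h (\<lambda>p\<in>I. of_real a * x p) < R}"
  have um: "u p \<in> borel_measurable (cgauss_prod S)" for p S
    unfolding u_def by (rule measurable_clamped_factor)
  have S2: "S2 \<in> sets (fading N n)"
  proof -
    have [measurable]: "(\<lambda>x. h (\<lambda>p\<in>I. of_real (u p x) * x p)) \<in> borel_measurable (fading N n)"
      unfolding h_def using um unfolding fading_def by (intro measurable_scaled[unfolded fading_def])
    show ?thesis unfolding S2_def by measurable
  qed
  have S1: "S1 \<in> sets (fading N n)"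
  proof -
    have [measurable]: "(\<lambda>x. h (\<lambda>p\<in>I. of_real a * x p)) \<in> borel_measurable (fading N n)"
      unfolding h_def by (intro measurable_scaled) simp
    show ?thesis unfolding S1_def by measurable
  qed
  have "F.prob S1 \<le> (1 / a\<^sup>2) ^ card I * F.prob S2"
    unfolding S1_def S2_def fading_def
  proof (rule measure_le_predictable_scale[OF cg finite_chan_index, where lev=fst])
    show "0 < a" by (rule a)
    show "a \<le> u i x" for i x
    proof -
      have "a \<le> t / K" using a by (simp add: K_def)
      also have "\<dots> \<le> u i x" unfolding u_def using K by (intro divide_right_mono) auto
      finally show ?thesis .
    qed
    show "u i x \<le> 1" for i x
      unfolding u_def using relay_factor_bounds[of \<kappa> \<rho> n i x] \<kappa> \<rho> t K by (simp add: K_def pos_divide_le_eq)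
    show "u i x = u i y" if "\<And>j. fst j < fst i \<Longrightarrow> x j = y j" for i x y
      unfolding u_def using relay_factor_predictable[of i x y n \<kappa> \<rho>] that by simp
    show "h \<in> borel_measurable (cgauss_prod I)"
      unfolding h_def[abs_def]
      by (intro measurable_rp_log_det borel_measurable_times borel_measurable_const measurable_PiM_coord)
  qed (rule um)
  moreover have "rp_prob \<rho> R \<le> F.prob S1"
    unfolding rp_prob_def
  proof (intro F.finite_measure_mono S1 subsetI)
    fix x assume x: "x \<in> {x \<in> space (fading N n). rp_log_det N n \<rho> x < R}"
    have "h (\<lambda>p\<in>I. of_real a * x p) = rp_log_det N n \<rho> (\<lambda>p. of_real (e * K * a) * x p)"
      unfolding h_def by (intro rp_log_det_cong) simp
    also have "\<dots> \<le> rp_log_det N n \<rho> x"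
      using \<rho> e(1) K a by (intro rp_log_det_scale_le) (auto simp: K_def)
    also have "\<dots> < R" using x by simp
    finally show "x \<in> S1" using x by (simp add: S1_def)
  qed
  moreover have "F.prob S2 \<le> af_prob \<rho> R + large_prob B"
  proof -
    let ?A = "{x \<in> space (fading N n). af_log_det N n \<kappa> \<rho> x < R}"
    have A: "?A \<in> sets (fading N n)" using measurable_af_log_det[of N n \<kappa> \<rho>] by measurable
    have "S2 \<subseteq> ?A \<union> large_fading N n B"
    proof
      fix x assume x: "x \<in> S2"
      show "x \<in> ?A \<union> large_fading N n B"
      proof (cases "x \<in> large_fading N n B")
        case False
        hence xB: "cmod (x p) \<le> B" if "p \<in> I" for p
          using x that by (auto simp: large_fading_def S2_def not_less)
        have "af_log_det N n \<kappa> \<rho> x \<le> rp_log_det N n \<rho> (\<lambda>p. of_real (e * relay_factor n \<kappa> \<rho> p x) * x p)"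
          by (rule af_log_det_le[OF \<rho> e])
        also have "\<dots> = h (\<lambda>p\<in>I. of_real (u p x) * x p)"
          unfolding h_def using relay_factor_lower_bound[OF t B \<rho> n1 nq xB] K
          by (intro rp_log_det_cong) (simp add: u_def max_absorb2)
        also have "\<dots> < R" using x by (simp add: S2_def)
        finally show ?thesis using x by (simp add: S2_def)
      qed simp
    qed
    hence "F.prob S2 \<le> F.prob (?A \<union> large_fading N n B)"
      using A large_fading(1)[OF cg, of B] B by (intro F.finite_measure_mono) auto
    also have "\<dots> \<le> af_prob \<rho> R + large_prob B"
      unfolding af_prob_def large_prob_def using A large_fading(1)[OF cg, of B] B by (intro measure_Un_le) auto
    finally show ?thesis .
  qed
  moreover have "(1 / a\<^sup>2) ^ card I * F.prob S2 \<le> (1 / a\<^sup>2) ^ card I * (af_prob \<rho> R + large_prob B)"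
    using \<open>F.prob S2 \<le> _\<close> by (intro mult_left_mono) auto
  ultimately show ?thesis by linarith
qed

text \<open>With \<open>B = ln \<rho>\<close>, the choices \<open>t = B^-2\<close> and
  \<open>b = B^2\<close> give \<open>(t / b)^-2 = B^8\<close> per coefficient. In the other
  direction \<open>a = B^-3\<close> costs only \<open>B^6\<close>, which is enlarged to
  \<open>B^8\<close> for uniformity.\<close>

lemma comparison:
  "\<exists>B0\<ge>1. \<forall>\<rho> R. 0 < \<rho> \<longrightarrow> B0 \<le> ln \<rho> \<longrightarrow>
     af_prob \<rho> R \<le> large_prob (ln \<rho>) + (ln \<rho> ^ 8) ^ card I * rp_prob \<rho> R \<and>
     rp_prob \<rho> R \<le> (ln \<rho> ^ 8) ^ card I * (af_prob \<rho> R + large_prob (ln \<rho>))"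
proof -
  define s where "s = cgauss_variance"
  define K where "K = max 1 \<kappa>"
  define e where "e = max 1 (1 / s)"
  define w where "w = s * (real N * (real q)\<^sup>2 * ((real q * K) ^ N)\<^sup>2)"
  \<comment> \<open>A sum of nonnegative terms, each of which \<open>B\<close> has to dominate
    somewhere below.\<close>
  define B0 where "B0 = 1 + 1 / \<kappa> + 2 * real q + K + w + e * K"
  have s: "s > 0" unfolding s_def by (rule s_pos)
  have K: "1 \<le> K" by (simp add: K_def)
  have e1: "1 \<le> e" by (simp add: e_def)
  have e: "0 < e" "1 \<le> e ^ (2 * N) * s"
  proof -
    have "1 \<le> e * s" using s by (auto simp: e_def max_def field_simps)
    also have "e * s \<le> e ^ (2 * N) * s"
      using s e1 N self_le_power[of e "2 * N"] by (intro mult_right_mono) auto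
    finally show "1 \<le> e ^ (2 * N) * s" .
  qed (use e1 in simp)
  have w0: "0 \<le> w" using s by (simp add: w_def)
  have eK: "0 \<le> e * K" using e1 K by simp
  have pos: "0 \<le> 1 / \<kappa>" "0 \<le> 2 * real q" using \<kappa> by auto
  have "af_prob \<rho> R \<le> large_prob (ln \<rho>) + (ln \<rho> ^ 8) ^ card I * rp_prob \<rho> R \<and>
     rp_prob \<rho> R \<le> (ln \<rho> ^ 8) ^ card I * (af_prob \<rho> R + large_prob (ln \<rho>))"
    if \<rho>0: "0 < \<rho>" and L: "B0 \<le> ln \<rho>" for \<rho> R
  proof -
    define B where "B = ln \<rho>"
    have B: "1 \<le> B" "1 / \<kappa> \<le> B" "2 * real q \<le> B" "K \<le> B" "w \<le> B" "e * K \<le> B"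
      using L w0 eK pos K unfolding B_def B0_def by linarith+
    have \<rho>: "1 \<le> \<rho>" using B(1) \<rho>0 ln_ge_zero_iff[of \<rho>] unfolding B_def by linarith
    \<comment> \<open>\<open>t\<close> is a lower bound for the gains and \<open>B\<^sup>2\<close> plays the role of \<open>b\<close> in \<open>af_prob_le\<close>\<close>
    define t where "t = 1 / B\<^sup>2"
    have B2: "B \<le> B\<^sup>2" and B3: "B \<le> B ^ 3" using B(1) by (auto intro: self_le_power)
    have t: "0 < t" "t \<le> 1" using B(1) by (auto simp: t_def one_le_power)
    have t\<kappa>: "t \<le> \<kappa>"
    proof -
      have "t \<le> 1 / B" unfolding t_def using B(1) B2 by (intro divide_left_mono) auto
      also have "\<dots> \<le> \<kappa>" using B(1,2) \<kappa> by (simp add: field_simps)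
      finally show ?thesis .
    qed
    have tq: "2 * real q * B\<^sup>2 * t\<^sup>2 \<le> 1"
    proof -
      have "2 * real q * B\<^sup>2 * t\<^sup>2 = 2 * real q / B\<^sup>2"
        using B(1) by (simp add: t_def power2_eq_square field_simps)
      also have "\<dots> \<le> 1" using B(1,3) B2 by (simp add: divide_le_eq_1)
      finally show ?thesis .
    qed
    have b: "max 1 \<kappa> \<le> B\<^sup>2" using B(4) B2 by (simp add: K_def)
    have wb: "cgauss_variance * (real N * (real q)\<^sup>2 * ((real q * max 1 \<kappa> * B) ^ N)\<^sup>2) \<le> (B\<^sup>2) ^ (2 * N)"
    proof -
      have "cgauss_variance * (real N * (real q)\<^sup>2 * ((real q * max 1 \<kappa> * B) ^ N)\<^sup>2) = w * B ^ (2 * N)"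
      proof -
        have "((real q * K * B) ^ N)\<^sup>2 = ((real q * K) ^ N)\<^sup>2 * B ^ (2 * N)"
          unfolding power_mult_distrib[of _ B] power_mult_distrib[of _ "B ^ N"] power_mult[symmetric]
          by (simp only: mult.commute[of N])
        thus ?thesis by (simp add: w_def s_def K_def)
      qed
      also have "\<dots> \<le> B ^ (2 * N) * B ^ (2 * N)"
        using B(1,5) N self_le_power[of B "2 * N"] by (intro mult_right_mono) auto
      also have "\<dots> = (B\<^sup>2) ^ (2 * N)" by (simp add: power_mult[symmetric] power_add[symmetric])
      finally show ?thesis .
    qed
    \<comment> \<open>One more power of \<open>B\<close> than in \<open>t\<close>: it absorbs the
      division by \<open>K\<close> in \<open>a \<le> t / K\<close>, and \<open>e * K \<le> B\<close>
      then gives the other condition.\<close>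
    define a where "a = 1 / B ^ 3"
    have a0: "0 < a" using B(1) by (simp add: a_def)
    have a1: "a \<le> t / max 1 \<kappa>"
    proof -
      have "B\<^sup>2 * K \<le> B ^ 3" using B(1,4) by (simp add: power3_eq_cube power2_eq_square)
      moreover have "0 < B\<^sup>2 * K" using B(1) K by simp
      ultimately have "1 / B ^ 3 \<le> 1 / (B\<^sup>2 * K)" by (intro frac_le) auto
      thus ?thesis by (simp add: a_def t_def K_def)
    qed
    have a2: "e * max 1 \<kappa> * a \<le> 1"
      using B(1,6) B3 by (simp add: a_def K_def[symmetric] divide_le_eq_1)
    have "(1 / (t / B\<^sup>2)\<^sup>2) = B ^ 8"
      using B(1) by (simp add: t_def power_divide power_mult[symmetric] power_add[symmetric] field_simps)
    hence A: "af_prob \<rho> R \<le> large_prob B + (B ^ 8) ^ card I * rp_prob \<rho> R"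
      using af_prob_le[OF \<rho> B(1) b t t\<kappa> tq wb, of R] by simp
    have "(1 / a\<^sup>2) ^ card I \<le> (B ^ 8) ^ card I"
    proof (rule power_mono)
      have "1 / a\<^sup>2 = B ^ 6" by (simp add: a_def power_divide power_mult[symmetric])
      also have "\<dots> \<le> B ^ 8" using B(1) by (intro power_increasing) auto
      finally show "1 / a\<^sup>2 \<le> B ^ 8" .
    qed simp
    hence "(1 / a\<^sup>2) ^ card I * (af_prob \<rho> R + large_prob B) \<le> (B ^ 8) ^ card I * (af_prob \<rho> R + large_prob B)"
      by (intro mult_right_mono) (auto simp: af_prob_def large_prob_def)
    with rp_prob_le[OF \<rho> B(1) t t\<kappa> tq e[unfolded s_def] a0 a1 a2, of R] A
    show ?thesis unfolding B_def[symmetric] by linarith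
  qed
  moreover have "1 \<le> B0" using w0 eK pos K unfolding B0_def by linarith
  ultimately show ?thesis by blast
qed

end

section \<open>Exponents\<close>

lemma tendsto_det_one_add_smult:
  fixes A :: "complex mat"
  assumes A: "A \<in> carrier_mat n n" and c: "c \<longlonglongrightarrow> 0"
  shows "(\<lambda>m. det (1\<^sub>m n + c m \<cdot>\<^sub>m A)) \<longlonglongrightarrow> 1"
proof -
  have "(\<lambda>m. \<Sum>p\<in>{p. p permutes {0..<n}}. signof p * (\<Prod>i=0..<n. (1\<^sub>m n + c m \<cdot>\<^sub>m A) $$ (i, p i)))
     \<longlonglongrightarrow> (\<Sum>p\<in>{p. p permutes {0..<n}}. signof p * (\<Prod>i=0..<n. (1\<^sub>m n :: complex mat) $$ (i, p i)))"
  proof (intro tendsto_sum tendsto_mult tendsto_const tendsto_prod)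
    fix p i assume "p \<in> {p. p permutes {0..<n}}" "i \<in> {0..<n}"
    hence i: "i < n" "p i < n" by (auto dest: permutes_in_image)
    have "(\<lambda>m. 1\<^sub>m n $$ (i, p i) + c m * A $$ (i, p i)) \<longlonglongrightarrow> 1\<^sub>m n $$ (i, p i) + 0 * A $$ (i, p i)"
      by (intro tendsto_intros c)
    thus "(\<lambda>m. (1\<^sub>m n + c m \<cdot>\<^sub>m A) $$ (i, p i)) \<longlonglongrightarrow> 1\<^sub>m n $$ (i, p i)"
      using i A by simp
  qed
  moreover have "det (1\<^sub>m n + c m \<cdot>\<^sub>m A)
      = (\<Sum>p\<in>{p. p permutes {0..<n}}. signof p * (\<Prod>i=0..<n. (1\<^sub>m n + c m \<cdot>\<^sub>m A) $$ (i, p i)))" for m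
    using A by (intro det_def') auto
  moreover have "(\<Sum>p\<in>{p. p permutes {0..<n}}. signof p * (\<Prod>i=0..<n. (1\<^sub>m n :: complex mat) $$ (i, p i))) = 1"
    using det_def'[of "1\<^sub>m n :: complex mat" n] by simp
  ultimately show ?thesis by simp
qed

text \<open>With \<open>Q = (ln \<rho>)^(8 k)\<close>, even \<open>Q * bad\<close> is at most half
  of the polynomially small \<open>p\<close>. Hence \<open>p / (2 Q) \<le> a \<le> 2 Q p\<close>,
  which also makes \<open>a\<close> positive, and \<open>ln (2 Q)\<close> is negligible against
  \<open>ln \<rho>\<close>.\<close>

lemma tendsto_ln_ratio_comparison:
  fixes a p bad :: "real \<Rightarrow> real" and k :: nat
  assumes upper: "eventually (\<lambda>\<rho>. a \<rho> \<le> bad \<rho> + (ln \<rho> ^ 8) ^ k * p \<rho>) at_top"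
    and lower: "eventually (\<lambda>\<rho>. p \<rho> \<le> (ln \<rho> ^ 8) ^ k * (a \<rho> + bad \<rho>)) at_top"
    and bad: "eventually (\<lambda>\<rho>. bad \<rho> \<le> real k * (2 * exp (- (ln \<rho>)\<^sup>2 / 2))) at_top"
    and poly: "\<delta> > 0" "eventually (\<lambda>\<rho>. \<delta> / (\<rho>\<^sup>2) ^ k \<le> p \<rho>) at_top"
  shows "((\<lambda>\<rho>. ln (a \<rho>) / ln \<rho> - ln (p \<rho>) / ln \<rho>) \<longlongrightarrow> 0) at_top"
proof -
  have "filterlim (\<lambda>\<rho>::real. ln \<rho>) at_top at_top" by (rule ln_at_top)
  hence big: "eventually (\<lambda>\<rho>. C \<le> ln \<rho>) at_top" for C :: real
    unfolding filterlim_at_top by blast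
  have bound: "eventually (\<lambda>\<rho>. norm (ln (a \<rho>) / ln \<rho> - ln (p \<rho>) / ln \<rho>)
      \<le> ln 2 * (1 / ln \<rho>) + 8 * real k * (ln (ln \<rho>) / ln \<rho>)) at_top"
    \<comment> \<open>With \<open>B = ln \<rho>\<close>, the first threshold makes
      \<open>8 k B - B^2 / 2\<close> at most \<open>- B - 2 k B\<close>. The spare
      \<open>exp (- B)\<close> then beats the constants, for which the second threshold
      \<open>4 k / \<delta>\<close> is made.\<close>
    using upper lower bad poly(2) big[of "20 * real k + 2"] big[of "4 * real k / \<delta>"] eventually_gt_at_top[of 0]
  proof eventually_elim
    case (elim \<rho>)
    define B where "B = ln \<rho>"
    define Q where "Q = (B ^ 8) ^ k"
    have B: "20 * real k + 2 \<le> B" "4 * real k / \<delta> \<le> B" using elim unfolding B_def by auto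
    hence B1: "1 \<le> B" by simp
    have \<rho>: "\<rho> = exp B" using elim by (simp add: B_def)
    have Q1: "1 \<le> Q" using B1 by (simp add: Q_def one_le_power)
    have Qk: "Q = B ^ (8 * k)" by (simp add: Q_def power_mult)
    have Q2: "Q \<le> exp (8 * real k * B)"
    proof -
      have "B \<le> exp B" using exp_ge_add_one_self[of B] by linarith
      hence "B ^ (8 * k) \<le> exp B ^ (8 * k)" using B1 by (intro power_mono) auto
      also have "\<dots> = exp (8 * real k * B)" by (simp add: exp_of_nat_mult[symmetric])
      finally show ?thesis by (simp add: Qk)
    qed
    have pd: "\<delta> * exp (- (2 * real k * B)) \<le> p \<rho>"
    proof -
      have "(\<rho>\<^sup>2) ^ k = exp (2 * real k * B)"
        unfolding \<rho> by (simp add: exp_of_nat_mult[symmetric] power_mult[symmetric])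
      thus ?thesis using elim(4) by (simp add: exp_minus divide_inverse)
    qed
    have p0: "0 < p \<rho>" using pd poly(1) by (meson exp_gt_zero mult_pos_pos less_le_trans)
    have small: "Q * bad \<rho> \<le> p \<rho> / 2"
    proof -
      have "Q * bad \<rho> \<le> Q * (real k * (2 * exp (- B\<^sup>2 / 2)))"
        using elim(3) Q1 unfolding B_def by (intro mult_left_mono) auto
      also have "\<dots> \<le> exp (8 * real k * B) * (real k * (2 * exp (- B\<^sup>2 / 2)))"
        using Q2 by (intro mult_right_mono) auto
      also have "\<dots> = 2 * real k * exp (8 * real k * B - B\<^sup>2 / 2)"
      proof -
        have "exp (8 * real k * B) * exp (- B\<^sup>2 / 2) = exp (8 * real k * B - B\<^sup>2 / 2)"
          by (simp add: mult_exp_exp)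
        thus ?thesis by (simp only: mult_ac)
      qed
      also have "\<dots> \<le> 2 * real k * exp (- B - 2 * real k * B)"
      proof -
        have "(20 * real k + 2) * B \<le> B * B" using B(1) B1 by (intro mult_right_mono) auto
        hence "8 * real k * B - B\<^sup>2 / 2 \<le> - B - 2 * real k * B"
          by (simp add: power2_eq_square algebra_simps)
        thus ?thesis by (intro mult_left_mono) auto
      qed
      also have "\<dots> = 2 * real k * exp (- B) * exp (- (2 * real k * B))"
        by (simp add: mult_exp_exp)
      also have "\<dots> \<le> \<delta> / 2 * exp (- (2 * real k * B))"
      proof (rule mult_right_mono)
        have "4 * real k \<le> \<delta> * B" using B(2) poly(1) by (simp add: pos_divide_le_eq mult.commute)
        also have "\<dots> \<le> \<delta> * exp B"
        proof (rule mult_left_mono)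
          show "B \<le> exp B" using exp_ge_add_one_self[of B] by linarith
        qed (use poly(1) in simp)
        finally show "2 * real k * exp (- B) \<le> \<delta> / 2"
          by (simp add: exp_minus field_simps)
      qed simp
      also have "\<dots> \<le> p \<rho> / 2" using pd by simp
      finally show ?thesis .
    qed
    have bad2: "bad \<rho> \<le> p \<rho> / 2"
    proof (cases "bad \<rho> \<le> 0")
      case False
      hence "1 * bad \<rho> \<le> Q * bad \<rho>" using Q1 by (intro mult_right_mono) auto
      thus ?thesis using small by simp
    qed (use p0 in simp)
    have lo: "p \<rho> / (2 * Q) \<le> a \<rho>"
    proof -
      have "p \<rho> \<le> Q * a \<rho> + Q * bad \<rho>" using elim(2) unfolding B_def[symmetric] Q_def[symmetric]
        by (simp add: distrib_left)
      hence "p \<rho> / 2 \<le> Q * a \<rho>" using small by linarith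
      thus ?thesis using Q1 by (simp add: field_simps)
    qed
    have up: "a \<rho> \<le> 2 * Q * p \<rho>"
    proof -
      have "a \<rho> \<le> bad \<rho> + Q * p \<rho>" using elim(1) unfolding B_def[symmetric] Q_def[symmetric] .
      moreover have "1 * p \<rho> \<le> Q * p \<rho>" using Q1 p0 by (intro mult_right_mono) auto
      ultimately show ?thesis using bad2 p0 by linarith
    qed
    have "0 < p \<rho> / (2 * Q)" using p0 Q1 by simp
    hence a0: "0 < a \<rho>" using lo by linarith
    have lnQ: "ln (2 * Q) = ln 2 + 8 * real k * ln B"
      using B1 Q1 by (simp add: ln_mult Qk ln_realpow)
    have "ln (a \<rho>) \<le> ln (2 * Q * p \<rho>)" using a0 up by (intro ln_mono)
    moreover have "ln (2 * Q * p \<rho>) = ln (2 * Q) + ln (p \<rho>)" using Q1 p0 by (intro ln_mult_pos) auto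
    moreover have "ln (p \<rho> / (2 * Q)) \<le> ln (a \<rho>)" using p0 Q1 lo by (intro ln_mono) auto
    moreover have "ln (p \<rho> / (2 * Q)) = ln (p \<rho>) - ln (2 * Q)" using Q1 p0 by (intro ln_divide_pos) auto
    ultimately have "\<bar>ln (a \<rho>) - ln (p \<rho>)\<bar> \<le> ln 2 + 8 * real k * ln B" unfolding lnQ by linarith
    hence "\<bar>ln (a \<rho>) - ln (p \<rho>)\<bar> / B \<le> (ln 2 + 8 * real k * ln B) / B"
      using B1 by (intro divide_right_mono) auto
    thus ?case unfolding B_def[symmetric] diff_divide_distrib[symmetric]
      using B1 by (simp add: add_divide_distrib)
  qed
  have "((\<lambda>\<rho>::real. 1 / ln \<rho>) \<longlongrightarrow> 0) at_top" "((\<lambda>\<rho>::real. ln (ln \<rho>) / ln \<rho>) \<longlongrightarrow> 0) at_top"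
    by real_asymp+
  hence "((\<lambda>\<rho>::real. ln 2 * (1 / ln \<rho>) + 8 * real k * (ln (ln \<rho>) / ln \<rho>)) \<longlongrightarrow> ln 2 * 0 + 8 * real k * 0) at_top"
    by (intro tendsto_add tendsto_mult tendsto_const)
  hence "((\<lambda>\<rho>::real. ln 2 * (1 / ln \<rho>) + 8 * real k * (ln (ln \<rho>) / ln \<rho>)) \<longlongrightarrow> 0) at_top" by simp
  with bound show ?thesis by (rule Lim_null_comparison)
qed

context relay_network
begin

text \<open>As the SNR tends to 0 so does the log-determinant, pointwise; by continuity from below
  some fixed SNR \<open>c\<close> has outage with positive probability at rate \<open>R1\<close>.
  Scaling the coefficients by \<open>c / \<rho>\<close> lowers the SNR from \<open>\<rho>\<close> to
  at most \<open>c\<close>, and the scaling estimate bounds the price by a power of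
  \<open>\<rho>\<close>.\<close>

lemma rp_prob_lower:
  assumes "0 < R1"
  shows "\<exists>\<delta>>0. \<forall>\<rho>\<ge>1. \<forall>R\<ge>R1. \<delta> / (\<rho>\<^sup>2) ^ card I \<le> rp_prob \<rho> R"
proof -
  define A where "A m = {x \<in> space (fading N n). rp_log_det N n (1 / real (Suc m)) x < R1}" for m :: nat
  have meas: "rp_log_det N n \<rho> \<in> borel_measurable (fading N n)" for \<rho>
    unfolding fading_def by (rule measurable_rp_log_det[OF measurable_PiM_coord])
  have A: "A m \<in> sets (fading N n)" for m
    unfolding A_def using meas by measurable
  have "incseq A"
  proof (rule incseq_SucI)
    fix m
    have "rp_log_det N n (1 / real (Suc (Suc m))) x \<le> rp_log_det N n (1 / real (Suc m)) x" for x
      by (intro rp_log_det_mono divide_left_mono) auto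
    thus "A m \<subseteq> A (Suc m)" unfolding A_def by (auto intro: le_less_trans)
  qed
  moreover have "(\<Union>m. A m) = space (fading N n)"
  proof -
    have "\<exists>m. rp_log_det N n (1 / real (Suc m)) x < R1" for x
    proof -
      define P where "P = chan_prod n N (chan_mat n x)"
      have P: "P \<in> carrier_mat (n N) (n 0)"
        unfolding P_def by (rule chan_prod_carrier[OF chan_mat_carrier])
      have PP: "P * mat_adjoint P \<in> carrier_mat (n N) (n N)"
        by (rule mult_carrier_mat[OF P mat_adjoint_carrier[OF P]])
      have "(\<lambda>m. of_real (1 / real (Suc m)) :: complex) \<longlonglongrightarrow> of_real 0"
        by (intro tendsto_of_real) (use LIMSEQ_inverse_real_of_nat in \<open>simp add: inverse_eq_divide\<close>)
      hence "(\<lambda>m. of_real (1 / real (Suc m)) :: complex) \<longlonglongrightarrow> 0" by simp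
      from tendsto_det_one_add_smult[OF PP this]
      have "(\<lambda>m. Re (det (1\<^sub>m (n N) + of_real (1 / real (Suc m)) \<cdot>\<^sub>m (P * mat_adjoint P)))) \<longlonglongrightarrow> Re 1"
        by (rule tendsto_Re)
      hence "(\<lambda>m. noisy_det (1\<^sub>m (n N)) P (1 / real (Suc m))) \<longlonglongrightarrow> 1"
        unfolding noisy_det_def by simp
      hence "(\<lambda>m. ln (noisy_det (1\<^sub>m (n N)) P (1 / real (Suc m)))) \<longlonglongrightarrow> ln 1"
        by (intro tendsto_ln) auto
      hence "(\<lambda>m. rp_log_det N n (1 / real (Suc m)) x) \<longlonglongrightarrow> 0"
        unfolding rp_log_det_def P_def by simp
      from order_tendstoD(2)[OF this assms] show ?thesis
        by (auto dest: eventually_happens)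
    qed
    thus ?thesis unfolding A_def by auto
  qed
  ultimately have "(\<lambda>m. F.prob (A m)) \<longlonglongrightarrow> F.prob (space (fading N n))"
    using F.finite_Lim_measure_incseq[of A] A by auto
  hence "(\<lambda>m. F.prob (A m)) \<longlonglongrightarrow> 1" by (simp add: F.prob_space)
  from order_tendstoD(1)[OF this, of 0] obtain m where m: "0 < F.prob (A m)"
    by (auto dest: eventually_happens)
  define c where "c = 1 / real (Suc m)"
  have c: "0 < c" "c \<le> 1" by (auto simp: c_def)
  define \<delta> where "\<delta> = F.prob (A m) * (c\<^sup>2) ^ card I"
  have "\<delta> / (\<rho>\<^sup>2) ^ card I \<le> rp_prob \<rho> R" if \<rho>: "1 \<le> \<rho>" and R: "R1 \<le> R" for \<rho> R
  proof -
    \<comment> \<open>The effective SNR is \<open>s ^ (2 * N) * \<rho>\<close>. Since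
      \<open>s \<le> 1\<close> and \<open>N \<ge> 1\<close>, it is at most
      \<open>s * \<rho> = c\<close>.\<close>
    define s where "s = c / \<rho>"
    have s: "0 < s" "s \<le> 1" using c \<rho> by (auto simp: s_def)
    let ?S = "{x \<in> space (fading N n). rp_log_det N n \<rho> (\<lambda>p\<in>I. of_real s * x p) < R}"
    have S: "?S \<in> sets (fading N n)"
      using measurable_scaled[of "\<lambda>_ _. s" \<rho> 1] by (simp del: restrict_apply) measurable
    have "F.prob (A m) \<le> F.prob ?S"
    proof (intro F.finite_measure_mono S subsetI)
      fix x assume x: "x \<in> A m"
      have "rp_log_det N n \<rho> (\<lambda>p\<in>I. of_real s * x p) = rp_log_det N n \<rho> (\<lambda>p. of_real s * x p)"
        by (intro rp_log_det_cong) simp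
      also have "\<dots> = rp_log_det N n (s ^ (2 * N) * \<rho>) x" by (rule rp_log_det_smult)
      also have "\<dots> \<le> rp_log_det N n c x"
      proof (rule rp_log_det_mono)
        show "0 < s ^ (2 * N) * \<rho>" using s \<rho> by simp
        have "s ^ (2 * N) \<le> s ^ 1" using s N by (intro power_decreasing) auto
        hence "s ^ (2 * N) * \<rho> \<le> s * \<rho>" using \<rho> by (intro mult_right_mono) auto
        thus "s ^ (2 * N) * \<rho> \<le> c" using \<rho> by (simp add: s_def)
      qed
      also have "\<dots> < R" using x R by (simp add: A_def c_def)
      finally show "x \<in> ?S" using x by (simp add: A_def)
    qed
    also have "\<dots> \<le> (1 / s\<^sup>2) ^ card I * rp_prob \<rho> R"
      unfolding rp_prob_def fading_def
      by (rule measure_predictable_scale_le[OF cg finite_chan_index, where lev=fst])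
         (use s meas[unfolded fading_def] in auto)
    also have "(1 / s\<^sup>2) ^ card I = (\<rho>\<^sup>2) ^ card I / (c\<^sup>2) ^ card I"
      using c \<rho> by (simp add: s_def power_divide)
    finally have "F.prob (A m) \<le> (\<rho>\<^sup>2) ^ card I / (c\<^sup>2) ^ card I * rp_prob \<rho> R" .
    moreover have "0 < (c\<^sup>2) ^ card I" "0 < (\<rho>\<^sup>2) ^ card I" using c \<rho> by auto
    ultimately show ?thesis unfolding \<delta>_def by (simp add: field_simps)
  qed
  moreover have "0 < \<delta>" using m c by (simp add: \<delta>_def)
  ultimately show ?thesis by blast
qed

lemma log_ratio_difference:
  assumes R: "eventually (\<lambda>\<rho>. R1 \<le> R \<rho>) at_top" and R1: "0 < R1"
  shows "((\<lambda>\<rho>. ln (af_prob \<rho> (R \<rho>)) / ln \<rho> - ln (rp_prob \<rho> (R \<rho>)) / ln \<rho>) \<longlongrightarrow> 0) at_top"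
proof -
  obtain B0 where B0: "1 \<le> B0" and cmp: "\<And>\<rho> R. 0 < \<rho> \<Longrightarrow> B0 \<le> ln \<rho> \<Longrightarrow>
     af_prob \<rho> R \<le> large_prob (ln \<rho>) + (ln \<rho> ^ 8) ^ card I * rp_prob \<rho> R \<and>
     rp_prob \<rho> R \<le> (ln \<rho> ^ 8) ^ card I * (af_prob \<rho> R + large_prob (ln \<rho>))"
    using comparison by blast
  obtain \<delta> where \<delta>: "\<delta> > 0" "\<And>\<rho> R. 1 \<le> \<rho> \<Longrightarrow> R1 \<le> R \<Longrightarrow> \<delta> / (\<rho>\<^sup>2) ^ card I \<le> rp_prob \<rho> R"
    using rp_prob_lower[OF R1] by blast
  have "eventually (\<lambda>\<rho>::real. B0 \<le> ln \<rho>) at_top"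
    using ln_at_top unfolding filterlim_at_top by blast
  hence ev: "eventually (\<lambda>\<rho>. 1 \<le> \<rho> \<and> B0 \<le> ln \<rho> \<and> R1 \<le> R \<rho>) at_top"
    using eventually_ge_at_top[of 1] R by eventually_elim auto
  show ?thesis
  proof (rule tendsto_ln_ratio_comparison[where bad="\<lambda>\<rho>. large_prob (ln \<rho>)" and k="card I" and \<delta>=\<delta>])
    show "eventually (\<lambda>\<rho>. af_prob \<rho> (R \<rho>) \<le> large_prob (ln \<rho>) + (ln \<rho> ^ 8) ^ card I * rp_prob \<rho> (R \<rho>)) at_top"
      using ev by eventually_elim (use cmp in auto)
    show "eventually (\<lambda>\<rho>. rp_prob \<rho> (R \<rho>) \<le> (ln \<rho> ^ 8) ^ card I * (af_prob \<rho> (R \<rho>) + large_prob (ln \<rho>))) at_top"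
      using ev by eventually_elim (use cmp in auto)
    show "eventually (\<lambda>\<rho>. large_prob (ln \<rho>) \<le> real (card I) * (2 * exp (- (ln \<rho>)\<^sup>2 / 2))) at_top"
      using ev by eventually_elim (use B0 large_fading(2)[OF cg] in \<open>simp add: large_prob_def\<close>)
    show "eventually (\<lambda>\<rho>. \<delta> / (\<rho>\<^sup>2) ^ card I \<le> rp_prob \<rho> (R \<rho>)) at_top"
      using ev by eventually_elim (use \<delta> in auto)
  qed (rule \<delta>)
qed

end

text \<open>Treats the fixed rates at \<open>r = 0\<close> and the growing rates at
  \<open>r > 0\<close> alike: both eventually stay above a positive constant, the form in which
  \<open>rp_prob_lower\<close> uses the rate.\<close>

lemma rate_of_gain_eventually_ge:
  assumes "rate_of_gain r R" "0 \<le> r"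
  obtains R1 where "0 < R1" "eventually (\<lambda>\<rho>. R1 \<le> R \<rho>) at_top"
proof (cases "r = 0")
  case True
  thus ?thesis using assms that by (auto simp: rate_of_gain_def)
next
  case False
  hence R: "R = (\<lambda>\<rho>. r * ln \<rho>)" using assms by (simp add: rate_of_gain_def)
  have "eventually (\<lambda>\<rho>::real. 1 \<le> ln \<rho>) at_top"
    using ln_at_top unfolding filterlim_at_top by blast
  hence "eventually (\<lambda>\<rho>. r \<le> R \<rho>) at_top"
    unfolding R by eventually_elim (use assms(2) mult_left_mono[of 1 _ r] in simp)
  thus ?thesis using that[of r] assms False by auto
qed

text \<open>The equivalence for every \<open>d\<close> says that one limit exists exactly when the
  other does, with the same value. It follows because the difference of the two exponents tends to
  0.\<close>

theorem mainTheorem4: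
  fixes M :: "'w measure" and M' :: "'v measure"
    and N :: nat and n :: "nat \<Rightarrow> nat" and \<kappa> :: real
    and H :: "nat \<Rightarrow> 'w \<Rightarrow> complex mat" and z :: "nat \<Rightarrow> 'w \<Rightarrow> complex vec"
    and G :: "nat \<Rightarrow> 'v \<Rightarrow> complex mat"
  assumes "prob_space M" and "prob_space M'"
    and "N \<ge> 1" and "\<And>i. i \<le> N \<Longrightarrow> n i \<ge> 1"
    and "\<kappa> > 0"
    and "multihop M N n H z"
    and "rayleigh_product M' N (\<lambda>i. n (N - i)) G"
  shows "\<forall>r \<ge> 0. \<forall>d. has_dmt M (af_matrix M N n \<kappa> H z) r d
           \<longleftrightarrow> has_dmt M' (\<lambda>\<rho>. rp_matrix N (\<lambda>i. n (N - i)) G) r d"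
proof (intro allI impI)
  fix r d :: real assume r: "0 \<le> r"
  have "complex_std_normal M (\<lambda>\<omega>. H 1 \<omega> $$ (0, 0))"
    using assms(3,6) assms(4)[of 0] assms(4)[of 1] unfolding multihop_def by auto
  hence cg: "prob_space cgauss"
    using prob_space.prob_space_distr[OF assms(1)] complex_std_normalD by metis
  interpret relay_network N n \<kappa> "Max (n ` {..N})"
    by (rule relay_network.intro[OF cg assms(3,4) _ assms(5)]) (auto intro: Max_ge)
  have af: "outage_prob M (af_matrix M N n \<kappa> H z \<rho>) \<rho> R = af_prob \<rho> R" for \<rho> R
    unfolding af_prob_def by (rule outage_prob_af_matrix[OF assms(1,3,4,6)])
  have rp: "outage_prob M' (rp_matrix N (\<lambda>i. n (N - i)) G) \<rho> R = rp_prob \<rho> R" for \<rho> R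
    unfolding rp_prob_def by (rule outage_prob_rp_matrix[OF assms(2,3,4,7)])
  have "((\<lambda>\<rho>. - (ln (af_prob \<rho> (R \<rho>)) / ln \<rho>)) \<longlongrightarrow> d) at_top
      \<longleftrightarrow> ((\<lambda>\<rho>. - (ln (rp_prob \<rho> (R \<rho>)) / ln \<rho>)) \<longlongrightarrow> d) at_top"
    if gain: "rate_of_gain r R" for R
  proof -
    obtain R1 where R1: "0 < R1" "eventually (\<lambda>\<rho>. R1 \<le> R \<rho>) at_top"
      using rate_of_gain_eventually_ge[OF gain r] .
    note L = log_ratio_difference[OF R1(2,1)]
    show ?thesis
    proof
      assume "((\<lambda>\<rho>. - (ln (af_prob \<rho> (R \<rho>)) / ln \<rho>)) \<longlongrightarrow> d) at_top"
      from tendsto_add[OF this L] show "((\<lambda>\<rho>. - (ln (rp_prob \<rho> (R \<rho>)) / ln \<rho>)) \<longlongrightarrow> d) at_top" by simp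
    next
      assume "((\<lambda>\<rho>. - (ln (rp_prob \<rho> (R \<rho>)) / ln \<rho>)) \<longlongrightarrow> d) at_top"
      from tendsto_diff[OF this L] show "((\<lambda>\<rho>. - (ln (af_prob \<rho> (R \<rho>)) / ln \<rho>)) \<longlongrightarrow> d) at_top" by simp
    qed
  qed
  thus "has_dmt M (af_matrix M N n \<kappa> H z) r d \<longleftrightarrow> has_dmt M' (\<lambda>\<rho>. rp_matrix N (\<lambda>i. n (N - i)) G) r d"
    unfolding has_dmt_def af rp by blast
qed

end
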